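(* Let $A\in\mathbb R^{K\times d}$, $y\in\mathbb R^K$, let $\Gamma\in\mathbb R^{K\times K}$ and $C_0\in\mathbb R^{d\times d}$ be symmetric positive definite, and let $J\ge 2$. Let $R:\mathbb R^d\to(-\infty,\infty]$ be proper, closed, convex and lower semicontinuous with $\inf_{x\in\mathbb R^d}R(x)>-\infty$. Let $x_0^{(j)}\in\mathbb R^d$, $j=1,\dots,J$, be such that the initial empirical covariance $$C(0)=\frac1J\sum_{j=1}^J (x_0^{(j)}-\bar x_0)(x_0^{(j)}-\bar x_0)^\top,\qquad \bar x_0=\frac1J\sum_{j=1}^J x_0^{(j)},$$ is positive definite. Then for every $T>0$ the system $$\frac{\mathrm d\bar x(t)}{\mathrm dt}+C(t)A^\top\Gamma^{-1}(A\bar x(t)-y)+C(t)C_0^{-1}\bar x(t)\in -C(t)\,\partial R(\bar x(t)),$$ $$\frac{\mathrm d e^{(j)}(t)}{\mathrm dt}=-C(t)\bigl(A^\top\Gamma^{-1}A+C_0^{-1}\bigr)e^{(j)}(t),\qquad j=1,\dots,J,$$ with initial condition $x^{(j)}(0)=x_0^{(j)}$, $j=1,\dots,J$, admits a unique solution $(x^{(j)}(t),\ t\in[0,T])_{j=1,\dots,J}\in C([0,T];\mathbb R^{d\cdot J})$.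
   Context: For an ensemble $x(t)=(x^{(j)}(t))_{j=1,\dots,J}$ of points of $\mathbb R^d$, write $\bar x(t)=\frac1J\sum_{j=1}^J x^{(j)}(t)$, $e^{(j)}(t)=x^{(j)}(t)-\bar x(t)$ and $C(t)=\frac1J\sum_{j=1}^J e^{(j)}(t)e^{(j)}(t)^\top$ (empirical covariance). The matrix $C_0$ is a fixed symmetric positive definite (Tikhonov) matrix, not to be confused with $C(0)$. $\partial R$ is the convex subdifferential and $C(t)\,\partial R(\bar x(t)):=\{C(t)\xi:\xi\in\partial R(\bar x(t))\}$. Solution of a differential inclusion $\frac{\mathrm dx(t)}{\mathrm dt}\in F(t,x(t))$ on $[0,T]$: an absolutely continuous function $x$ on $[0,T]$ for which there is a measurable function $w$ with $w(t)\in F(t,x(t))$ and $\frac{\mathrm dx(t)}{\mathrm dt}=w(t)$ for almost every $t\in[0,T]$.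
   Formalization: Added hypothesis: the initial mean x̄_0 lies in the closure of the effective domain {R < ∞}; otherwise no solution exists (e.g. d = 1, R the indicator function of {0}, x_0 = (0,2), so x̄_0 = 1). *)

theory Defs
  imports "HOL-Analysis.Analysis"
begin

section \<open>Symmetric positive definite matrices\<close>

definition sym_pos_def :: "real^'n^'n \<Rightarrow> bool" where
  "sym_pos_def M \<longleftrightarrow> transpose M = M \<and> (\<forall>v. v \<noteq> 0 \<longrightarrow> 0 < v \<bullet> (M *v v))"


section \<open>Convex functions with values in \<open>(-\<infinity>, \<infinity>]\<close>\<close>

definition proper_fun :: "('a \<Rightarrow> ereal) \<Rightarrow> bool" where
  "proper_fun R \<longleftrightarrow> (\<forall>x. R x \<noteq> -\<infinity>) \<and> (\<exists>x. R x \<noteq> \<infinity>)"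

definition eff_dom :: "('a \<Rightarrow> ereal) \<Rightarrow> 'a set" where
  "eff_dom R = {x. R x < \<infinity>}"

definition closed_fun :: "('a::topological_space \<Rightarrow> ereal) \<Rightarrow> bool" where
  "closed_fun R \<longleftrightarrow> closed {(x, a :: real). R x \<le> ereal a}"

definition lsc_fun :: "('a::t2_space \<Rightarrow> ereal) \<Rightarrow> bool" where
  "lsc_fun R \<longleftrightarrow> (\<forall>x. R x \<le> Liminf (at x) R)"

text \<open>For \<open>u = 0\<close> and \<open>u = 1\<close> the inequality is trivial, since \<open>0 * \<infinity> = 0\<close> for \<^typ>\<open>ereal\<close>.\<close>

definition convex_fun :: "('a::real_vector \<Rightarrow> ereal) \<Rightarrow> bool" where
  "convex_fun R \<longleftrightarrow> (\<forall>x y. \<forall>u\<in>{0..1}.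
     R (u *\<^sub>R x + (1 - u) *\<^sub>R y) \<le> ereal u * R x + ereal (1 - u) * R y)"

text \<open>For proper \<open>R\<close> the subdifferential is empty outside the effective domain.\<close>

definition subdiff :: "('a::real_inner \<Rightarrow> ereal) \<Rightarrow> 'a \<Rightarrow> 'a set" where
  "subdiff R x = {\<xi>. \<forall>z. R z \<ge> R x + ereal (\<xi> \<bullet> (z - x))}"


section \<open>Solutions of differential inclusions\<close>

text \<open>A finite family of non-overlapping subintervals of \<open>S\<close> is given by the set \<open>D\<close> of the
  pairs of its endpoints.\<close>

definition abs_continuous_on :: "real set \<Rightarrow> (real \<Rightarrow> 'a::real_normed_vector) \<Rightarrow> bool" where
  "abs_continuous_on S f \<longleftrightarrow> (\<forall>\<epsilon>>0. \<exists>\<delta>>0. \<forall>D. finite D \<longrightarrow>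
     (\<forall>(a, b)\<in>D. a \<le> b \<and> {a..b} \<subseteq> S) \<longrightarrow>
     pairwise (\<lambda>(a, b) (a', b'). disjnt {a<..<b} {a'<..<b'}) D \<longrightarrow>
     (\<Sum>(a, b)\<in>D. b - a) < \<delta> \<longrightarrow>
     (\<Sum>(a, b)\<in>D. norm (f b - f a)) < \<epsilon>)"

definition inclusion_solution ::
  "(real \<Rightarrow> 'a::euclidean_space \<Rightarrow> 'a set) \<Rightarrow> real \<Rightarrow> (real \<Rightarrow> 'a) \<Rightarrow> bool" where
  "inclusion_solution F T x \<longleftrightarrow> abs_continuous_on {0..T} x \<and>
     (\<exists>w \<in> borel_measurable (lebesgue_on {0..T}). AE t in lebesgue_on {0..T}.
        w t \<in> F t (x t) \<and> (x has_vector_derivative w t) (at t within {0..T}))"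


section \<open>The ensemble system\<close>

text \<open>An ensemble of \<open>J = CARD('j)\<close> points of \<open>\<real>\<^sup>d\<close> is a vector \<open>x :: real^'d^'j\<close>, whose component
  \<open>x $ j\<close> is the \<open>j\<close>-th point.\<close>

definition ens_mean :: "real^'d^'j \<Rightarrow> real^'d" where
  "ens_mean x = (1 / real CARD('j)) *\<^sub>R (\<Sum>j\<in>UNIV. x $ j)"

definition ens_dev :: "real^'d^'j \<Rightarrow> real^'d^'j" where
  "ens_dev x = (\<chi> j. x $ j - ens_mean x)"

text \<open>The argument of \<open>dev_cov\<close> is the family of deviations \<open>e\<close>, so the empirical covariance of an
  ensemble \<open>x\<close> is \<open>dev_cov (ens_dev x)\<close>.\<close>

definition dev_cov :: "real^'d^'j \<Rightarrow> real^'d^'d" where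
  "dev_cov e = (1 / real CARD('j)) *\<^sub>R
     (\<Sum>j\<in>UNIV. (columnvector (e $ j) :: real^1^'d) ** transpose (columnvector (e $ j)))"

text \<open>The right-hand side of the system in the unknowns \<open>(m, e)\<close>, the mean and the deviations;
  \<open>(p, q)\<close> stands for the derivatives of \<open>m\<close> and \<open>e\<close>. The system is autonomous.\<close>

definition eki_rhs ::
  "real^'d^'k \<Rightarrow> real^'k \<Rightarrow> real^'k^'k \<Rightarrow> real^'d^'d \<Rightarrow> (real^'d \<Rightarrow> ereal) \<Rightarrow>
   real \<Rightarrow> (real^'d) \<times> (real^'d^'j) \<Rightarrow> ((real^'d) \<times> (real^'d^'j)) set" where
  "eki_rhs A y \<Gamma> C\<^sub>0 R t = (\<lambda>(m, e). let C = dev_cov e in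
     {(p, q).
        p + C *v (transpose A *v (matrix_inv \<Gamma> *v (A *v m - y))) + C *v (matrix_inv C\<^sub>0 *v m)
          \<in> (\<lambda>\<xi>. - (C *v \<xi>)) ` subdiff R m \<and>
        (\<forall>j. q $ j =
          - (C *v ((transpose A ** matrix_inv \<Gamma> ** A + matrix_inv C\<^sub>0) *v (e $ j))))})"

definition eki_solution ::
  "real^'d^'k \<Rightarrow> real^'k \<Rightarrow> real^'k^'k \<Rightarrow> real^'d^'d \<Rightarrow> (real^'d \<Rightarrow> ereal) \<Rightarrow>
   real \<Rightarrow> (real \<Rightarrow> real^'d^'j) \<Rightarrow> bool" where
  "eki_solution A y \<Gamma> C\<^sub>0 R T x \<longleftrightarrow>
     inclusion_solution (eki_rhs A y \<Gamma> C\<^sub>0 R) T (\<lambda>t. (ens_mean (x t), ens_dev (x t)))"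

lemma abs_continuous_on_imp_continuous_on_Icc:
  assumes "abs_continuous_on {a..b} f"
  shows "continuous_on {a..b} f"
proof (unfold continuous_on_iff, intro ballI allI impI)
  fix s and \<epsilon> :: real
  assume s: "s \<in> {a..b}" and "\<epsilon> > 0"
  with assms obtain \<delta> where "\<delta> > 0" and
    \<delta>: "\<And>D. finite D \<Longrightarrow> (\<forall>(u, v)\<in>D. u \<le> v \<and> {u..v} \<subseteq> {a..b}) \<Longrightarrow>
     pairwise (\<lambda>(u, v) (u', v'). disjnt {u<..<v} {u'<..<v'}) D \<Longrightarrow>
     (\<Sum>(u, v)\<in>D. v - u) < \<delta> \<Longrightarrow> (\<Sum>(u, v)\<in>D. norm (f v - f u)) < \<epsilon>"
    unfolding abs_continuous_on_def by meson
  have "dist (f r) (f s) < \<epsilon>" if "r \<in> {a..b}" "dist r s < \<delta>" for r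
    using \<delta>[of "{(min r s, max r s)}"] s that
    by (cases "r \<le> s") (auto simp: dist_norm norm_minus_commute)
  with \<open>\<delta> > 0\<close> show "\<exists>d>0. \<forall>r\<in>{a..b}. dist r s < d \<longrightarrow> dist (f r) (f s) < \<epsilon>"
    by blast
qed

lemma subdiff_imp_eff_dom:
  assumes "proper_fun R" "\<xi> \<in> subdiff R x"
  shows "x \<in> eff_dom R"
  using assms unfolding proper_fun_def subdiff_def eff_dom_def
  by (force simp: less_top[symmetric] top_ereal_def)

text \<open>A solution takes values in the domain of the subdifferential almost everywhere, so by
  continuity its initial mean lies in the closure of the effective domain. An initial mean outside
  this closure therefore never admits a solution.\<close>

lemma eki_solution_initial_mean:
  assumes R: "proper_fun R" and T: "T > 0" and sol: "eki_solution A y \<Gamma> C\<^sub>0 R T x"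
  shows "ens_mean (x 0) \<in> closure (eff_dom R)"
proof (unfold closure_approachable, intro allI impI)
  fix \<epsilon> :: real assume "\<epsilon> > 0"
  let ?u = "\<lambda>t. (ens_mean (x t), ens_dev (x t))"
  have "continuous_on {0..T} ?u"
    and AE: "AE t in lebesgue_on {0..T}. ens_mean (x t) \<in> eff_dom R"
    using sol unfolding eki_solution_def inclusion_solution_def
    by (auto simp: abs_continuous_on_imp_continuous_on_Icc eki_rhs_def Let_def
        elim!: eventually_mono intro: subdiff_imp_eff_dom[OF R])
  then have "continuous_on {0..T} (\<lambda>t. fst (?u t))"
    by (intro continuous_on_fst)
  with \<open>\<epsilon> > 0\<close> T obtain d where d: "d > 0"
    "\<And>t. t \<in> {0..T} \<Longrightarrow> dist t 0 < d \<Longrightarrow> dist (ens_mean (x t)) (ens_mean (x 0)) < \<epsilon>"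
    unfolding continuous_on_iff by (metis atLeastAtMost_iff fst_conv less_eq_real_def)
  define h where "h = min T (d / 2)"
  have h: "0 < h" "h \<le> T" "h < d" using T d(1) by (auto simp: h_def)
  have "\<exists>t\<in>{0..h}. ens_mean (x t) \<in> eff_dom R"
  proof (rule ccontr)
    assume none: "\<not> ?thesis"
    from AE have "AE t in lebesgue. t \<in> {0..T} \<longrightarrow> ens_mean (x t) \<in> eff_dom R"
      by (simp add: AE_restrict_space_iff)
    then have "AE t in lebesgue. t \<notin> {0..h}"
      using none h by (auto elim!: eventually_mono)
    then have "emeasure lebesgue {0..h} = 0"
      by (subst (asm) AE_iff_measurable[where N = "{0..h}"]) auto
    with h show False by simp
  qed
  with h d(2) show "\<exists>z\<in>eff_dom R. dist z (ens_mean (x 0)) < \<epsilon>"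
    by fastforce
qed

end

theory Submission
  imports Defs
begin

text \<open>Put \<open>P = C(0)\<^sup>-\<^sup>1\<close>, \<open>M = A\<^sup>T \<Gamma>\<^sup>-\<^sup>1 A + C\<^sub>0\<^sup>-\<^sup>1\<close>, \<open>b = A\<^sup>T \<Gamma>\<^sup>-\<^sup>1 y\<close> and \<open>S(t) = P + 2tM\<close>. Solutions of
  \<open>S(t) e' = -M e\<close> preserve the pairings \<open>\<langle>S(t) e\<^sub>i, e\<^sub>j\<rangle>\<close>, which forces their empirical covariance \<open>C(t)\<close>
  to be \<open>S(t)\<^sup>-\<^sup>1\<close>. So they solve the deviation equation, and they are the only solutions because
  that equation is locally Lipschitz.

  The mean then solves the gradient flow \<open>S(t) m' \<in> -\<partial>\<phi>(m)\<close> of \<open>\<phi>(m) = R(m) + \<langle>m, M m\<rangle>/2 - \<langle>b, m\<rangle>\<close> in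
  a moving metric. The growth \<open>S' = 2M\<close> of the metric is compensated by the strong convexity of \<open>\<phi>\<close>:
  for the difference \<open>d\<close> of two solutions \<open>\<langle>S(t) d, d\<rangle>\<close> does not increase, which gives uniqueness.
  For the same reason the steps of an implicit Euler scheme have non-increasing speed; they also
  have finite total length. The scheme therefore converges to a curve that is Lipschitz away
  from \<open>t = 0\<close> and absolutely continuous up to \<open>t = 0\<close>, and the inclusion holds at every point of
  differentiability of this curve. The flow of the deviations is the case \<open>R = 0\<close>, \<open>b = 0\<close>.\<close>

section \<open>Lipschitz functions of one variable are differentiable almost everywhere\<close>

text \<open>The obstacle is the initial mean: it is only known to lie in the closure of the
  effective domain, where \<open>R\<close> may be infinite and its subdifferential empty. Neither an
  energy bound nor a speed bound is available at \<open>t = 0\<close>; hence the separate estimate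
  of the length, and Lipschitz constants that grow like \<open>1 / \<tau>\<close> on times after
  \<open>\<tau>\<close>. The inclusion itself is not carried through the limit: what passes is an
  inequality tested with every point of the domain (an evolution variational inequality), in which
  \<open>\<phi>\<close> enters only through a closed epigraph. Differentiating it from the left
  returns the subgradient. The factor 2 in \<open>S\<close> comes from the pairings:
  \<open>S e' = - M e\<close> gives them the derivative \<open>(S' - 2 M) e_i \<bullet> e_j\<close>,
  which vanishes for \<open>S' = 2 M\<close>. Solutions are merely absolutely continuous, so two
  facts carry the argument: Lipschitz curves are differentiable almost everywhere (existence), and
  an absolutely continuous function with nonpositive derivative almost everywhere does not increase
  (uniqueness and conservation).\<close>

lemma lmeasurable_outer_open:
  assumes S: "S \<in> lmeasurable" and "e > 0"
  obtains T where "open T" "S \<subseteq> T" "T \<in> lmeasurable" "measure lebesgue T < measure lebesgue S + e"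
proof -
  obtain T where T: "open T" "S \<subseteq> T" "T - S \<in> lmeasurable" "emeasure lebesgue (T - S) < ennreal e"
    using sets_lebesgue_outer_open[OF fmeasurableD[OF S] \<open>e > 0\<close>] by metis
  have eq: "T = S \<union> (T - S)" using T(2) by blast
  have "T \<in> lmeasurable" using fmeasurable.Un[OF S T(3)] eq by simp
  moreover have "measure lebesgue (S \<union> (T - S)) \<le> measure lebesgue S + measure lebesgue (T - S)"
    using S T(3) by (intro measure_Un_le) auto
  moreover have "measure lebesgue (T - S) < e"
    using T(3,4) \<open>e > 0\<close> by (simp add: emeasure_eq_measure2 ennreal_less_iff)
  ultimately show ?thesis using that T eq by simp
qed

text \<open>The chord spans any short interval containing \<open>x\<close>, written as a ball
  because the Vitali covering theorem works with balls. As the ball is closed, \<open>x\<close> may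
  be an endpoint, so the usual difference quotients are included.\<close>

abbreviation slope_le_within :: "(real \<Rightarrow> real) \<Rightarrow> real \<Rightarrow> real \<Rightarrow> real \<Rightarrow> bool" where
  "slope_le_within f p x d \<equiv>
     \<exists>c r. 0 < r \<and> r < d \<and> x \<in> cball c r \<and> f (c + r) - f (c - r) \<le> p * (2 * r)"

abbreviation slope_ge_within :: "(real \<Rightarrow> real) \<Rightarrow> real \<Rightarrow> real \<Rightarrow> real \<Rightarrow> bool" where
  "slope_ge_within f p x d \<equiv>
     \<exists>c r. 0 < r \<and> r < d \<and> x \<in> cball c r \<and> f (c + r) - f (c - r) \<ge> p * (2 * r)"

text \<open>Vitali's theorem is applied twice. Disjoint intervals of slope at most \<open>p\<close>
  cover almost all of \<open>E\<close> inside an open set of nearly minimal measure; inside them,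
  disjoint intervals of slope at least \<open>q\<close> again cover almost all of \<open>E\<close>.
  Comparing Lebesgue measure with the Stieltjes measure of \<open>f\<close> gives
  \<open>q * \<alpha> \<le> p * (\<alpha> + 2 * \<epsilon>)\<close> for the outer measure
  \<open>\<alpha>\<close> of \<open>E\<close>, so \<open>\<alpha> = 0\<close>.\<close>

lemma slope_oscillation_negligible_aux:
  fixes f :: "real \<Rightarrow> real"
  assumes mono: "mono f" and cont: "continuous_on UNIV f" and pq: "0 \<le> p" "p < q"
      and bdd: "bounded E"
    and low: "\<And>x d. x \<in> E \<Longrightarrow> 0 < d \<Longrightarrow> slope_le_within f p x d"
    and high: "\<And>x d. x \<in> E \<Longrightarrow> 0 < d \<Longrightarrow> slope_ge_within f q x d"
  shows "negligible E"
proof -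
  define \<mu> where "\<mu> = interval_measure f"
  have [simp]: "sets \<mu> = sets borel" by (simp add: \<mu>_def)
  have \<mu>: "emeasure \<mu> (cball c r) = ennreal (f (c + r) - f (c - r))" if "0 < r" for c r
    unfolding \<mu>_def cball_eq_atLeastAtMost using that mono cont
    by (subst emeasure_interval_measure_Icc) (auto simp: mono_def)
  have lam: "emeasure lborel (cball c r) = ennreal (2 * r)" if "0 < r" for c r :: real
    using that by (simp add: cball_eq_atLeastAtMost)
  \<comment> \<open>\<open>E\<close> is not known to be measurable; \<open>\<alpha>\<close> is its
    outer measure.\<close>
  define A where "A = {measure lebesgue T | T. T \<in> lmeasurable \<and> E \<subseteq> T}"
  define \<alpha> where "\<alpha> = Inf A"
  have A0: "A \<noteq> {}" 
  proof -
    obtain a where "E \<subseteq> cbox (- a) a" using bdd bounded_subset_cbox_symmetric by blast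
    then have "measure lebesgue (cbox (- a) a) \<in> A"
      unfolding A_def using lmeasurable_cbox[of "- a" a]
          by (intro CollectI exI[of _ "cbox (- a) a"]) auto
    then show ?thesis by auto
  qed
  have Abdd: "bdd_below A" unfolding A_def by (auto intro!: bdd_belowI[of _ 0])
  have \<alpha>0: "0 \<le> \<alpha>" unfolding \<alpha>_def using A0 by (intro cInf_greatest) (auto simp: A_def)
  have key: "q * \<alpha> \<le> p * (\<alpha> + 2 * \<epsilon>)" if "\<epsilon> > 0" for \<epsilon>
  proof -
    obtain T where T: "T \<in> lmeasurable" "E \<subseteq> T" "measure lebesgue T < \<alpha> + \<epsilon>"
    proof -
      have "Inf A < \<alpha> + \<epsilon>" using \<open>\<epsilon> > 0\<close> by (simp add: \<alpha>_def)
      then obtain z where "z \<in> A" "z < \<alpha> + \<epsilon>" using cInf_lessD[OF A0] by metis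
      then show ?thesis using that unfolding A_def by blast
    qed
    obtain U where U: "open U" "T \<subseteq> U" "U \<in> lmeasurable" "measure lebesgue U < \<alpha> + 2 * \<epsilon>"
    proof (rule lmeasurable_outer_open[OF T(1) \<open>\<epsilon> > 0\<close>])
      fix V assume "open V" "T \<subseteq> V" "V \<in> lmeasurable" "measure lebesgue V < measure lebesgue T + \<epsilon>"
      then show thesis using T(3) by (intro that(1)[of V]) auto
    qed
    define K1 where "K1 = {(c, r). 0 < r \<and> cball c r \<subseteq> U \<and> f (c + r) - f (c - r) \<le> p * (2 * r)}"
    have K1_pos: "0 < snd i" if "i \<in> K1" for i using that by (auto simp: K1_def)
    have K1_fine: "\<exists>i. i \<in> K1 \<and> x \<in> cball (fst i) (snd i) \<and> snd i < d" if x: "x \<in> E" "0 < d" for x d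
    proof -
      obtain e where e: "e > 0" "cball x e \<subseteq> U"
        using U(1,2) T(2) x(1) open_contains_cball[of U] by blast
      obtain c r where cr: "0 < r" "r < min d (e / 2)" "x \<in> cball c r" "f (c + r) - f (c - r)
          \<le> p * (2 * r)"
        using low[OF x(1), of "min d (e / 2)"] x(2) e(1) by auto
      have "cball c r \<subseteq> cball x e"
        using cr(2,3) by (auto simp: dist_real_def abs_real_def split: if_splits)
      with cr e show ?thesis unfolding K1_def by (intro exI[of _ "(c, r)"]) auto
    qed
    obtain C1 where C1: "countable C1" "C1 \<subseteq> K1"
      "pairwise (\<lambda>i j. disjnt (cball (fst i) (snd i)) (cball (fst j) (snd j))) C1"
      "negligible (E - (\<Union>i\<in>C1. cball (fst i) (snd i)))"
      by (rule Vitali_covering_theorem_cballs[of K1 snd E fst, OF K1_pos K1_fine])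
    \<comment> \<open>Open balls, so that the second covering can be fitted into \<open>V\<close>;
      only the countably many endpoints are lost.\<close>
    define V where "V = (\<Union>i\<in>C1. ball (fst i) (snd i))"
    have "E - V \<subseteq> (E - (\<Union>i\<in>C1. cball (fst i) (snd i))) \<union> (\<Union>i\<in>C1. {fst i - snd i, fst i + snd i})"
      by (fastforce simp: V_def dist_real_def abs_real_def not_le not_less split: if_splits)
    moreover have "negligible (\<Union>i\<in>C1. {fst i - snd i, fst i + snd i})"
      using C1(1) unfolding negligible_iff_null_sets
      by (intro null_sets_completionI countable_imp_null_set_lborel countable_UN) auto
    ultimately have EV: "negligible (E - V)"
      using C1(4) negligible_Un negligible_subset by blast
    define K2 where "K2 = {(c, r). 0 < r \<and> cball c r \<subseteq> V \<and> f (c + r) - f (c - r) \<ge> q * (2 * r)}"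
    have "open V" by (auto simp: V_def)
    have K2_pos: "0 < snd i" if "i \<in> K2" for i using that by (auto simp: K2_def)
    have K2_fine: "\<exists>i. i \<in> K2 \<and> x \<in> cball (fst i) (snd i) \<and> snd i < d" if x: "x \<in> E \<inter> V" "0 < d"
        for x d
    proof -
      obtain e where e: "e > 0" "cball x e \<subseteq> V"
        using \<open>open V\<close> x(1) open_contains_cball[of V] by blast
      obtain c r where cr: "0 < r" "r < min d (e / 2)" "x \<in> cball c r" "f (c + r) - f (c
          - r) \<ge> q * (2 * r)"
        using high[of x "min d (e / 2)"] x e(1) by auto
      have "cball c r \<subseteq> cball x e"
        using cr(2,3) by (auto simp: dist_real_def abs_real_def split: if_splits)
      with cr e show ?thesis unfolding K2_def by (intro exI[of _ "(c, r)"]) auto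
    qed
    obtain C2 where C2: "countable C2" "C2 \<subseteq> K2"
      "pairwise (\<lambda>i j. disjnt (cball (fst i) (snd i)) (cball (fst j) (snd j))) C2"
      "negligible (E \<inter> V - (\<Union>i\<in>C2. cball (fst i) (snd i)))"
      by (rule Vitali_covering_theorem_cballs[of K2 snd "E \<inter> V" fst, OF K2_pos K2_fine])
    define W1 where "W1 = (\<Union>i\<in>C1. cball (fst i) (snd i))"
    define W2 where "W2 = (\<Union>i\<in>C2. cball (fst i) (snd i))"
    have um: "emeasure N (\<Union>i\<in>C. cball (fst i) (snd i))
        = (\<integral>\<^sup>+i. emeasure N (cball (fst i) (snd i)) \<partial>count_space C)"
      if "countable C" "pairwise (\<lambda>i j. disjnt (cball (fst i) (snd i)) (cball (fst j) (snd j))) C"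
         "sets N = sets borel" for C and N :: "real measure"
      using that by (intro emeasure_UN_countable)
        (auto simp: disjoint_family_on_def pairwise_def disjnt_def)
    have "cball (fst i) (snd i) \<subseteq> V" if "i \<in> C2" for i
      using subsetD[OF C2(2) that] by (simp add: K2_def split_beta)
    then have "W2 \<subseteq> V" unfolding W2_def by blast
    moreover have "V \<subseteq> W1" unfolding V_def W1_def using ball_subset_cball by blast
    moreover have "cball (fst i) (snd i) \<subseteq> U" if "i \<in> C1" for i
      using subsetD[OF C1(2) that] by (simp add: K1_def split_beta)
    then have "W1 \<subseteq> U" unfolding W1_def by blast
    ultimately have sub: "W2 \<subseteq> W1" "W1 \<subseteq> U" by blast+
    have W: "W1 \<in> sets borel" "W2 \<in> sets borel" using C1(1) C2(1)
      by (auto simp: W1_def W2_def intro!: sets.countable_UN')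
    \<comment> \<open>The growth of \<open>f\<close>, measured by \<open>\<mu>\<close>, is at least
      \<open>q\<close> per unit length on \<open>W2\<close> and at most \<open>p\<close> per unit
      length on the larger set \<open>W1\<close>.\<close>
    have "ennreal q * emeasure lborel W2 = (\<integral>\<^sup>+i. ennreal q * emeasure lborel (cball (fst i) (snd
        i)) \<partial>count_space C2)"
      unfolding W2_def using C2 by (simp add: um nn_integral_cmult)
    also have "\<dots> \<le> (\<integral>\<^sup>+i. emeasure \<mu> (cball (fst i) (snd i)) \<partial>count_space C2)"
      using C2(2) pq by (intro nn_integral_mono)
        (auto simp: K2_def lam \<mu> ennreal_mult[symmetric] intro!: ennreal_leI)
    also have "\<dots> = emeasure \<mu> W2" unfolding W2_def using C2 by (simp add: um)
    also have "\<dots> \<le> emeasure \<mu> W1" using sub W by (intro emeasure_mono) auto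
    also have "\<dots> = (\<integral>\<^sup>+i. emeasure \<mu> (cball (fst i) (snd i)) \<partial>count_space C1)"
      unfolding W1_def using C1 by (simp add: um)
    also have "\<dots> \<le> (\<integral>\<^sup>+i. ennreal p * emeasure lborel (cball (fst i) (snd i)) \<partial>count_space C1)"
      using C1(2) pq by (intro nn_integral_mono)
        (auto simp: K1_def lam \<mu> ennreal_mult[symmetric] intro!: ennreal_leI)
    also have "\<dots> = ennreal p * emeasure lborel W1"
      unfolding W1_def using C1 by (simp add: um nn_integral_cmult)
    also have "\<dots> \<le> ennreal p * emeasure lborel U"
      using sub U W by (intro mult_left_mono emeasure_mono) auto
    finally have le: "ennreal q * emeasure lebesgue W2 \<le> ennreal p * emeasure lebesgue U"
      using W U by simp
    have W2m: "W2 \<in> lmeasurable" using sub W U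
      by (intro fmeasurableI2[OF U(3)]) auto
    have "ennreal (q * measure lebesgue W2) \<le> ennreal (p * measure lebesgue U)"
      using le W2m U(3) pq by (simp add: emeasure_eq_measure2 ennreal_mult)
    then have 1: "q * measure lebesgue W2 \<le> p * measure lebesgue U"
      using pq by (simp add: ennreal_le_iff)
    \<comment> \<open>A null set added to \<open>W2\<close> turns it into a measurable cover of
      \<open>E\<close>, so its measure is at least \<open>\<alpha>\<close>.\<close>
    have "negligible (E - W2)"
      by (rule negligible_subset[OF negligible_Un[OF EV C2(4)]]) (auto simp: W2_def)
    then have "W2 \<union> (E - W2) \<in> lmeasurable" "measure lebesgue (W2 \<union> (E - W2)) = measure lebesgue W2"
      using W2m negligible_imp_measurable
      by (auto simp: measure_Un_null_set negligible_iff_null_sets simp del: Un_Diff_cancel)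
    then have "measure lebesgue W2 \<in> A"
      unfolding A_def by (intro CollectI exI[of _ "W2 \<union> (E - W2)"]) auto
    then have "\<alpha> \<le> measure lebesgue W2"
      unfolding \<alpha>_def using Abdd by (rule cInf_lower)
    then have "q * \<alpha> \<le> p * measure lebesgue U"
      using 1 pq by (meson less_eq_real_def mult_left_mono order_trans le_less_trans)
    also have "\<dots> \<le> p * (\<alpha> + 2 * \<epsilon>)" using U(4) pq by (intro mult_left_mono) auto
    finally show ?thesis .
  qed
  have "\<alpha> = 0"
  proof (rule ccontr)
    assume "\<alpha> \<noteq> 0"
    with \<alpha>0 have "\<alpha> > 0" by simp
    \<comment> \<open>Chosen to make \<open>2 * (p + 1) * \<epsilon>\<close> half of
      \<open>(q - p) * \<alpha>\<close>; \<open>p + 1\<close> covers the case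
      \<open>p = 0\<close>.\<close>
    define \<epsilon> where "\<epsilon> = (q - p) * \<alpha> / (4 * (p + 1))"
    have "\<epsilon> > 0" using \<open>\<alpha> > 0\<close> pq by (simp add: \<epsilon>_def)
    from key[OF this] have "(q - p) * \<alpha> \<le> 2 * p * \<epsilon>" by (simp add: algebra_simps)
    also have "2 * p * \<epsilon> \<le> 2 * (p + 1) * \<epsilon>" using \<open>\<epsilon> > 0\<close> by simp
    also have "\<dots> = (q - p) * \<alpha> / 2" using pq by (simp add: \<epsilon>_def field_simps)
    finally show False using \<open>\<alpha> > 0\<close> pq by simp
  qed
  show ?thesis
    unfolding negligible_outer
  proof (intro allI impI)
    fix e :: real assume "0 < e"
    then have "Inf A < e" using \<open>\<alpha> = 0\<close> by (simp add: \<alpha>_def)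
    then obtain z where "z \<in> A" "z < e" using cInf_lessD[OF A0] by metis
    then show "\<exists>T. E \<subseteq> T \<and> T \<in> lmeasurable \<and> measure lebesgue T < e"
      unfolding A_def by blast
  qed
qed


lemma slope_oscillation_negligible:
  fixes f :: "real \<Rightarrow> real"
  assumes mono: "mono f" and cont: "continuous_on UNIV f" and pq: "0 \<le> p" "p < q"
  shows "negligible {x. (\<forall>d>0. slope_le_within f p x d) \<and>
                        (\<forall>d>0. slope_ge_within f q x d)}"
    (is "negligible ?E")
  by (subst negligible_on_intervals, intro allI,
      rule slope_oscillation_negligible_aux[OF assms]) (auto intro: bounded_Int)

text \<open>Consider a point where no two rationals \<open>p < q\<close> are such that slopes at
  most \<open>p\<close> and slopes at least \<open>q\<close> both occur arbitrarily close by. There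
  the supremum \<open>D\<close> of the slopes reached arbitrarily close to the point is the
  derivative; the Lipschitz bound keeps \<open>D\<close> finite.\<close>

lemma lipschitz_mono_differentiable_ae:
  fixes f :: "real \<Rightarrow> real"
  assumes mono: "mono f" and lip: "L-lipschitz_on UNIV f"
  shows "negligible {x. \<not> f differentiable (at x)}"
proof -
  have cont: "continuous_on UNIV f" using lip lipschitz_on_continuous_on by blast
  define low where "low p x \<longleftrightarrow> (\<forall>d>0. slope_le_within f p x d)" for p x
  define high where "high q x \<longleftrightarrow> (\<forall>d>0. slope_ge_within f q x d)" for q x
  define N where "N = (\<Union>(p,q)\<in>{(p,q). p \<in> \<rat> \<and> q \<in> \<rat> \<and> 0 \<le> p \<and> p < q}. {x. low p x \<and> high q x})"
  have N: "negligible N" unfolding N_def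
  proof (rule negligible_countable_Union[OF countable_image])
    show "countable {(p,q). p \<in> \<rat> \<and> q \<in> \<rat> \<and> 0 \<le> p \<and> p < (q::real)}"
      by (rule countable_subset[of _ "\<rat> \<times> \<rat>"]) (auto simp: countable_rat)
  qed (use slope_oscillation_negligible[OF mono cont] in \<open>auto simp: low_def high_def\<close>)
  have "f differentiable (at x)" if "x \<notin> N" for x
  proof -
    have noth: "\<not> (low p x \<and> high q x)" if "p \<in> \<rat>" "q \<in> \<rat>" "0 \<le> p" "p < q" for p q
      using \<open>x \<notin> N\<close> that unfolding N_def by blast
    have slope: "f (c + r) - f (c - r) \<ge> 0" "f (c + r) - f (c - r) \<le> L * (2 * r)" if "0 < r" for c r
    proof -
      show "f (c + r) - f (c - r) \<ge> 0" using mono that by (auto simp: mono_def)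
      show "f (c + r) - f (c - r) \<le> L * (2 * r)"
        using lipschitz_onD[OF lip, of "c + r" "c - r"] that by (auto simp: dist_real_def)
    qed
    define H where "H = {q. high q x}"
    have H0: "0 \<in> H" unfolding H_def high_def
    proof (intro CollectI allI impI)
      fix d :: real assume "0 < d"
      then show "slope_ge_within f 0 x d"
        using slope(1)[of "d / 2" x] by (intro exI[of _ x] exI[of _ "d / 2"]) auto
    qed
    have HB: "q \<le> L" if "q \<in> H" for q
    proof -
      have "high q x" using that by (simp add: H_def)
      from this[unfolded high_def, rule_format, of 1]
      obtain c r where "0 < r" "f (c + r) - f (c - r) \<ge> q * (2 * r)" by auto
      then have "q * (2 * r) \<le> L * (2 * r)" using slope(2)[of r c] by linarith
      with \<open>0 < r\<close> show ?thesis by simp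
    qed
    have bdd: "bdd_above H" using HB by (rule bdd_aboveI)
    define D where "D = Sup H"
    have D0: "0 \<le> D" unfolding D_def using H0 bdd by (rule cSup_upper)
    have up: "\<exists>d>0. \<forall>c r. 0 < r \<longrightarrow> r < d \<longrightarrow> x \<in> cball c r \<longrightarrow> f (c + r) - f (c - r) < (D + \<epsilon>) * (2 * r)"
        if "\<epsilon> > 0" for \<epsilon>
    proof -
      have "\<not> D + \<epsilon> \<le> D" using that by simp
      then have "\<not> high (D + \<epsilon>) x" using cSup_upper[OF _ bdd] unfolding D_def H_def by blast
      then obtain d where "d > 0" "\<not> (slope_ge_within f (D + \<epsilon>) x d)"
        unfolding high_def by blast
      then show ?thesis by (intro exI[of _ d]) (auto simp: not_le[symmetric])
    qed
    have lo: "\<exists>d>0. \<forall>c r. 0 < r \<longrightarrow> r < d \<longrightarrow> x \<in> cball c r \<longrightarrow> f (c + r) - f (c - r) > (D - \<epsilon>) * (2 * r)"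
        if "\<epsilon> > 0" for \<epsilon>
    proof (cases "D - \<epsilon> < 0")
      case True
      have "f (c + r) - f (c - r) > (D - \<epsilon>) * (2 * r)" if "0 < r" for c r
        using slope(1)[OF that, of c] True that mult_neg_pos[of "D - \<epsilon>" "2 * r"] by linarith
      then show ?thesis by (intro exI[of _ 1]) auto
    next
      case False
      \<comment> \<open>Slopes at most \<open>p < D\<close> arbitrarily close to \<open>x\<close>,
        together with slopes at least a rational \<open>q\<close> between \<open>p\<close> and
        \<open>D\<close>, would put \<open>x\<close> into \<open>N\<close>.\<close>
      obtain p where p: "p \<in> \<rat>" "D - \<epsilon> < p" "p < D" using Rats_dense_in_real[of "D - \<epsilon>" D] \<open>\<epsilon> > 0\<close>
          by auto
      obtain q where q: "q \<in> \<rat>" "p < q" "q < D" using Rats_dense_in_real[of p D] p by auto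
      obtain q' where q': "q' \<in> H" "q < q'" using less_cSupD[of H q] H0 q(3) unfolding D_def
          by blast
      have "high q x" unfolding high_def
      proof (intro allI impI)
        fix d :: real assume "0 < d"
        then obtain c r where cr: "0 < r" "r < d" "x \<in> cball c r" "f (c + r) - f (c
            - r) \<ge> q' * (2 * r)"
          using q'(1) unfolding H_def high_def by blast
        moreover have "q * (2 * r) \<le> q' * (2 * r)" using q' cr by (intro mult_right_mono) auto
        ultimately show "slope_ge_within f q x d"
          by (meson order_trans)
      qed
      then have "\<not> low p x" using noth[of p q] p q False by auto
      then obtain d where d0: "d > 0" "\<not> (slope_le_within f p x d)"
        unfolding low_def by blast
      then have d: "f (c + r) - f (c - r) > p * (2 * r)" if "0 < r" "r < d" "x \<in> cball c r" for c r
        using that not_le by blast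
      have "f (c + r) - f (c - r) > (D - \<epsilon>) * (2 * r)" if "0 < r" "r < d" "x \<in> cball c r" for c r
        using d[OF that] p(2) mult_strict_right_mono[of "D - \<epsilon>" p "2 * r"] that(1) by linarith
      with d0(1) show ?thesis by blast
    qed
    have "(f has_real_derivative D) (at x)"
      unfolding has_field_derivative_iff LIM_eq
    proof (intro allI impI)
      fix \<epsilon> :: real assume "0 < \<epsilon>"
      obtain d1 where d1: "d1 > 0" "\<And>c r. 0 < r \<Longrightarrow> r < d1 \<Longrightarrow> x \<in> cball c r \<Longrightarrow> f (c + r) - f (c
          - r) < (D + \<epsilon>) * (2 * r)"
        using up[OF \<open>0 < \<epsilon>\<close>] by blast
      obtain d2 where d2: "d2 > 0" "\<And>c r. 0 < r \<Longrightarrow> r < d2 \<Longrightarrow> x \<in> cball c r \<Longrightarrow> f (c + r) - f (c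
          - r) > (D - \<epsilon>) * (2 * r)"
        using lo[OF \<open>0 < \<epsilon>\<close>] by blast
      have "norm ((f y - f x) / (y - x) - D) < \<epsilon>" if "y \<noteq> x" "norm (y - x) < min d1 d2" for y
      proof -
        define c r where "c = (x + y) / 2" and "r = \<bar>y - x\<bar> / 2"
        have cr: "0 < r" "r < d1" "r < d2" "x \<in> cball c r" "2 * r = \<bar>y - x\<bar>"
          using that d1 d2 by (auto simp: c_def r_def dist_real_def field_simps)
        have eq: "(f y - f x) / (y - x) = (f (c + r) - f (c - r)) / (2 * r)"
        proof (cases "y > x")
          case True
          then have "c + r = y" "c - r = x" "2 * r = y - x" by (auto simp: c_def r_def field_simps)
          then show ?thesis by (simp only:)
        next
          case False
          then have *: "c + r = x" "c - r = y" "2 * r = x - y"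
              by (auto simp: c_def r_def field_simps)
          show ?thesis unfolding * by (metis minus_diff_eq minus_divide_divide)
        qed
        have "(f (c + r) - f (c - r)) / (2 * r) < D + \<epsilon>" "D - \<epsilon> < (f (c + r) - f (c - r)) / (2 * r)"
          using d1(2)[OF cr(1,2,4)] d2(2)[OF cr(1,3,4)] cr(1)
          by (simp_all add: pos_divide_less_eq pos_less_divide_eq)
        then show ?thesis unfolding eq by (simp add: abs_less_iff)
      qed
      then show "\<exists>s>0. \<forall>y. y \<noteq> x \<and> norm (y - x) < s \<longrightarrow> norm ((f y - f x) / (y - x) - D) < \<epsilon>"
        using d1(1) d2(1) by (intro exI[of _ "min d1 d2"]) auto
    qed
    then show ?thesis using real_differentiable_def by blast
  qed
  then have "{x. \<not> f differentiable (at x)} \<subseteq> N" by blast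
  then show ?thesis by (rule negligible_subset[OF N])
qed

lemma lipschitz_differentiable_ae:
  fixes f :: "real \<Rightarrow> 'a::euclidean_space"
  assumes lip: "L-lipschitz_on UNIV f"
  shows "negligible {x. \<not> f differentiable (at x)}"
proof -
  have "negligible {x. \<not> (\<lambda>x. f x \<bullet> i) differentiable (at x)}" if "i \<in> Basis" for i
  proof -
    \<comment> \<open>Adding \<open>L * x\<close> makes the component nondecreasing and does not
      affect differentiability.\<close>
    define g where "g x = f x \<bullet> i + L * x" for x
    have L: "L \<ge> 0" using lip lipschitz_on_nonneg by blast
    have inc: "\<bar>f x \<bullet> i - f y \<bullet> i\<bar> \<le> L * \<bar>x - y\<bar>" for x y
    proof -
      have "\<bar>(f x - f y) \<bullet> i\<bar> \<le> norm (f x - f y)" using that Basis_le_norm by blast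
      also have "\<dots> \<le> L * \<bar>x - y\<bar>" using lipschitz_onD[OF lip, of x y] by (simp add: dist_norm)
      finally show ?thesis by (simp add: inner_diff_left)
    qed
    have "mono g"
    proof (rule monoI)
      fix x y :: real assume "x \<le> y"
      then show "g x \<le> g y" using inc[of x y] by (simp add: g_def algebra_simps abs_le_iff)
    qed
    moreover have "(2 * L)-lipschitz_on UNIV g"
    proof (rule lipschitz_onI)
      fix x y :: real
      have "dist (g x) (g y) = \<bar>(f x \<bullet> i - f y \<bullet> i) + L * (x - y)\<bar>"
        by (simp add: g_def dist_real_def algebra_simps)
      also have "\<dots> \<le> L * \<bar>x - y\<bar> + L * \<bar>x - y\<bar>"
        using inc[of x y] L abs_triangle_ineq[of "f x \<bullet> i - f y \<bullet> i" "L * (x - y)"]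
            by (simp add: abs_mult)
      finally show "dist (g x) (g y) \<le> 2 * L * dist x y" by (simp add: dist_real_def)
    qed (use L in simp)
    ultimately have N: "negligible {x. \<not> g differentiable (at x)}"
      by (rule lipschitz_mono_differentiable_ae)
    have "(\<lambda>x. f x \<bullet> i) differentiable (at x)" if "g differentiable (at x)" for x
    proof -
      have "(\<lambda>x. g x - L * x) differentiable (at x)" using that by (intro derivative_intros) auto
      then show ?thesis by (simp add: g_def)
    qed
    then have "{x. \<not> (\<lambda>x. f x \<bullet> i) differentiable (at x)} \<subseteq> {x. \<not> g differentiable (at x)}" by blast
    then show ?thesis by (rule negligible_subset[OF N])
  qed
  then have "negligible (\<Union>i\<in>Basis. {x. \<not> (\<lambda>x. f x \<bullet> i) differentiable (at x)})"
    by (intro negligible_Union) auto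
  moreover have "{x. \<not> f differentiable (at x)} \<subseteq> (\<Union>i\<in>Basis. {x. \<not> (\<lambda>x. f x \<bullet> i) differentiable (at
      x)})"
    using differentiable_componentwise_within[of f _ UNIV] by auto
  ultimately show ?thesis by (rule negligible_subset)
qed

section \<open>Absolutely continuous functions\<close>

definition nonoverlapping_in :: "real set \<Rightarrow> (real \<times> real) set \<Rightarrow> bool" where
  "nonoverlapping_in S D \<longleftrightarrow> finite D \<and> (\<forall>(a, b)\<in>D. a \<le> b \<and> {a..b} \<subseteq> S) \<and>
     pairwise (\<lambda>(a, b) (a', b'). disjnt {a<..<b} {a'<..<b'}) D"

lemma nonoverlapping_inD:
  assumes "nonoverlapping_in S D" "(a, b) \<in> D"
  shows "a \<le> b" "{a..b} \<subseteq> S"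
  using assms unfolding nonoverlapping_in_def by auto

lemma abs_continuous_on_iff:
  "abs_continuous_on S f \<longleftrightarrow> (\<forall>\<epsilon>>0. \<exists>\<delta>>0. \<forall>D. nonoverlapping_in S D \<longrightarrow>
     (\<Sum>(a, b)\<in>D. b - a) < \<delta> \<longrightarrow> (\<Sum>(a, b)\<in>D. norm (f b - f a)) < \<epsilon>)"
  unfolding abs_continuous_on_def nonoverlapping_in_def by (simp only: imp_conjL)

lemma abs_continuous_onD:
  assumes "abs_continuous_on S f" "0 < \<epsilon>"
  obtains \<delta> where "0 < \<delta>" "\<And>D. nonoverlapping_in S D \<Longrightarrow>
     (\<Sum>(a, b)\<in>D. b - a) < \<delta> \<Longrightarrow> (\<Sum>(a, b)\<in>D. norm (f b - f a)) < \<epsilon>"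
  using assms unfolding abs_continuous_on_iff by blast

text \<open>Summing the domination over the intervals bounds the increments of \<open>h\<close>.
  Sums, multiples, bounded linear images, pairs and the quadratic expressions used later all come
  from this one criterion.\<close>

lemma abs_continuous_on_comb:
  assumes f: "abs_continuous_on S f" and g: "abs_continuous_on S g" and "0 \<le> K"
    and h: "\<And>a b. a \<in> S \<Longrightarrow> b \<in> S \<Longrightarrow> norm (h b - h a) \<le> K * (norm (f b - f a) + norm (g b - g a))"
  shows "abs_continuous_on S h"
proof (unfold abs_continuous_on_iff, intro allI impI)
  fix \<epsilon> :: real assume "0 < \<epsilon>"
  define \<eta> where "\<eta> = \<epsilon> / (2 * (K + 1))"
  have "\<eta> > 0" using \<open>0 < \<epsilon>\<close> \<open>0 \<le> K\<close> by (simp add: \<eta>_def)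
  obtain \<delta>1 where \<delta>1: "\<delta>1 > 0" "\<And>D. nonoverlapping_in S D \<Longrightarrow>
     (\<Sum>(a, b)\<in>D. b - a) < \<delta>1 \<Longrightarrow> (\<Sum>(a, b)\<in>D. norm (f b - f a)) < \<eta>"
    using abs_continuous_onD[OF f \<open>\<eta> > 0\<close>] by metis
  obtain \<delta>2 where \<delta>2: "\<delta>2 > 0" "\<And>D. nonoverlapping_in S D \<Longrightarrow>
     (\<Sum>(a, b)\<in>D. b - a) < \<delta>2 \<Longrightarrow> (\<Sum>(a, b)\<in>D. norm (g b - g a)) < \<eta>"
    using abs_continuous_onD[OF g \<open>\<eta> > 0\<close>] by metis
  show "\<exists>\<delta>>0. \<forall>D. nonoverlapping_in S D \<longrightarrow>
     (\<Sum>(a, b)\<in>D. b - a) < \<delta> \<longrightarrow> (\<Sum>(a, b)\<in>D. norm (h b - h a)) < \<epsilon>"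
  proof (intro exI[of _ "min \<delta>1 \<delta>2"] conjI allI impI)
    fix D :: "(real \<times> real) set"
    assume D: "nonoverlapping_in S D" "(\<Sum>(a, b)\<in>D. b - a) < min \<delta>1 \<delta>2"
    have "(\<Sum>(a, b)\<in>D. norm (h b - h a)) \<le> (\<Sum>(a, b)\<in>D. K * (norm (f b - f a) + norm (g b - g a)))"
    proof (rule sum_mono, clarify)
      fix a b assume "(a, b) \<in> D"
      then have "a \<le> b" "{a..b} \<subseteq> S" by (rule nonoverlapping_inD[OF D(1)])+
      then show "norm (h b - h a) \<le> K * (norm (f b - f a) + norm (g b - g a))" by (intro h) auto
    qed
    also have "\<dots> = K * ((\<Sum>(a, b)\<in>D. norm (f b - f a)) + (\<Sum>(a, b)\<in>D. norm (g b - g a)))"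
      by (simp add: sum.distrib[symmetric] sum_distrib_left case_prod_beta')
    also have "\<dots> \<le> K * (\<eta> + \<eta>)"
      using \<delta>1(2)[OF D(1)] \<delta>2(2)[OF D(1)] D(2) \<open>0 \<le> K\<close>
      by (intro mult_left_mono add_mono less_imp_le[of _ \<eta>]) auto
    also have "\<dots> < (K + 1) * (\<eta> + \<eta>)" using \<open>\<eta> > 0\<close> by (intro mult_strict_right_mono) auto
    also have "\<dots> = (2 * (K + 1)) * \<eta>" by (simp add: algebra_simps)
    also have "\<dots> = \<epsilon>" using \<open>0 \<le> K\<close> by (simp add: \<eta>_def)
    finally show "(\<Sum>(a, b)\<in>D. norm (h b - h a)) < \<epsilon>" .
  qed (use \<delta>1 \<delta>2 in simp)
qed

lemma abs_continuous_on_subset: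
  assumes "abs_continuous_on S f" "S' \<subseteq> S"
  shows "abs_continuous_on S' f"
proof (unfold abs_continuous_on_iff, intro allI impI)
  fix \<epsilon> :: real assume "0 < \<epsilon>"
  obtain \<delta> where \<delta>: "\<delta> > 0" "\<And>D. nonoverlapping_in S D \<Longrightarrow>
     (\<Sum>(a, b)\<in>D. b - a) < \<delta> \<Longrightarrow> (\<Sum>(a, b)\<in>D. norm (f b - f a)) < \<epsilon>"
    using abs_continuous_onD[OF assms(1) \<open>\<epsilon> > 0\<close>] by metis
  show "\<exists>\<delta>>0. \<forall>D. nonoverlapping_in S' D \<longrightarrow>
     (\<Sum>(a, b)\<in>D. b - a) < \<delta> \<longrightarrow> (\<Sum>(a, b)\<in>D. norm (f b - f a)) < \<epsilon>"
  proof (intro exI[of _ \<delta>] conjI allI impI)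
    fix D assume D: "nonoverlapping_in S' D" "(\<Sum>(a, b)\<in>D. b - a) < \<delta>"
    have "nonoverlapping_in S D" using D(1) assms(2) unfolding nonoverlapping_in_def by blast
    then show "(\<Sum>(a, b)\<in>D. norm (f b - f a)) < \<epsilon>" by (rule \<delta>(2)) (fact D(2))
  qed (fact \<delta>(1))
qed

lemma abs_continuous_on_ident: "abs_continuous_on S (\<lambda>t. t)"
proof (unfold abs_continuous_on_iff, intro allI impI)
  fix \<epsilon> :: real assume "0 < \<epsilon>"
  have "(\<Sum>(a, b)\<in>D. norm (b - a)) = (\<Sum>(a, b)\<in>D. b - a)" if "nonoverlapping_in S D" for D
    using nonoverlapping_inD[OF that] by (intro sum.cong) auto
  then show "\<exists>\<delta>>0. \<forall>D. nonoverlapping_in S D \<longrightarrow>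
     (\<Sum>(a, b)\<in>D. b - a) < \<delta> \<longrightarrow> (\<Sum>(a, b)\<in>D. norm (b - a)) < \<epsilon>"
    using \<open>0 < \<epsilon>\<close> by (intro exI[of _ \<epsilon>]) auto
qed

text \<open>Families of intervals are only required to have disjoint interiors, whereas the
  Stieltjes measure that turns increments into measures is evaluated on half-open intervals.\<close>

lemma disjnt_Ioc:
  fixes a b a' b' :: real
  assumes "disjnt {a<..<b} {a'<..<b'}" "a \<le> b" "a' \<le> b'"
  shows "disjnt {a<..b} {a'<..b'}"
proof (rule ccontr)
  assume "\<not> ?thesis"
  then obtain x where "x \<in> {a<..b}" "x \<in> {a'<..b'}" unfolding disjnt_def by blast
  then have "(max a a' + x) / 2 \<in> {a<..<b} \<inter> {a'<..<b'}" by (auto simp: field_simps)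
  then show False using assms(1) unfolding disjnt_def by blast
qed

text \<open>The increments are Stieltjes measures of disjoint subintervals, so their sum is at most
  the measure of the whole interval.\<close>

lemma sum_increments_le:
  fixes G :: "real \<Rightarrow> real"
  assumes G: "mono_on {s..t} G" "continuous_on {s..t} G" and "s \<le> t"
    and no: "nonoverlapping_in {s..t} D"
  shows "(\<Sum>(a, b)\<in>D. G b - G a) \<le> G t - G s"
proof -
  have D: "finite D" "\<And>a b. (a, b) \<in> D \<Longrightarrow> a \<le> b \<and> {a..b} \<subseteq> {s..t}"
    "pairwise (\<lambda>(a, b) (a', b'). disjnt {a<..<b} {a'<..<b'}) D"
    using no unfolding nonoverlapping_in_def by auto
  \<comment> \<open>Constant extension outside \<open>{s..t}\<close>, since the measure is built
    from a function on the whole line.\<close>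
  define H where "H x = G (max s (min t x))" for x
  have H: "mono H" using G(1) \<open>s \<le> t\<close> unfolding H_def by (intro monoI mono_onD[OF G(1)]) auto
  have "continuous_on UNIV H" unfolding H_def
    by (intro continuous_on_compose2[OF G(2)] continuous_intros) (use \<open>s \<le> t\<close> in auto)
  then have "isCont H x" for x by (simp add: continuous_on_eq_continuous_at)
  then have rc: "continuous (at_right x) H" for x by (rule continuous_at_imp_continuous_at_within)
  let ?\<mu> = "interval_measure H"
  have \<mu>: "emeasure ?\<mu> {a<..b} = ennreal (H b - H a)" if "a \<le> b" for a b
    using emeasure_interval_measure_Ioc[OF that _ rc] H by (simp add: mono_def)
  have "(\<Sum>(a, b)\<in>D. G b - G a) = (\<Sum>i\<in>D. measure ?\<mu> {fst i<..snd i})"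
  proof (rule sum.cong)
    fix i assume "i \<in> D"
    obtain a b where i: "i = (a, b)" by (cases i)
    have "a \<le> b" "a \<in> {s..t}" "b \<in> {s..t}" using D(2)[of a b] \<open>i \<in> D\<close> i by auto
    moreover have "H a \<le> H b" using H \<open>a \<le> b\<close> by (simp add: mono_def)
    ultimately show "(case i of (a, b) \<Rightarrow> G b - G a) = measure ?\<mu> {fst i<..snd i}"
      by (simp add: measure_def \<mu> i) (simp add: H_def)
  qed simp
  also have "\<dots> = measure ?\<mu> (\<Union>i\<in>D. {fst i<..snd i})"
  proof (rule measure_finite_Union[symmetric])
    show "disjoint_family_on (\<lambda>i. {fst i<..snd i}) D"
      unfolding disjoint_family_on_def
    proof (intro ballI impI)
      fix i j assume ij: "i \<in> D" "j \<in> D" "i \<noteq> j"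
      then have "disjnt {fst i<..<snd i} {fst j<..<snd j}" using D(3)
          by (auto simp: pairwise_def split_beta)
      then show "{fst i<..snd i} \<inter> {fst j<..snd j} = {}"
        using disjnt_Ioc[of "fst i" "snd i" "fst j" "snd j"] D(2)[of "fst i" "snd i"] D(2)[of "fst
            j" "snd j"] ij
        by (simp add: disjnt_def)
    qed
    show "emeasure ?\<mu> {fst i<..snd i} \<noteq> \<infinity>" for i
      by (cases "fst i \<le> snd i") (simp_all add: \<mu>)
  qed (use D in auto)
  also have "\<dots> \<le> measure ?\<mu> {s<..t}"
  proof (rule measure_mono_fmeasurable)
    show "(\<Union>i\<in>D. {fst i<..snd i}) \<subseteq> {s<..t}"
    proof clarify
      fix x a b assume "(a, b) \<in> D" "x \<in> {fst (a, b)<..snd (a, b)}"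
      then show "x \<in> {s<..t}" using D(2)[of a b] by auto
    qed
    show "{s<..t} \<in> fmeasurable ?\<mu>" by (rule fmeasurableI) (auto simp: \<mu> \<open>s \<le> t\<close>)
    show "(\<Union>i\<in>D. {fst i<..snd i}) \<in> sets ?\<mu>" using D(1) by (auto intro!: sets.finite_UN)
  qed
  also have "\<dots> = G t - G s"
  proof -
    have "H s \<le> H t" using H \<open>s \<le> t\<close> by (simp add: mono_def)
    then show ?thesis using \<open>s \<le> t\<close> by (simp add: measure_def \<mu>) (simp add: H_def)
  qed
  finally show ?thesis .
qed

text \<open>Near \<open>0\<close> the increments are controlled by the small total increase of
  \<open>G\<close> on \<open>{0..\<tau>}\<close>, beyond \<open>\<tau>\<close> by a Lipschitz
  constant that may blow up as \<open>\<tau>\<close> tends to \<open>0\<close>. This gives absolute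
  continuity up to a point where the speed may be unbounded.\<close>

lemma abs_continuous_on_mono_Lipschitz_tail:
  assumes Gm: "mono_on {0..T} G" and Gc: "continuous_on {0..T} G" and "0 < T"
    and inc: "\<And>a b. 0 \<le> a \<Longrightarrow> a \<le> b \<Longrightarrow> b \<le> T \<Longrightarrow> norm (f b - f a) \<le> G b - G a"
    and lip: "\<And>\<tau>. 0 < \<tau> \<Longrightarrow> \<exists>L. \<forall>a b. \<tau> \<le> a \<longrightarrow> a \<le> b \<longrightarrow> b \<le> T \<longrightarrow> norm (f b - f a) \<le> L * (b - a)"
  shows "abs_continuous_on {0..T} f"
proof (unfold abs_continuous_on_iff, intro allI impI)
  fix \<epsilon> :: real assume "0 < \<epsilon>"
  obtain d where d: "d > 0" "\<And>s. s \<in> {0..T} \<Longrightarrow> dist s 0 < d \<Longrightarrow> dist (G s) (G 0) < \<epsilon> / 2"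
    using Gc \<open>0 < T\<close> \<open>0 < \<epsilon>\<close> unfolding continuous_on_iff
    by (metis atLeastAtMost_iff half_gt_zero less_eq_real_def order_refl)
  define \<tau> where "\<tau> = min T (d / 2)"
  have \<tau>: "0 < \<tau>" "\<tau> \<le> T" "\<tau> < d" using d(1) \<open>0 < T\<close> by (auto simp: \<tau>_def)
  have "dist (G \<tau>) (G 0) < \<epsilon> / 2" using \<tau> by (intro d(2)) auto
  then have G\<tau>: "G \<tau> - G 0 < \<epsilon> / 2" unfolding dist_real_def by linarith
  obtain L0 where L0: "\<And>a b. \<tau> \<le> a \<Longrightarrow> a \<le> b \<Longrightarrow> b \<le> T \<Longrightarrow> norm (f b - f a) \<le> L0 * (b - a)"
    using lip[OF \<open>0 < \<tau>\<close>] by blast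
  define L where "L = \<bar>L0\<bar> + 1"
  have L: "L > 0" "norm (f b - f a) \<le> L * (b - a)" if "\<tau> \<le> a" "a \<le> b" "b \<le> T" for a b
  proof -
    have "norm (f b - f a) \<le> L0 * (b - a)" using that by (rule L0)
    also have "\<dots> \<le> L * (b - a)" using that by (intro mult_right_mono) (auto simp: L_def)
    finally show "norm (f b - f a) \<le> L * (b - a)" .
  qed (simp add: L_def)
  have Lpos: "L > 0" by (simp add: L_def)
  have step: "norm (f b - f a) \<le> (G (min \<tau> b) - G (min \<tau> a)) + L * (b - a)" if ab: "0 \<le> a" "a
      \<le> b" "b \<le> T" for a b
  proof -
    \<comment> \<open>Every interval is split at \<open>\<tau>\<close> by clamping its endpoints
      from above and from below.\<close>
    have "f b - f a = (f (min \<tau> b) - f (min \<tau> a)) + (f (max \<tau> b) - f (max \<tau> a))"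
      using ab by (auto simp: min_def max_def)
    then have "norm (f b - f a) \<le> norm (f (min \<tau> b) - f (min \<tau> a)) + norm (f (max \<tau> b)
        - f (max \<tau> a))"
      by (metis norm_triangle_ineq)
    also have "norm (f (min \<tau> b) - f (min \<tau> a)) \<le> G (min \<tau> b) - G (min \<tau> a)"
      using ab \<tau> by (intro inc) auto
    also have "norm (f (max \<tau> b) - f (max \<tau> a)) \<le> L * (max \<tau> b - max \<tau> a)"
      using ab \<tau> by (intro L(2)) auto
    also have "L * (max \<tau> b - max \<tau> a) \<le> L * (b - a)"
      using ab Lpos by (intro mult_left_mono) auto
    finally show ?thesis by simp
  qed
  show "\<exists>\<delta>>0. \<forall>D. nonoverlapping_in {0..T} D \<longrightarrow>
     (\<Sum>(a, b)\<in>D. b - a) < \<delta> \<longrightarrow> (\<Sum>(a, b)\<in>D. norm (f b - f a)) < \<epsilon>"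
  proof (intro exI[of _ "\<epsilon> / (2 * L)"] conjI allI impI)
    fix D assume D: "nonoverlapping_in {0..T} D" "(\<Sum>(a, b)\<in>D. b - a) < \<epsilon> / (2 * L)"
    have G1: "(\<Sum>(a, b)\<in>D. (\<lambda>x. G (min \<tau> x)) b - (\<lambda>x. G (min \<tau> x)) a) \<le> (\<lambda>x. G (min \<tau> x)) T
        - (\<lambda>x. G (min \<tau> x)) 0"
    proof (rule sum_increments_le)
      show "mono_on {0..T} (\<lambda>x. G (min \<tau> x))"
        using \<tau> by (intro mono_onI mono_onD[OF Gm]) auto
      show "continuous_on {0..T} (\<lambda>x. G (min \<tau> x))"
        by (intro continuous_on_compose2[OF Gc] continuous_intros) (use \<tau> in auto)
    qed (use D \<open>0 < T\<close> in auto)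
    have "(\<Sum>(a, b)\<in>D. norm (f b - f a)) \<le> (\<Sum>(a, b)\<in>D. (G (min \<tau> b) - G (min \<tau> a)) + L * (b - a))"
    proof (rule sum_mono, clarify)
      fix a b assume "(a, b) \<in> D"
      then have "a \<le> b" "{a..b} \<subseteq> {0..T}" by (rule nonoverlapping_inD[OF D(1)])+
      then show "norm (f b - f a) \<le> (G (min \<tau> b) - G (min \<tau> a)) + L * (b - a)" by (intro step) auto
    qed
    also have "\<dots> = (\<Sum>(a, b)\<in>D. G (min \<tau> b) - G (min \<tau> a)) + L * (\<Sum>(a, b)\<in>D. b - a)"
      by (simp add: sum.distrib sum_distrib_left case_prod_beta')
    also have "\<dots> < \<epsilon> / 2 + \<epsilon> / 2"
    proof (rule add_less_le_mono)
      show "(\<Sum>(a, b)\<in>D. G (min \<tau> b) - G (min \<tau> a)) < \<epsilon> / 2"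
        using G1 \<tau> G\<tau> by simp
      have "L * (\<Sum>(a, b)\<in>D. b - a) \<le> L * (\<epsilon> / (2 * L))" using D(2) Lpos
          by (intro mult_left_mono) auto
      then show "L * (\<Sum>(a, b)\<in>D. b - a) \<le> \<epsilon> / 2" using Lpos by simp
    qed
    finally show "(\<Sum>(a, b)\<in>D. norm (f b - f a)) < \<epsilon>" by simp
  qed (use Lpos \<open>0 < \<epsilon>\<close> in simp)
qed

text \<open>Straddle estimate: \<open>u\<close> and \<open>v\<close> lie on either side of the point
  of differentiability, so the two errors add up to \<open>\<epsilon> * (v - u)\<close>.\<close>

lemma has_vector_derivative_nonpos_increment:
  fixes g :: "real \<Rightarrow> real"
  assumes "(g has_vector_derivative D) (at x within S)" "D \<le> 0" "0 < \<epsilon>"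
  shows "\<exists>d>0. \<forall>u v. u \<in> S \<longrightarrow> v \<in> S \<longrightarrow> u \<in> ball x d \<longrightarrow> v \<in> ball x d \<longrightarrow> u \<le> x \<longrightarrow> x \<le> v \<longrightarrow> g v - g u
      \<le> \<epsilon> * (v - u)"
proof -
  obtain d where d: "d > 0" "\<And>y. y \<in> S \<Longrightarrow> norm (y - x) < d \<Longrightarrow> norm (g y - g x - (y - x) *\<^sub>R D)
      \<le> \<epsilon> * norm (y - x)"
    using assms(1,3) unfolding has_vector_derivative_def has_derivative_within_alt by blast
  have "g v - g u \<le> \<epsilon> * (v - u)" if "u \<in> S" "v \<in> S" "u \<in> ball x d" "v \<in> ball x d" "u \<le> x" "x \<le> v"
      for u v
  proof -
    have "g v - g x - (v - x) * D \<le> \<epsilon> * (v - x)" using d(2)[of v] that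
        by (auto simp: dist_real_def abs_le_iff)
    moreover have "g x - g u - (x - u) * D \<le> \<epsilon> * (x - u)" using d(2)[of u] that
      by (auto simp: dist_real_def abs_le_iff algebra_simps)
    moreover have "(v - x) * D \<le> 0" "(x - u) * D \<le> 0" using that assms(2)
        by (auto simp: mult_nonneg_nonpos)
    ultimately show ?thesis by (simp add: algebra_simps)
  qed
  with d(1) show ?thesis by blast
qed

text \<open>A gauge argument. Points of \<open>N\<close> get balls inside an open set whose measure
  is below the modulus of absolute continuity, all other points get balls from the straddle
  estimate. In a tagged division fine for this gauge, each of the two kinds of pieces contributes
  less than \<open>e / 2\<close> to \<open>g b - g a\<close>.\<close>

lemma abs_continuous_nonincreasing:
  fixes g :: "real \<Rightarrow> real"
  assumes ac: "abs_continuous_on {a..b} g" and "a \<le> b" and N: "negligible N"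
    and der: "\<And>t. t \<in> {a..b} - N \<Longrightarrow> \<exists>D\<le>0. (g has_vector_derivative D) (at t within {a..b})"
  shows "g b \<le> g a"
proof (rule field_le_epsilon)
  fix e :: real assume "0 < e"
  \<comment> \<open>One is added so that a degenerate interval causes no division by zero.\<close>
  define n where "n = b - a + 1"
  define \<epsilon> where "\<epsilon> = e / (2 * n)"
  have "n > 0" using \<open>a \<le> b\<close> by (simp add: n_def)
  have "\<epsilon> > 0" using \<open>0 < e\<close> \<open>n > 0\<close> by (simp add: \<epsilon>_def)
  obtain \<delta> where \<delta>: "0 < \<delta>"
    "\<And>D. nonoverlapping_in {a..b} D \<Longrightarrow>
     (\<Sum>(u, v)\<in>D. v - u) < \<delta> \<Longrightarrow> (\<Sum>(u, v)\<in>D. norm (g v - g u)) < e / 2"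
    using abs_continuous_onD[OF ac, of "e / 2"] \<open>0 < e\<close> by (metis half_gt_zero)
  obtain U where U: "open U" "N \<subseteq> U" "U \<in> lmeasurable" "measure lebesgue U < \<delta>"
    using lmeasurable_outer_open[OF negligible_imp_measurable[OF N] \<open>0 < \<delta>\<close>]
        negligible_imp_measure0[OF N] by auto
  have "\<exists>d>0. if t \<in> N then ball t d \<subseteq> U else (\<forall>u v. u \<in> {a..b} \<longrightarrow> v \<in> {a..b} \<longrightarrow> u \<in> ball t d
      \<longrightarrow> v \<in> ball t d \<longrightarrow> u \<le> t \<longrightarrow> t \<le> v \<longrightarrow> g v - g u \<le> \<epsilon> * (v - u))" for t
  proof (cases "t \<in> N")
    case True
    then show ?thesis using U(1,2) by (auto simp: open_contains_ball)
  next
    case False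
    show ?thesis
    proof (cases "t \<in> {a..b}")
      case True
      then obtain D where "D \<le> 0" "(g has_vector_derivative D) (at t within {a..b})" using der False
          by blast
      then show ?thesis using has_vector_derivative_nonpos_increment[of g D t "{a..b}" \<epsilon>] \<open>\<epsilon> > 0\<close>
          False by simp
    qed (use False in \<open>auto intro!: exI[of _ 1]\<close>)
  qed
  then obtain d where d: "\<And>t. d t > 0" "\<And>t. if t \<in> N then ball t (d t) \<subseteq> U else (\<forall>u v. u \<in> {a..b}
      \<longrightarrow> v \<in> {a..b} \<longrightarrow> u \<in> ball t (d t) \<longrightarrow> v \<in> ball t (d t) \<longrightarrow> u \<le> t \<longrightarrow> t \<le> v \<longrightarrow> g v - g u \<le> \<epsilon> * (v - u))"
    by metis
  obtain p where p: "p tagged_division_of {a..b}" "(\<lambda>t. ball t (d t)) fine p"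
    using fine_division_exists_real[of "\<lambda>t. ball t (d t)" a b] gauge_ball_dependent[of d] d(1)
        by metis
  have fin: "finite p" using p(1) by blast
  have pk: "Inf K \<le> x \<and> x \<le> Sup K \<and> {Inf K..Sup K} \<subseteq> {a..b} \<and> {Inf K..Sup K} \<subseteq> ball x (d x)"
    and pkI: "interior K = {Inf K<..<Sup K}" if "(x, K) \<in> p" for x K
  proof -
    have "\<exists>u v. K = cbox u v" using tagged_division_ofD(4)[OF p(1) that] by blast
    then obtain u v where "K = cbox u v" by blast
    moreover have "x \<in> K" "K \<subseteq> {a..b}" using tagged_division_ofD(2,3)[OF p(1) that] by auto
    moreover have "K \<subseteq> ball x (d x)" using p(2) that by (auto simp: fine_def)
    ultimately have 1: "u \<le> v" "K = {u..v}" "x \<in> {u..v}" "{u..v} \<subseteq> {a..b}" "K \<subseteq> ball x (d x)"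
        by auto
    then have 2: "Inf K = u" "Sup K = v" by simp_all
    show "Inf K \<le> x \<and> x \<le> Sup K \<and> {Inf K..Sup K} \<subseteq> {a..b} \<and> {Inf K..Sup K} \<subseteq> ball x (d x)"
      "interior K = {Inf K<..<Sup K}" unfolding 2 using 1 by simp_all
  qed
  define pN where "pN = {(x, K) \<in> p. x \<in> N}"
  have pN: "pN \<subseteq> p" "finite pN" using fin by (auto simp: pN_def intro: finite_subset)
  define I where "I = (\<lambda>(x::real, K::real set). (Inf K, Sup K))"
  have disj: "disjnt {Inf K<..<Sup K} {Inf K'<..<Sup K'}"
      if "(x, K) \<in> p" "(x', K') \<in> p" "(x, K) \<noteq> (x', K')" for x K x' K'
  proof -
    have "interior K \<inter> interior K' = {}" using tagged_division_ofD(5)[OF p(1) that] .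
    then show ?thesis unfolding pkI[OF that(1)] pkI[OF that(2)] disjnt_def .
  qed
  have disjI: "pairwise (\<lambda>(u, v) (u', v'). disjnt {u<..<v} {u'<..<v'}) (I ` pN)"
  proof (rule pairwiseI)
    fix z z' assume A: "z \<in> I ` pN" "z' \<in> I ` pN" "z \<noteq> z'"
    then obtain i j where ij: "i \<in> pN" "z = I i" "j \<in> pN" "z' = I j" by blast
    obtain x K x' K' where xK: "i = (x, K)" "j = (x', K')" by (cases i, cases j)
    have "(x, K) \<in> p" "(x', K') \<in> p" "(x, K) \<noteq> (x', K')" using A(3) ij pN(1) xK by auto
    then have "disjnt {Inf K<..<Sup K} {Inf K'<..<Sup K'}" by (rule disj)
    then show "(\<lambda>(u, v) (u', v'). disjnt {u<..<v} {u'<..<v'}) z z'" by (simp add: ij xK I_def)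
  qed
  \<comment> \<open>Distinct pieces with the same endpoints have disjoint interiors, hence are
    single points with zero increment; so the sums may be indexed by pairs of endpoints.\<close>
  have nontriv: "(\<lambda>(u, v). h v - h u) (I i) = (0::real)" if "i \<in> pN" "j \<in> pN" "i \<noteq> j" "I i = I j"
      for i j and h :: "real \<Rightarrow> real"
  proof -
    obtain x K x' K' where ij: "i = (x, K)" "j = (x', K')" by (cases i, cases j)
    then have "disjnt {Inf K<..<Sup K} {Inf K'<..<Sup K'}" using disj[of x K x' K'] that pN(1)
        by auto
    then have "{Inf K<..<Sup K} = {}" using that(4) ij by (simp add: I_def disjnt_def)
    moreover have "Inf K \<le> Sup K" using pk[of x K] that(1) ij pN(1) by auto
    ultimately have "Inf K = Sup K" by (simp add: greaterThanLessThan_empty_iff)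
    then show ?thesis using ij by (simp add: I_def)
  qed
  have "(\<Sum>(u, v)\<in>I ` pN. v - u) = (\<Sum>i\<in>I ` pN. measure lebesgue {fst i<..<snd i})"
  proof (rule sum.cong)
    fix i assume "i \<in> I ` pN"
    then obtain x K where "(x, K) \<in> pN" and i: "i = (Inf K, Sup K)" by (auto simp: I_def)
    then have "Inf K \<le> Sup K" using pk[of x K] pN(1) by auto
    then show "(case i of (u, v) \<Rightarrow> v - u) = measure lebesgue {fst i<..<snd i}" by (simp add: i)
  qed simp
  also have "\<dots> = measure lebesgue (\<Union>i\<in>I ` pN. {fst i<..<snd i})"
  proof (rule measure_finite_Union[symmetric])
    show "disjoint_family_on (\<lambda>i. {fst i<..<snd i}) (I ` pN)"
      unfolding disjoint_family_on_def
    proof (intro ballI impI)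
      fix i j assume "i \<in> I ` pN" "j \<in> I ` pN" "i \<noteq> j"
      from pairwiseD[OF disjI this] show "{fst i<..<snd i} \<inter> {fst j<..<snd j} = {}"
        by (simp add: disjnt_def split_beta)
    qed
    show "emeasure lebesgue {fst i<..<snd i} \<noteq> \<infinity>" for i :: "real \<times> real"
      by (cases "fst i \<le> snd i") simp_all
  qed (use pN(2) in auto)
  also have "\<dots> \<le> measure lebesgue U"
  proof (rule measure_mono_fmeasurable[OF _ _ U(3)])
    have "{fst (I i)<..<snd (I i)} \<subseteq> U" if "i \<in> pN" for i
    proof -
      obtain x K where i: "i = (x, K)" by (cases i)
      then have "(x, K) \<in> p" "x \<in> N" using that by (auto simp: pN_def)
      then have "{Inf K..Sup K} \<subseteq> ball x (d x)" "ball x (d x) \<subseteq> U"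
        using pk[of x K] d(2)[of x] by simp_all
      moreover have "{Inf K<..<Sup K} \<subseteq> {Inf K..Sup K}" by auto
      ultimately show ?thesis unfolding i I_def by simp
    qed
    then show "(\<Union>i\<in>I ` pN. {fst i<..<snd i}) \<subseteq> U" by blast
    show "(\<Union>i\<in>I ` pN. {fst i<..<snd i}) \<in> sets lebesgue" using pN(2) by (intro sets.finite_UN) auto
  qed
  also have "\<dots> < \<delta>" by (rule U(4))
  finally have small: "(\<Sum>(u, v)\<in>I ` pN. v - u) < \<delta>" .
  have "(\<Sum>(u, v)\<in>I ` pN. norm (g v - g u)) < e / 2"
  proof (rule \<delta>(2)[OF _ small])
    have "u \<le> v \<and> {u..v} \<subseteq> {a..b}" if uv: "(u, v) \<in> I ` pN" for u v
    proof -
      obtain x K where "(x, K) \<in> pN" "u = Inf K" "v = Sup K" using uv by (auto simp: I_def)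
      then show ?thesis using pk[of x K] pN(1) by auto
    qed
    then show "nonoverlapping_in {a..b} (I ` pN)"
      using disjI pN(2) unfolding nonoverlapping_in_def by blast
  qed
  moreover have "(\<Sum>(u, v)\<in>I ` pN. g v - g u) \<le> (\<Sum>(u, v)\<in>I ` pN. norm (g v - g u))"
    by (rule sum_mono) auto
  moreover have "(\<Sum>(u, v)\<in>I ` pN. g v - g u) = (\<Sum>i\<in>pN. (\<lambda>(u, v). g v - g u) (I i))"
    by (rule sum.reindex_nontrivial[OF pN(2), unfolded o_def]) (use nontriv in blast)
  ultimately have 1: "(\<Sum>(x, K)\<in>pN. g (Sup K) - g (Inf K)) < e / 2"
    by (simp add: I_def case_prod_beta')
  have "(\<Sum>(x, K)\<in>p - pN. g (Sup K) - g (Inf K)) \<le> (\<Sum>(x, K)\<in>p - pN. \<epsilon> * (Sup K - Inf K))"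
  proof (rule sum_mono, clarify)
    fix x K assume xK: "(x, K) \<in> p" "(x, K) \<notin> pN"
    then have "x \<notin> N" by (auto simp: pN_def)
    then have *: "\<forall>u v. u \<in> {a..b} \<longrightarrow> v \<in> {a..b} \<longrightarrow> u \<in> ball x (d x) \<longrightarrow> v \<in> ball x (d x) \<longrightarrow> u \<le> x \<longrightarrow> x
        \<le> v \<longrightarrow> g v - g u \<le> \<epsilon> * (v - u)"
      using d(2)[of x] by simp
    have "Inf K \<in> {Inf K..Sup K}" "Sup K \<in> {Inf K..Sup K}" using pk[OF xK(1)] by auto
    then show "g (Sup K) - g (Inf K) \<le> \<epsilon> * (Sup K - Inf K)"
      using pk[OF xK(1)] by (intro *[rule_format]) blast+
  qed
  also have "\<dots> \<le> (\<Sum>(x, K)\<in>p. \<epsilon> * (Sup K - Inf K))"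
  proof (rule sum_mono2[OF fin])
    fix i assume i: "i \<in> p - (p - pN)"
    obtain x K where "i = (x, K)" by (cases i)
    with i pk[of x K] \<open>\<epsilon> > 0\<close> show "0 \<le> (case i of (x, K) \<Rightarrow> \<epsilon> * (Sup K - Inf K))" by auto
  qed auto
  also have "\<dots> = \<epsilon> * (b - a)"
    using additive_tagged_division_1[OF \<open>a \<le> b\<close> p(1), of "\<lambda>x. x"]
    by (simp add: sum_distrib_left[symmetric] case_prod_beta')
  also have "\<dots> < \<epsilon> * n" using \<open>\<epsilon> > 0\<close> by (simp add: n_def)
  also have "\<dots> = e / 2" using \<open>n > 0\<close> by (simp add: \<epsilon>_def)
  finally have "(\<Sum>(x, K)\<in>p - pN. g (Sup K) - g (Inf K)) < e / 2" .
  moreover have "(\<Sum>(x, K)\<in>p. g (Sup K) - g (Inf K)) = (\<Sum>(x, K)\<in>p - pN. g (Sup K) - g (Inf K))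
      + (\<Sum>(x, K)\<in>pN. g (Sup K) - g (Inf K))"
    by (rule sum.subset_diff[OF pN(1) fin])
  ultimately show "g b \<le> g a + e"
    using 1 additive_tagged_division_1[OF \<open>a \<le> b\<close> p(1), of g] by simp
qed

section \<open>Subgradients and the implicit Euler scheme for a moving metric\<close>

definition spd_map :: "('a::euclidean_space \<Rightarrow> 'a) \<Rightarrow> bool" where
  "spd_map N \<longleftrightarrow> linear N \<and> (\<forall>x y. N x \<bullet> y = x \<bullet> N y) \<and> (\<forall>x. x \<noteq> 0 \<longrightarrow> 0 < x \<bullet> N x)"

lemma spd_map_coercive:
  fixes N :: "'a::euclidean_space \<Rightarrow> 'a"
  assumes "spd_map N"
  obtains c where "0 < c" "\<And>x. c * (norm x)\<^sup>2 \<le> x \<bullet> N x"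
proof -
  have lin: "linear N" and pos: "\<And>x. x \<noteq> 0 \<Longrightarrow> 0 < x \<bullet> N x" using assms by (auto simp: spd_map_def)
  have cont: "continuous_on (sphere 0 1) (\<lambda>x. x \<bullet> N x)"
    by (intro continuous_intros linear_continuous_on linear_conv_bounded_linear[THEN iffD1] lin)
  have ne: "sphere (0::'a) 1 \<noteq> {}" by simp
  obtain u where u: "u \<in> sphere 0 1" "\<And>y. y \<in> sphere 0 1 \<Longrightarrow> u \<bullet> N u \<le> y \<bullet> N y"
    using continuous_attains_inf[OF compact_sphere ne cont] by blast
  show thesis
  proof (rule that[of "u \<bullet> N u"])
    have "u \<noteq> 0" using u(1) by auto
    then show "0 < u \<bullet> N u" by (rule pos)
    fix x :: 'a
    show "u \<bullet> N u * (norm x)\<^sup>2 \<le> x \<bullet> N x"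
    proof (cases "x = 0")
      case False
      define y where "y = (1 / norm x) *\<^sub>R x"
      have "u \<bullet> N u \<le> y \<bullet> N y" using False by (intro u(2)) (simp add: y_def)
      then have "u \<bullet> N u * (norm x)\<^sup>2 \<le> (y \<bullet> N y) * (norm x)\<^sup>2" by (intro mult_right_mono) auto
      also have "\<dots> = x \<bullet> N x" using False
        by (simp add: y_def linear_scale[OF lin] power2_eq_square)
      finally show ?thesis .
    qed (simp add: linear_0[OF lin])
  qed
qed

lemma spd_map_quad_diff:
  assumes "spd_map N"
  shows "(x - y) \<bullet> N (x - y) = x \<bullet> N x - 2 * (N x \<bullet> y) + y \<bullet> N y"
proof -
  have lin: "linear N" and sym: "\<And>x y. N x \<bullet> y = x \<bullet> N y" using assms by (auto simp: spd_map_def)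
  show ?thesis
    by (simp add: linear_diff[OF lin] inner_diff_left inner_diff_right sym[of x y] inner_commute[of
        y "N x"])
qed

lemma spd_map_nonneg: "spd_map N \<Longrightarrow> 0 \<le> x \<bullet> N x"
  by (cases "x = 0") (auto simp: spd_map_def linear_0 intro: less_imp_le)

lemma spd_map_linear: "spd_map N \<Longrightarrow> linear N" by (simp add: spd_map_def)
lemma spd_map_sym: "spd_map N \<Longrightarrow> N x \<bullet> y = x \<bullet> N y" by (simp add: spd_map_def)

lemma spd_map_bound:
  assumes "spd_map N"
  obtains B where "0 < B" "\<And>x. x \<bullet> N x \<le> B * (norm x)\<^sup>2"
proof -
  obtain B where B: "0 < B" "\<And>x. norm (N x) \<le> B * norm x"
    using linear_bounded_pos[OF spd_map_linear[OF assms]] by blast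
  show thesis
  proof (rule that[OF B(1)])
    fix x
    have "x \<bullet> N x \<le> norm x * norm (N x)" by (rule norm_cauchy_schwarz)
    also have "\<dots> \<le> norm x * (B * norm x)" by (intro mult_left_mono B) auto
    finally show "x \<bullet> N x \<le> B * (norm x)\<^sup>2" by (simp add: power2_eq_square mult_ac)
  qed
qed

text \<open>An extended-real function is represented by its effective domain \<open>D\<close> and
  its real values there. Closedness of the epigraph in the whole space encodes lower semicontinuity
  and forces \<open>f\<close> to tend to infinity at points of the closure outside
  \<open>D\<close>.\<close>

locale closed_convex_function =
  fixes D :: "'a::euclidean_space set" and f :: "'a \<Rightarrow> real" and \<beta> :: real
  assumes D_ne: "D \<noteq> {}" and f_convex: "convex_on D f"
    and epi_closed: "closed {(x, a). x \<in> D \<and> f x \<le> a}"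
    and f_lower: "\<And>x. x \<in> D \<Longrightarrow> \<beta> \<le> f x"
begin

definition subgrad :: "'a \<Rightarrow> 'a \<Rightarrow> bool" where
  "subgrad x \<xi> \<longleftrightarrow> x \<in> D \<and> (\<forall>z\<in>D. f x + \<xi> \<bullet> (z - x) \<le> f z)"

text \<open>The point is a minimiser of \<open>f\<close> plus the quadratic
  \<open>(x \<bullet> N x) / 2 - g \<bullet> x\<close>, and its first-order condition is the claimed
  subgradient. In operator language, \<open>N\<close> plus the subdifferential is onto.\<close>

lemma resolvent_exists:
  assumes N: "spd_map N"
  obtains x where "subgrad x (g - N x)"
proof -
  obtain c where c: "0 < c" "\<And>x. c * (norm x)\<^sup>2 \<le> x \<bullet> N x" using spd_map_coercive[OF N] by blast
  have lin: "linear N" by (rule spd_map_linear[OF N])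
  define q where "q x = (x \<bullet> N x) / 2 - g \<bullet> x" for x
  define F where "F x = f x + q x" for x
  obtain x0 where x0: "x0 \<in> D" using D_ne by blast
  have q_low: "- (norm g * norm x) \<le> q x" and q_coer: "c * (norm x)\<^sup>2 / 2 - norm g * norm x \<le> q x"
      for x
  proof -
    have "g \<bullet> x \<le> norm g * norm x" by (rule norm_cauchy_schwarz)
    then show "c * (norm x)\<^sup>2 / 2 - norm g * norm x \<le> q x" using c(2)[of x] by (simp add: q_def)
    then show "- (norm g * norm x) \<le> q x" using c(1)
        by (smt (verit) divide_nonneg_nonneg mult_nonneg_nonneg zero_le_power2)
  qed
  \<comment> \<open>Beyond this radius the quadratic part exceeds
    \<open>\<bar>F x0 - \<beta>\<bar>\<close>, which confines the sublevel set of \<open>x0\<close>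
    to the ball.\<close>
  define r where "r = max 1 (2 * (norm g + \<bar>F x0 - \<beta>\<bar> + 1) / c)"
  have r: "norm x \<le> r" if "x \<in> D" "F x \<le> F x0" for x
  proof (rule ccontr)
    assume "\<not> norm x \<le> r"
    then have n: "norm x > 1" "norm x > 2 * (norm g + \<bar>F x0 - \<beta>\<bar> + 1) / c" by (auto simp: r_def)
    then have "norm g + \<bar>F x0 - \<beta>\<bar> + 1 < c * norm x / 2" using c(1) by (simp add: field_simps)
    then have "1 * (\<bar>F x0 - \<beta>\<bar> + 1) \<le> norm x * (c * norm x / 2 - norm g)" using n(1)
      by (intro mult_mono) auto
    also have "\<dots> = c * (norm x)\<^sup>2 / 2 - norm g * norm x"
        by (simp add: algebra_simps power2_eq_square)
    finally have "\<bar>F x0 - \<beta>\<bar> + 1 \<le> q x" using q_coer[of x] by simp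
    then show False using f_lower[OF that(1)] that(2) by (simp add: F_def)
  qed
  \<comment> \<open>A compact piece of the epigraph: the height coordinate is continuous on it,
    whereas \<open>f\<close> is only lower semicontinuous.\<close>
  define A where "A = {(x, a). x \<in> D \<and> f x \<le> a} \<inter> (cball 0 r \<times> {\<beta>..F x0 + norm g * r})"
  have "compact A" unfolding A_def
    by (intro closed_Int_compact epi_closed compact_Times compact_cball compact_Icc)
  have inA: "(x, f x) \<in> A" if "x \<in> D" "F x \<le> F x0" for x
  proof -
    have "f x \<le> F x0 + norm g * norm x" using that(2) q_low[of x] by (simp add: F_def)
    also have "\<dots> \<le> F x0 + norm g * r" using r[OF that] by (intro add_left_mono mult_left_mono) auto
    finally show ?thesis using that(1) r[OF that] f_lower[OF that(1)] by (auto simp: A_def)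
  qed
  have "A \<noteq> {}" using inA[OF x0] by auto
  have qcont: "continuous_on S q" for S unfolding q_def
    by (intro continuous_intros linear_continuous_on linear_conv_bounded_linear[THEN iffD1] lin)
        auto
  have "continuous_on A (\<lambda>p. snd p + q (fst p))"
    by (intro continuous_intros continuous_on_compose2[OF qcont[of UNIV]]) auto
  then obtain p where p: "p \<in> A" "\<And>p'. p' \<in> A \<Longrightarrow> snd p + q (fst p) \<le> snd p' + q (fst p')"
    using continuous_attains_inf[OF \<open>compact A\<close> \<open>A \<noteq> {}\<close>] by blast
  define x where "x = fst p"
  have x: "x \<in> D" "f x \<le> snd p" using p(1) by (auto simp: A_def x_def)
  have minF: "F x \<le> F z" if "z \<in> D" for z
  proof -
    have 1: "F x \<le> F y" if "y \<in> D" "F y \<le> F x0" for y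
      using p(2)[OF inA[OF that]] x by (simp add: F_def x_def)
    show ?thesis using 1[OF that] 1[OF x0] by linarith
  qed
  have "f x + (g - N x) \<bullet> (z - x) \<le> f z" if z: "z \<in> D" for z
  proof -
    define C where "C = (z - x) \<bullet> N (z - x) / 2"
    define B where "B = f z - f x - (g - N x) \<bullet> (z - x)"
    have "0 \<le> C" using spd_map_nonneg[OF N] by (simp add: C_def)
    \<comment> \<open>Minimality is used at the point a fraction \<open>s\<close> of the way from
      \<open>x\<close> to \<open>z\<close>, and divided by \<open>s\<close>; the second-order term
      \<open>s * C\<close> vanishes as \<open>s\<close> tends to \<open>0\<close>.\<close>
    have *: "0 \<le> B + s * C" if s: "0 < s" "s \<le> 1" for s
    proof -
      define y where "y = (1 - s) *\<^sub>R x + s *\<^sub>R z"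
      have y: "y - x = s *\<^sub>R (z - x)" by (simp add: y_def algebra_simps)
      have "y \<in> D" "f y \<le> (1 - s) * f x + s * f z"
        using convex_onD[OF f_convex, of s x z] x z s convexD_alt[OF convex_on_imp_convex[OF
            f_convex], of x z s]
        by (auto simp: y_def)
      moreover have "q y = q x + (N x - g) \<bullet> (y - x) + (y - x) \<bullet> N (y - x) / 2"
        using spd_map_quad_diff[OF N, of "y" x] spd_map_sym[OF N, of x x] spd_map_sym[OF N, of x y]
        by (simp add: q_def inner_diff_left inner_diff_right inner_commute spd_map_sym[OF N, of y x]
            field_simps)
      ultimately have "F x \<le> (1 - s) * f x + s * f z + q x + (N x - g) \<bullet> (y - x) + (y - x) \<bullet> N (y
          - x) / 2"
        using minF[of y] by (simp add: F_def)
      moreover have "(y - x) \<bullet> N (y - x) = s * (s * (2 * C))"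
        by (simp add: y C_def linear_scale[OF lin])
      moreover have "(N x - g) \<bullet> (y - x) = - (s * ((g - N x) \<bullet> (z - x)))"
        by (simp add: y inner_diff_left algebra_simps)
      ultimately have "0 \<le> s * (B + s * C)"
        by (simp add: F_def B_def algebra_simps del: inner_diff_left inner_diff_right)
      then show ?thesis using s by (simp add: zero_le_mult_iff)
    qed
    have "0 \<le> B"
    proof (rule field_le_epsilon)
      fix e :: real assume "0 < e"
      define s where "s = min 1 (e / (C + 1))"
      have s: "0 < s" "s \<le> 1" "s \<le> e / (C + 1)" using \<open>0 \<le> C\<close> \<open>0 < e\<close> by (auto simp: s_def)
      then have "s * C \<le> e / (C + 1) * C" using \<open>0 \<le> C\<close> by (intro mult_right_mono) auto
      also have "\<dots> \<le> e" using \<open>0 \<le> C\<close> \<open>0 < e\<close> by (simp add: field_simps)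
      finally show "0 \<le> B + e" using *[OF s(1,2)] by simp
    qed
    then show ?thesis by (simp add: B_def)
  qed
  then show thesis using that[of x] x(1) unfolding subgrad_def by blast
qed

end


section \<open>Gradient flow in a growing metric: a single implicit step\<close>

locale moving_metric_flow = closed_convex_function D f \<beta>
  for D :: "'a::euclidean_space set" and f \<beta> +
  fixes P M :: "'a \<Rightarrow> 'a" and b :: 'a
  assumes P: "spd_map P" and M: "spd_map M"
begin

definition S :: "real \<Rightarrow> 'a \<Rightarrow> 'a" where "S t x = P x + (2 * t) *\<^sub>R M x"
definition Q :: "real \<Rightarrow> 'a \<Rightarrow> real" where "Q t x = x \<bullet> S t x"
abbreviation qM :: "'a \<Rightarrow> real" where "qM x \<equiv> x \<bullet> M x"
definition \<phi> :: "'a \<Rightarrow> real" where "\<phi> x = f x + (x \<bullet> M x) / 2 - b \<bullet> x"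

lemma S_spd_map: "0 \<le> t \<Longrightarrow> spd_map (S t)"
  unfolding spd_map_def
proof (intro conjI allI impI)
  assume "0 \<le> t"
  show "linear (S t)" unfolding S_def[abs_def]
    by (intro linear_compose_add linear_compose_scale_right spd_map_linear P M)
  show "S t x \<bullet> y = x \<bullet> S t y" for x y
    by (simp add: S_def inner_add_left inner_add_right spd_map_sym[OF P] spd_map_sym[OF M])
  show "0 < x \<bullet> S t x" if "x \<noteq> 0" for x
  proof -
    have "0 < x \<bullet> P x" using P that by (simp add: spd_map_def)
    moreover have "0 \<le> x \<bullet> M x" by (rule spd_map_nonneg[OF M])
    ultimately show ?thesis using \<open>0 \<le> t\<close> by (simp add: S_def inner_add_right add_pos_nonneg)
  qed
qed

lemma Q_add: "Q (t + s) x = Q t x + 2 * s * (x \<bullet> M x)"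
  by (simp add: Q_def S_def inner_add_right algebra_simps)

lemma Q_diff: "0 \<le> t \<Longrightarrow> Q t (x - y) = Q t x - 2 * (S t x \<bullet> y) + Q t y"
  unfolding Q_def by (rule spd_map_quad_diff[OF S_spd_map])

lemma Q_nonneg: "0 \<le> t \<Longrightarrow> 0 \<le> Q t x"
  unfolding Q_def by (rule spd_map_nonneg[OF S_spd_map])

definition P_coercivity :: real where "P_coercivity = (SOME c. 0 < c \<and> (\<forall>x. c * (norm x)\<^sup>2
    \<le> x \<bullet> P x))"

lemma P_coercivity_pos: "0 < P_coercivity" and P_coercivity_P: "P_coercivity * (norm x)\<^sup>2 \<le> x \<bullet> P x"
proof -
  have "\<exists>c. 0 < c \<and> (\<forall>x. c * (norm x)\<^sup>2 \<le> x \<bullet> P x)" using spd_map_coercive[OF P] by metis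
  from someI_ex[OF this] show "0 < P_coercivity" "P_coercivity * (norm x)\<^sup>2 \<le> x \<bullet> P x"
      unfolding P_coercivity_def by auto
qed

text \<open>\<open>M\<close> is nonnegative, so the metric at every later time dominates the one at
  time \<open>0\<close>, and one coercivity constant serves for all times.\<close>

lemma P_coercivity_Q: "0 \<le> t \<Longrightarrow> P_coercivity * (norm x)\<^sup>2 \<le> Q t x"
  using P_coercivity_P[of x] spd_map_nonneg[OF M, of x]
      by (simp add: Q_def S_def inner_add_right add_increasing2)

lemma phi_strong:
  assumes "subgrad x \<xi>" "z \<in> D"
  shows "\<phi> x + (\<xi> + M x - b) \<bullet> (z - x) + qM (z - x) / 2 \<le> \<phi> z"
proof -
  have "f x + \<xi> \<bullet> (z - x) \<le> f z" using assms by (simp add: subgrad_def)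
  moreover have "(\<xi> + M x - b) \<bullet> (z - x) = \<xi> \<bullet> (z - x) + M x \<bullet> z - x \<bullet> M x - b \<bullet> z + b \<bullet> x"
    by (simp add: inner_add_left inner_diff_left inner_diff_right inner_commute[of "M x" x])
  moreover have "M z \<bullet> x = M x \<bullet> z" using spd_map_sym[OF M, of x z] by (simp add: inner_commute)
  ultimately show ?thesis unfolding spd_map_quad_diff[OF M] \<phi>_def
      by (simp add: diff_divide_distrib add_divide_distrib)
qed

text \<open>The quadratic part of \<open>\<phi>\<close> is expanded exactly, so the inequality with
  its full quadratic gain is equivalent to the subgradient inequality for \<open>f\<close>. This
  direction recovers the inclusion from the limit inequality.\<close>

lemma phi_strong_conv:
  assumes "x \<in> D" "\<And>z. z \<in> D \<Longrightarrow> \<phi> x + \<eta> \<bullet> (z - x) + qM (z - x) / 2 \<le> \<phi> z"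
  shows "subgrad x (\<eta> - M x + b)"
  unfolding subgrad_def
proof (intro conjI ballI)
  fix z assume "z \<in> D"
  note assms(2)[OF this]
  moreover have "(\<eta> - M x + b) \<bullet> (z - x) = \<eta> \<bullet> (z - x) - M x \<bullet> z + x \<bullet> M x + b \<bullet> z - b \<bullet> x"
    by (simp add: inner_add_left inner_diff_left inner_diff_right inner_commute[of "M x" x])
  moreover have "M z \<bullet> x = M x \<bullet> z" using spd_map_sym[OF M, of x z] by (simp add: inner_commute)
  ultimately show "f x + (\<eta> - M x + b) \<bullet> (z - x) \<le> f z"
    unfolding spd_map_quad_diff[OF M] \<phi>_def by (simp add: diff_divide_distrib add_divide_distrib)
qed fact

text \<open>An implicit Euler step of size \<open>h\<close> for \<open>S t m' \<in> - \<partial>\<phi> m\<close>; the quadratic term is the strong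
  convexity of \<open>\<phi>\<close>.\<close>

definition is_step :: "real \<Rightarrow> real \<Rightarrow> 'a \<Rightarrow> 'a \<Rightarrow> bool" where
  "is_step h t w x \<longleftrightarrow> x \<in> D \<and> (\<forall>z\<in>D. \<phi> x - (S t (x - w) \<bullet> (z - x)) / h + qM (z - x) / 2 \<le> \<phi> z)"

lemma step_exists:
  assumes "0 < h" "0 \<le> t"
  shows "\<exists>x. is_step h t w x"
proof -
  \<comment> \<open>The step solves \<open>0 \<in> S t (x - w) / h + \<partial>\<phi> x\<close>,
    which is a resolvent equation for \<open>S t / h + M\<close>.\<close>
  define N where "N x = (1 / h) *\<^sub>R S t x + M x" for x
  have St: "spd_map (S t)" by (rule S_spd_map) fact
  have "spd_map N" unfolding spd_map_def
  proof (intro conjI allI impI)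
    show "linear N" unfolding N_def[abs_def]
      by (intro linear_compose_add linear_compose_scale_right spd_map_linear St M)
    show "N x \<bullet> y = x \<bullet> N y" for x y
      by (simp add: N_def inner_add_left inner_add_right spd_map_sym[OF St] spd_map_sym[OF M])
    show "0 < x \<bullet> N x" if "x \<noteq> 0" for x
      using St M that assms(1) by (simp add: N_def inner_add_right spd_map_def add_pos_pos)
  qed
  then obtain x where x: "subgrad x ((1 / h) *\<^sub>R S t w + b - N x)" using resolvent_exists by blast
  have e: "((1 / h) *\<^sub>R S t w + b - N x) + M x - b = - ((1 / h) *\<^sub>R S t (x - w))"
    by (simp add: N_def linear_diff[OF spd_map_linear[OF St]] algebra_simps)
  have "is_step h t w x"
    using phi_strong[OF x] x unfolding is_step_def e by (simp add: subgrad_def)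
  then show ?thesis ..
qed

text \<open>The minimiser of \<open>\<phi>\<close> is a stationary solution, which provides a priori bounds.\<close>

lemma phi_minimiser: "\<exists>a\<in>D. \<forall>z\<in>D. \<phi> a + qM (z - a) / 2 \<le> \<phi> z"
proof -
  obtain a where a: "subgrad a (b - M a)" using resolvent_exists[OF M] by blast
  have "\<phi> a + qM (z - a) / 2 \<le> \<phi> z" if "z \<in> D" for z
    using phi_strong[OF a that] by simp
  then show ?thesis using a unfolding subgrad_def by blast
qed

definition minimiser :: 'a where "minimiser = (SOME a. a \<in> D \<and> (\<forall>z\<in>D. \<phi> a + qM (z - a) / 2 \<le> \<phi> z))"

lemma minimiser: "minimiser \<in> D" "z \<in> D \<Longrightarrow> \<phi> minimiser + qM (z - minimiser) / 2 \<le> \<phi> z"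
proof -
  have "\<exists>a. a \<in> D \<and> (\<forall>z\<in>D. \<phi> a + qM (z - a) / 2 \<le> \<phi> z)" using phi_minimiser by blast
  from someI_ex[OF this] show "minimiser \<in> D" "z \<in> D \<Longrightarrow> \<phi> minimiser + qM (z - minimiser) / 2 \<le> \<phi> z"
    unfolding minimiser_def by auto
qed

lemma phi_lower: "z \<in> D \<Longrightarrow> \<phi> minimiser \<le> \<phi> z"
  using minimiser(2)[of z] spd_map_nonneg[OF M, of "z - minimiser"] by simp

text \<open>Polarisation of \<open>S t (x - w) \<bullet> (x - z)\<close>, with
  \<open>Q t (x - w)\<close> dropped. Passing from the metric at \<open>t\<close> to the one at
  \<open>t + h\<close> costs \<open>h * qM (x - z)\<close>, of which strong convexity returns half;
  this leaves the last term with a plus sign.\<close>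

lemma step_evi:
  assumes "is_step h t w x" "0 < h" "0 \<le> t" "z \<in> D"
  shows "Q (t + h) (x - z) / 2 - Q t (w - z) / 2 \<le> h * (\<phi> z - \<phi> x + qM (x - z) / 2)"
proof -
  have "h * (\<phi> x - (S t (x - w) \<bullet> (z - x)) / h + qM (z - x) / 2) \<le> h * \<phi> z"
    using assms by (intro mult_left_mono) (auto simp: is_step_def)
  then have 1: "S t (x - w) \<bullet> (x - z) \<le> h * (\<phi> z - \<phi> x - qM (z - x) / 2)"
  proof -
    have *: "h * (p - u / h + v) = h * p - u + h * v" for p u v using assms(2)
        by (simp add: field_simps)
    have "S t (x - w) \<bullet> (x - z) = - (S t (x - w) \<bullet> (z - x))" by (simp add: inner_diff_right)
    with \<open>h * _ \<le> _\<close> show ?thesis unfolding * by (simp add: right_diff_distrib)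
  qed
  have 2: "qM (z - x) = qM (x - z)"
    using linear_diff[OF spd_map_linear[OF M]] by (simp add: inner_diff_left inner_diff_right)
  have "Q t (w - z) = Q t ((x - z) - (x - w))" by simp
  also have "\<dots> = Q t (x - z) - 2 * (S t (x - w) \<bullet> (x - z)) + Q t (x - w)"
    using Q_diff[OF assms(3), of "x - z" "x - w"] spd_map_sym[OF S_spd_map[OF assms(3)], of "x
        - z" "x - w"]
    by (simp add: inner_commute)
  finally have "Q t (x - z) / 2 - Q t (w - z) / 2 \<le> S t (x - w) \<bullet> (x - z)"
    using Q_nonneg[OF assms(3), of "x - w"] by linarith
  moreover define p where "p = qM (x - z)"
  ultimately show ?thesis
    using 1 unfolding Q_add 2 p_def[symmetric] by (simp add: right_diff_distrib distrib_left
        add_divide_distrib)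
qed

lemma step_energy:
  assumes "is_step h t w x" "0 < h" "0 \<le> t" "w \<in> D"
  shows "\<phi> x \<le> \<phi> w"
proof -
  have "\<phi> x - (S t (x - w) \<bullet> (w - x)) / h + qM (w - x) / 2 \<le> \<phi> w"
    using assms by (auto simp: is_step_def)
  moreover have "S t (x - w) \<bullet> (w - x) = - Q t (x - w)"
    unfolding Q_def by (simp add: inner_commute[of "S t (x - w)"] inner_diff_left)
  moreover have "0 \<le> Q t (x - w) / h" using Q_nonneg[OF assms(3)] assms(2) by simp
  moreover have "0 \<le> qM (w - x)" by (rule spd_map_nonneg[OF M])
  ultimately show ?thesis by simp
qed

text \<open>Each of two consecutive steps is tested with the end point of the other one.\<close>

lemma step_speed:
  assumes 1: "is_step h t w x" and 2: "is_step h (t + h) x x'" and "0 < h" "0 \<le> t"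
  shows "Q (t + h) (x' - x) \<le> Q t (x - w)"
proof -
  let ?v = "x - w" and ?v' = "x' - x"
  have a: "\<phi> x - (S t ?v \<bullet> ?v') / h + (?v' \<bullet> M ?v') / 2 \<le> \<phi> x'"
    using 1 2 by (auto simp: is_step_def)
  have b: "\<phi> x' - (S (t + h) ?v' \<bullet> (x - x')) / h + qM (x - x') / 2 \<le> \<phi> x"
    using 1 2 by (auto simp: is_step_def)
  have m: "qM (x - x') = ?v' \<bullet> M ?v'"
    using linear_diff[OF spd_map_linear[OF M]] by (simp add: inner_diff_left inner_diff_right)
  have q: "S (t + h) ?v' \<bullet> (x - x') = - Q (t + h) ?v'"
    unfolding Q_def by (simp add: inner_commute[of "S (t + h) (x' - x)"] inner_diff_left)
  have "Q (t + h) ?v' / h + ?v' \<bullet> M ?v' \<le> (S t ?v \<bullet> ?v') / h"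
    using a b unfolding m q by simp
  then have "h * (Q (t + h) ?v' / h + ?v' \<bullet> M ?v') \<le> h * ((S t ?v \<bullet> ?v') / h)"
    using assms(3) by (intro mult_left_mono) auto
  then have c: "Q (t + h) ?v' + h * (?v' \<bullet> M ?v') \<le> S t ?v \<bullet> ?v'" using assms(3)
      by (simp add: distrib_left)
  \<comment> \<open>Young's inequality in the metric at time \<open>t\<close>. Expressing
    \<open>Q t ?v'\<close> by \<open>Q (t + h) ?v'\<close> leaves a surplus of \<open>4 * h\<close>
    times \<open>?v' \<bullet> M ?v'\<close>, which is dropped.\<close>
  have "0 \<le> Q t (?v - ?v')" by (rule Q_nonneg) fact
  then have "2 * (S t ?v \<bullet> ?v') \<le> Q t ?v + Q t ?v'" unfolding Q_diff[OF assms(4)] by simp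
  moreover have "0 \<le> h * (?v' \<bullet> M ?v')" using assms(3) spd_map_nonneg[OF M]
      by (intro mult_nonneg_nonneg) auto
  ultimately show ?thesis using c Q_add[of t h ?v'] by simp
qed

end

context closed_convex_function
begin

text \<open>\<open>D\<close> may have empty interior, so an affine basis of its hull is taken inside
  \<open>D\<close>. The simplex it spans lies in \<open>D\<close>, and by convexity \<open>f\<close>
  is bounded there by its largest value at a vertex; the centre is a relative interior point of the
  simplex.\<close>

lemma relative_ball:
  obtains a r K where "0 < r" "a \<in> D" "\<And>z. z \<in> affine hull D \<Longrightarrow> dist a z \<le> r \<Longrightarrow> z \<in> D \<and> f z \<le> K"
proof -
  obtain B where B: "B \<subseteq> D" "\<not> affine_dependent B" "affine hull D = affine hull B"
    using affine_basis_exists[of D] by blast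
  have finB: "finite B" using B(2) by (rule aff_independent_finite)
  have "B \<noteq> {}" using B(3) D_ne by (metis affine_hull_eq_empty)
  define K where "K = Max (f ` B)"
  have "convex {x \<in> D. f x \<le> K}"
    unfolding convex_def
  proof (intro ballI allI impI)
    fix x y and u v :: real
    assume xy: "x \<in> {x \<in> D. f x \<le> K}" "y \<in> {x \<in> D. f x \<le> K}" and uv: "0 \<le> u" "0 \<le> v" "u + v = 1"
    have "f (u *\<^sub>R x + v *\<^sub>R y) \<le> u * f x + v * f y" "u *\<^sub>R x + v *\<^sub>R y \<in> D"
      using f_convex xy uv unfolding convex_on_def convex_def by auto
    moreover have "u * f x + v * f y \<le> u * K + v * K" using xy uv
        by (intro add_mono mult_left_mono) auto
    moreover have "u * K + v * K = K" using uv(3) by (metis distrib_right mult_1)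
    ultimately show "u *\<^sub>R x + v *\<^sub>R y \<in> {x \<in> D. f x \<le> K}" by simp
  qed
  moreover have "B \<subseteq> {x \<in> D. f x \<le> K}" using B(1) finB by (auto simp: K_def)
  ultimately have hull: "convex hull B \<subseteq> {x \<in> D. f x \<le> K}" by (rule hull_minimal[rotated])
  have "rel_interior (convex hull B) \<noteq> {}" using \<open>B \<noteq> {}\<close> by (simp add: rel_interior_eq_empty)
  then obtain a e where ae: "a \<in> convex hull B" "0 < e" "ball a e \<inter> affine hull (convex hull B)
      \<subseteq> convex hull B"
    unfolding mem_rel_interior_ball[of _ "convex hull B", symmetric] using mem_rel_interior_ball
        by blast
  show thesis
  proof (rule that[of "e / 2" a K])
    show "a \<in> D" using ae(1) hull by blast
    show "z \<in> D \<and> f z \<le> K" if "z \<in> affine hull D" "dist a z \<le> e / 2" for z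
    proof -
      have "z \<in> ball a e \<inter> affine hull (convex hull B)" using that ae(2) B(3) by simp
      then show ?thesis using ae(3) hull by blast
    qed
  qed (use ae(2) in simp)
qed

end

context moving_metric_flow
begin

lemma phi_relative_ball:
  obtains a r K where "0 < r" "a \<in> D" "\<And>z. z \<in> affine hull D \<Longrightarrow> dist a z \<le> r \<Longrightarrow> z \<in> D \<and> \<phi> z \<le> K"
proof -
  obtain a r K where a: "0 < r" "a \<in> D" "\<And>z. z \<in> affine hull D \<Longrightarrow> dist a z \<le> r \<Longrightarrow> z \<in> D \<and> f z \<le> K"
    by (rule relative_ball, rule that) blast+
  obtain M_norm where M_norm: "0 < M_norm" "\<And>x. x \<bullet> M x \<le> M_norm * (norm x)\<^sup>2"
      by (rule spd_map_bound[OF M], rule that) blast+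
  show thesis
  proof (rule that[of r a "K + M_norm * (norm a + r)\<^sup>2 / 2 + norm b * (norm a + r)"])
    fix z assume z: "z \<in> affine hull D" "dist a z \<le> r"
    have "z \<in> D" "f z \<le> K" using a(3)[OF z] by auto
    have nz: "norm z \<le> norm a + r" using z(2) norm_triangle_ineq2[of z a]
        by (simp add: dist_norm norm_minus_commute)
    have "z \<bullet> M z \<le> M_norm * (norm a + r)\<^sup>2"
      using M_norm(2)[of z] power_mono[OF nz, of 2] M_norm(1)
          by (smt (verit) mult_left_mono norm_ge_zero)
    moreover have "- (b \<bullet> z) \<le> norm b * (norm a + r)"
    proof -
      have "- (b \<bullet> z) \<le> norm b * norm z" using Cauchy_Schwarz_ineq2[of b z] by linarith
      also have "\<dots> \<le> norm b * (norm a + r)" using nz by (intro mult_left_mono) auto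
      finally show ?thesis .
    qed
    ultimately show "z \<in> D \<and> \<phi> z \<le> K + M_norm * (norm a + r)\<^sup>2 / 2 + norm b * (norm a + r)"
      using \<open>z \<in> D\<close> \<open>f z \<le> K\<close> by (simp add: \<phi>_def)
  qed (use a in auto)
qed

text \<open>The step is tested with a point of a relative ball on which \<open>\<phi>\<close> is bounded, shifted from the
  centre against the direction of the step. The bound telescopes, so the total length stays finite
  even if the initial value only lies in the closure of the domain.\<close>

lemma step_length:
  assumes step: "is_step h t w x" "0 < h" "0 \<le> t" and w: "w \<in> affine hull D"
    and a: "0 < r" "a \<in> D" "\<And>z. z \<in> affine hull D \<Longrightarrow> dist a z \<le> r \<Longrightarrow> z \<in> D \<and> \<phi> z \<le> K"
  shows "P_coercivity * r * norm (x - w) \<le> h * (K - \<phi> minimiser + qM (x - a)) + (Q t (w - a) / 2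
      - Q (t + h) (x - a) / 2)"
proof -
  have x: "x \<in> D" using step(1) by (simp add: is_step_def)
  define n where "n = norm (x - w)"
  \<comment> \<open>For \<open>x = w\<close> the quotient is \<open>r / 0 = 0\<close>, and
    \<open>z\<close> is the centre itself.\<close>
  define z where "z = a + (r / n) *\<^sub>R (w - x)"
  have "z \<in> affine hull D" unfolding z_def
    using a(2) x w by (intro mem_affine_3_minus affine_affine_hull) (auto intro: hull_inc)
  moreover have "dist a z \<le> r"
    using a(1) by (simp add: z_def dist_norm n_def norm_minus_commute)
  ultimately have z: "z \<in> D" "\<phi> z \<le> K" using a(3) by auto
  have "\<phi> x - (S t (x - w) \<bullet> (z - x)) / h + qM (z - x) / 2 \<le> \<phi> z"
    using step z by (auto simp: is_step_def)
  then have "\<phi> minimiser - (S t (x - w) \<bullet> (z - x)) / h \<le> K"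
    using z(2) phi_lower[OF x] spd_map_nonneg[OF M, of "z - x"] by simp
  then have "h * (\<phi> minimiser - (S t (x - w) \<bullet> (z - x)) / h) \<le> h * K" using step(2)
      by (intro mult_left_mono) auto
  moreover have "h * (p - u / h) = h * p - u" for p u using step(2) by (simp add: field_simps)
  ultimately have 1: "- (S t (x - w) \<bullet> (z - x)) \<le> h * (K - \<phi> minimiser)"
      by (simp only: right_diff_distrib)
  have "S t (x - w) \<bullet> (z - x) = S t (x - w) \<bullet> (a - x) - (r / n) * Q t (x - w)"
    by (simp add: z_def Q_def inner_diff_right inner_add_right inner_diff_left algebra_simps
        inner_commute[of "S t (x - w)"])
  moreover have "P_coercivity * r * n \<le> (r / n) * Q t (x - w)"
  proof (cases "n = 0")
    case False
    have "(r / n) * (P_coercivity * n\<^sup>2) \<le> (r / n) * Q t (x - w)"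
      using P_coercivity_Q[OF step(3), of "x - w"] a(1) by (intro mult_left_mono) (auto simp: n_def)
    then show ?thesis using False by (simp add: power2_eq_square mult_ac)
  qed simp
  moreover have "S t (x - w) \<bullet> (a - x) \<le> Q t (w - a) / 2 - Q t (x - a) / 2"
  proof -
    have "Q t (w - a) = Q t ((x - a) - (x - w))" by simp
    also have "\<dots> = Q t (x - a) - 2 * (S t (x - w) \<bullet> (x - a)) + Q t (x - w)"
      using Q_diff[OF step(3), of "x - a" "x - w"] spd_map_sym[OF S_spd_map[OF step(3)], of "x
          - a" "x - w"]
      by (simp add: inner_commute)
    finally have "S t (x - w) \<bullet> (x - a) \<ge> Q t (x - a) / 2 - Q t (w - a) / 2"
      using Q_nonneg[OF step(3), of "x - w"] by linarith
    moreover have "S t (x - w) \<bullet> (a - x) = - (S t (x - w) \<bullet> (x - a))"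
        by (simp add: inner_diff_right)
    ultimately show ?thesis by linarith
  qed
  ultimately have "P_coercivity * r * n \<le> h * (K - \<phi> minimiser) + (Q t (w - a) / 2 - Q t (x
      - a) / 2)" using 1 by linarith
  moreover define p where "p = qM (x - a)"
  ultimately show ?thesis unfolding n_def Q_add p_def[symmetric]
      by (simp add: distrib_left add_divide_distrib)
qed

section \<open>The iterated scheme and its bounds, uniform in the step size\<close>

primrec euler :: "real \<Rightarrow> 'a \<Rightarrow> nat \<Rightarrow> 'a" where
  "euler h x0 0 = x0"
| "euler h x0 (Suc k) = (SOME x. is_step h (real k * h) (euler h x0 k) x)"

abbreviation move :: "real \<Rightarrow> 'a \<Rightarrow> nat \<Rightarrow> real" where
  "move h x0 k \<equiv> norm (euler h x0 (Suc k) - euler h x0 k)"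

abbreviation half_dist :: "real \<Rightarrow> 'a \<Rightarrow> 'a \<Rightarrow> nat \<Rightarrow> real" where
  "half_dist h x0 z k \<equiv> Q (real k * h) (euler h x0 k - z) / 2"

text \<open>The metric is frozen at the beginning \<open>k * h\<close> of the step, while
  \<open>\<phi>\<close> is taken implicitly.\<close>

lemma euler_step: "0 < h \<Longrightarrow> is_step h (real k * h) (euler h x0 k) (euler h x0 (Suc k))"
  using someI_ex[OF step_exists[of h "real k * h" "euler h x0 k"]] by simp

lemma euler_in_D: "0 < h \<Longrightarrow> euler h x0 (Suc k) \<in> D"
  using euler_step unfolding is_step_def by blast

text \<open>The length estimate moves within the affine hull in the direction of a step; the initial
  value belongs to that hull because affine hulls are closed.\<close>

lemma euler_in_hull:
  assumes "0 < h" "x0 \<in> closure D"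
  shows "euler h x0 k \<in> affine hull D"
proof (cases k)
  case 0
  have "closure D \<subseteq> affine hull D" by (intro closure_minimal hull_subset closed_affine_hull)
  then show ?thesis using assms(2) 0 by auto
next
  case (Suc j)
  then show ?thesis using euler_in_D[OF assms(1), of x0 j] by (simp add: hull_inc del: euler.simps)
qed

lemma euler_evi_step:
  assumes "0 < h" "z \<in> D"
  shows "half_dist h x0 z (Suc k) - half_dist h x0 z k
    \<le> h * (\<phi> z - \<phi> (euler h x0 (Suc k)) + qM (euler h x0 (Suc k) - z) / 2)"
  using step_evi[OF euler_step[OF assms(1), of k x0] assms(1) _ assms(2)] assms(1)
  by (simp add: algebra_simps del: euler.simps)

text \<open>Tested with the minimiser, the variational inequality has a nonpositive right-hand side:
  strong convexity at the minimiser absorbs the term left by the growth of the metric.\<close>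

lemma euler_bound:
  assumes "0 < h"
  shows "Q (real k * h) (euler h x0 k - minimiser) \<le> Q 0 (x0 - minimiser)"
proof (induction k)
  case (Suc k)
  have "\<phi> minimiser - \<phi> (euler h x0 (Suc k)) + qM (euler h x0 (Suc k) - minimiser) / 2 \<le> 0"
    using minimiser(2)[OF euler_in_D[OF assms, of x0 k]] by (simp del: euler.simps)
  then have "h * (\<phi> minimiser - \<phi> (euler h x0 (Suc k)) + qM (euler h x0 (Suc k) - minimiser) / 2)
      \<le> 0"
    using assms by (intro mult_nonneg_nonpos) auto
  then show ?case using euler_evi_step[OF assms minimiser(1), of k x0] Suc.IH by linarith
qed simp

text \<open>Radius of a ball around the minimiser that contains all iterates for every step
  size.\<close>

definition rad :: "'a \<Rightarrow> real" where "rad x0 = sqrt (Q 0 (x0 - minimiser) / P_coercivity)"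

lemma euler_norm_bound:
  assumes "0 < h"
  shows "norm (euler h x0 k - minimiser) \<le> rad x0"
proof -
  have "P_coercivity * (norm (euler h x0 k - minimiser))\<^sup>2 \<le> Q 0 (x0 - minimiser)"
    using P_coercivity_Q[of "real k * h" "euler h x0 k
        - minimiser"] euler_bound[OF assms, of k x0] assms by simp
  then show ?thesis unfolding rad_def using P_coercivity_pos
      by (intro real_le_rsqrt) (simp add: field_simps)
qed

lemma euler_norm_bound':
  assumes "0 < h"
  shows "norm (euler h x0 k - z) \<le> rad x0 + norm (minimiser - z)"
  using euler_norm_bound[OF assms, of x0 k] norm_triangle_ineq[of "euler h x0 k
      - minimiser" "minimiser - z"] by simp

definition M_norm :: real where "M_norm = (SOME B. 0 < B \<and> (\<forall>x. norm (M x) \<le> B * norm x))"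

lemma M_norm: "0 < M_norm" "norm (M x) \<le> M_norm * norm x"
proof -
  have "\<exists>B. 0 < B \<and> (\<forall>x. norm (M x) \<le> B * norm x)" using linear_bounded_pos[OF spd_map_linear[OF M]]
      by blast
  from someI_ex[OF this] show "0 < M_norm" "norm (M x) \<le> M_norm * norm x" unfolding M_norm_def
      by auto
qed

lemma M_norm_inner: "x \<bullet> M y \<le> M_norm * (norm x * norm y)"
proof -
  have "x \<bullet> M y \<le> norm x * norm (M y)" by (rule norm_cauchy_schwarz)
  also have "\<dots> \<le> norm x * (M_norm * norm y)" by (intro mult_left_mono M_norm) auto
  finally show ?thesis by (simp add: mult_ac)
qed

lemma euler_M_bound:
  assumes "0 < h"
  shows "qM (euler h x0 k - z) \<le> M_norm * (rad x0 + norm (minimiser - z))\<^sup>2"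
proof -
  have "qM (euler h x0 k - z) \<le> M_norm * (norm (euler h x0 k - z))\<^sup>2"
    using M_norm_inner[of "euler h x0 k - z" "euler h x0 k - z"] by (simp add: power2_eq_square)
  also have "\<dots> \<le> M_norm * (rad x0 + norm (minimiser - z))\<^sup>2"
    using euler_norm_bound'[OF assms, of x0 k z] M_norm(1) by (intro mult_left_mono power_mono) auto
  finally show ?thesis .
qed

text \<open>Unlike the estimates on later intervals, this one starts at the initial value itself,
  with a constant that depends on \<open>z\<close> but not on \<open>h\<close>. It yields continuity
  of the limit at \<open>0\<close>.\<close>

lemma euler_evi_initial:
  assumes "0 < h" "z \<in> D"
  shows "half_dist h x0 z k \<le> Q 0 (x0 - z) / 2 + real k * h * (\<phi> z - \<phi> minimiser + M_norm * (rad x0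
      + norm (minimiser - z))\<^sup>2 / 2)"
proof (induction k)
  case (Suc k)
  let ?K = "\<phi> z - \<phi> minimiser + M_norm * (rad x0 + norm (minimiser - z))\<^sup>2 / 2"
  have "\<phi> z - \<phi> (euler h x0 (Suc k)) + qM (euler h x0 (Suc k) - z) / 2 \<le> ?K"
    using phi_lower[OF euler_in_D[OF assms(1), of x0 k]] euler_M_bound[OF assms(1), of x0 "Suc k" z]
        by simp
  then have "h * (\<phi> z - \<phi> (euler h x0 (Suc k)) + qM (euler h x0 (Suc k) - z) / 2) \<le> h * ?K"
    using assms(1) by (intro mult_left_mono) auto
  moreover have "real (Suc k) * h * ?K = real k * h * ?K + h * ?K" by (simp add: algebra_simps)
  ultimately show ?case using euler_evi_step[OF assms, of k x0] Suc.IH by linarith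
qed simp

text \<open>The one-step bounds telescope. Since the right-hand side is the increment of a function
  of time, it later provides the monotone function that controls the limit curve near
  \<open>0\<close>.\<close>

lemma euler_length:
  assumes h: "0 < h" and x0: "x0 \<in> closure D"
    and a: "0 < r" "a \<in> D" "\<And>z. z \<in> affine hull D \<Longrightarrow> dist a z \<le> r \<Longrightarrow> z \<in> D \<and> \<phi> z \<le> K"
    and "k \<le> l"
  shows "P_coercivity * r * (\<Sum>i=k..<l. move h x0 i) \<le>
    real (l - k) * h * (K - \<phi> minimiser + M_norm * (rad x0 + norm (minimiser - a))\<^sup>2)
    + (half_dist h x0 a k - half_dist h x0 a l)"
proof -
  let ?K = "K - \<phi> minimiser + M_norm * (rad x0 + norm (minimiser - a))\<^sup>2"
  have "P_coercivity * r * move h x0 i \<le>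
      h * ?K + - (half_dist h x0 a (Suc i) - half_dist h x0 a i)" for i
  proof -
    have "h * (K - \<phi> minimiser + qM (euler h x0 (Suc i) - a)) \<le> h * ?K"
      using euler_M_bound[OF h, of x0 "Suc i" a] h by (intro mult_left_mono) auto
    moreover have e: "real (Suc i) * h = real i * h + h" by (simp add: algebra_simps)
    moreover have "0 \<le> real i * h" using h by simp
    note step_length[OF euler_step[OF h] h this euler_in_hull[OF h x0] a, folded e]
    ultimately show ?thesis by linarith
  qed
  then have "(\<Sum>i=k..<l. P_coercivity * r * move h x0 i) \<le>
      (\<Sum>i=k..<l. h * ?K + - (half_dist h x0 a (Suc i) - half_dist h x0 a i))"
    by (intro sum_mono)
  also have "\<dots> = real (l - k) * h * ?K - (\<Sum>i=k..<l. half_dist h x0 a (Suc i) - half_dist h x0 a i)"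
    by (simp only: sum.distrib sum_negf) simp
  also have "(\<Sum>i=k..<l. half_dist h x0 a (Suc i) - half_dist h x0 a i)
      = half_dist h x0 a l - half_dist h x0 a k"
    by (rule sum_Suc_diff'[OF \<open>k \<le> l\<close>])
  finally show ?thesis by (simp add: sum_distrib_left)
qed

lemma euler_dist_le_length:
  assumes "k \<le> l"
  shows "norm (euler h x0 l - euler h x0 k) \<le> (\<Sum>i=k..<l. move h x0 i)"
proof -
  have "euler h x0 l - euler h x0 k = (\<Sum>i=k..<l. euler h x0 (Suc i) - euler h x0 i)"
    by (rule sum_Suc_diff'[OF assms, symmetric])
  then show ?thesis by (simp only: norm_sum)
qed

lemma euler_speed:
  assumes h: "0 < h" and "i \<le> k"
  shows "Q (real k * h) (euler h x0 (Suc k) - euler h x0 k) \<le> Q (real i * h) (euler h x0 (Suc i)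
      - euler h x0 i)"
  using assms(2)
proof (induction k rule: dec_induct)
  case (step k)
  have e: "real (Suc k) * h = real k * h + h" by (simp add: algebra_simps)
  show ?case
    using step_speed[OF euler_step[OF h, of k x0] euler_step[OF h, of "Suc k" x0, unfolded e] h]
        step.IH h
    unfolding e by (simp del: euler.simps)
qed simp

text \<open>Each step is tested with its own starting point. The first step is excluded because the
  initial value may lie outside \<open>D\<close>.\<close>

lemma euler_energy: "0 < h \<Longrightarrow> 1 \<le> k \<Longrightarrow> k \<le> l \<Longrightarrow> \<phi> (euler h x0 l) \<le> \<phi> (euler h x0 k)"
proof (rotate_tac 2, induction l rule: dec_induct)
  case (step l)
  obtain j where "l = Suc j" using step by (cases l) auto
  then have "\<phi> (euler h x0 (Suc l)) \<le> \<phi> (euler h x0 l)"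
    using step_energy[OF euler_step[OF step(4), of l x0] step(4)] euler_in_D[OF step(4), of x0 j]
        step(4) by (simp del: euler.simps)
  then show ?case using step by simp
qed simp

text \<open>Speeds decrease in the moving metric, so up to a constant every earlier move is at least
  as long as the last one; \<open>Suc k\<close> times the last move is therefore bounded by the
  total length. This is a decay of the speed like \<open>1 / t\<close> even if the initial energy is
  infinite.\<close>

lemma euler_speed_bound:
  assumes x0: "x0 \<in> closure D" and T: "0 < T"
  obtains L where "0 < L" "\<And>h k. 0 < h \<Longrightarrow> real (Suc k) * h \<le> T \<Longrightarrow> real (Suc k) * move h x0 k \<le> L"
proof -
  obtain a r K where a: "0 < r" "a \<in> D" "\<And>z. z \<in> affine hull D \<Longrightarrow> dist a z \<le> r \<Longrightarrow> z \<in> D \<and> \<phi> z \<le> K"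
    by (rule phi_relative_ball, rule that) blast+
  obtain BP where BP: "0 < BP" "\<And>x. x \<bullet> P x \<le> BP * (norm x)\<^sup>2"
      by (rule spd_map_bound[OF P], rule that) blast+
  define B where "B = BP + 2 * T * M_norm"
  have "B > 0" using BP(1) M_norm(1) T by (simp add: B_def add_pos_pos)
  define K' where "K' = \<bar>K - \<phi> minimiser + M_norm * (rad x0 + norm (minimiser - a))\<^sup>2\<bar>"
  define len where "len = (T * K' + Q 0 (x0 - a) / 2) / (P_coercivity * r)"
  have QB: "Q t x \<le> B * (norm x)\<^sup>2" if "0 \<le> t" "t \<le> T" for t x
  proof -
    have "Q t x = x \<bullet> P x + 2 * t * (x \<bullet> M x)" by (simp add: Q_def S_def inner_add_right)
    also have "\<dots> \<le> BP * (norm x)\<^sup>2 + 2 * T * (M_norm * (norm x)\<^sup>2)"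
      using BP(2)[of x] M_norm_inner[of x x] spd_map_nonneg[OF M, of x] that
      by (intro add_mono mult_mono) (auto simp: power2_eq_square)
    finally show ?thesis by (simp add: B_def algebra_simps)
  qed
  have main: "real (Suc k) * move h x0 k \<le> sqrt (B / P_coercivity) * len" if h: "0 < h"
      and kT: "real (Suc k) * h \<le> T" for h k
  proof -
    let ?n = "\<lambda>i. move h x0 i"
    have "P_coercivity * r * (\<Sum>i=0..<Suc k. ?n i) \<le> T * K' + Q 0 (x0 - a) / 2"
    proof -
      have "P_coercivity * r * (\<Sum>i=0..<Suc k. ?n i) \<le> real (Suc k) * h * (K - \<phi> minimiser
          + M_norm * (rad x0 + norm (minimiser - a))\<^sup>2)
        + (Q 0 (x0 - a) / 2 - half_dist h x0 a (Suc k))"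
        using euler_length[OF h x0 a, of 0 "Suc k"] by (simp del: euler.simps(2))
      moreover have "real (Suc k) * h * (K - \<phi> minimiser + M_norm * (rad x0 + norm (minimiser
          - a))\<^sup>2) \<le> T * K'"
      proof -
        have "real (Suc k) * h * (K - \<phi> minimiser + M_norm * (rad x0 + norm (minimiser - a))\<^sup>2)
            \<le> real (Suc k) * h * K'"
          using h by (intro mult_left_mono) (auto simp: K'_def)
        also have "\<dots> \<le> T * K'" using kT by (intro mult_right_mono) (auto simp: K'_def)
        finally show ?thesis .
      qed
      moreover have "0 \<le> Q (real (Suc k) * h) (euler h x0 (Suc k) - a)" using h
          by (intro Q_nonneg) auto
      ultimately show ?thesis by linarith
    qed
    then have len: "(\<Sum>i=0..<Suc k. ?n i) \<le> len" using P_coercivity_pos a(1)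
        by (simp add: len_def field_simps)
    \<comment> \<open>The factor \<open>sqrt (B / P_coercivity)\<close> compares the norm with the
      metrics at the times of the two moves.\<close>
    have each: "?n k \<le> sqrt (B / P_coercivity) * ?n i" if "i < Suc k" for i
    proof -
      have ik: "i \<le> k" "real i * h \<le> real (Suc k) * h" using that h by (auto intro: mult_right_mono)
      have "P_coercivity * (?n k)\<^sup>2 \<le> Q (real k * h) (euler h x0 (Suc k) - euler h x0 k)" using h
          by (intro P_coercivity_Q) auto
      also have "\<dots> \<le> Q (real i * h) (euler h x0 (Suc i) - euler h x0 i)"
          by (rule euler_speed[OF h ik(1)])
      also have "\<dots> \<le> B * (?n i)\<^sup>2"
      proof (rule QB)
        show "0 \<le> real i * h" using h by simp
        show "real i * h \<le> T" using ik(2) kT by linarith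
      qed
      finally have "(?n k)\<^sup>2 \<le> B / P_coercivity * (?n i)\<^sup>2" using P_coercivity_pos
          by (simp add: field_simps)
      then have "?n k \<le> sqrt (B / P_coercivity * (?n i)\<^sup>2)" by (rule real_le_rsqrt)
      also have "\<dots> = sqrt (B / P_coercivity) * ?n i"
          by (simp only: real_sqrt_mult real_sqrt_abs abs_norm_cancel)
      finally show ?thesis .
    qed
    have "real (Suc k) * ?n k = (\<Sum>i=0..<Suc k. ?n k)" by simp
    also have "\<dots> \<le> (\<Sum>i=0..<Suc k. sqrt (B / P_coercivity) * ?n i)" using each
        by (intro sum_mono) (auto simp del: euler.simps)
    also have "\<dots> = sqrt (B / P_coercivity) * (\<Sum>i=0..<Suc k. ?n i)" by (simp only: sum_distrib_left)
    also have "\<dots> \<le> sqrt (B / P_coercivity) * len" using len \<open>B > 0\<close> P_coercivity_pos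
        by (intro mult_left_mono) auto
    finally show ?thesis .
  qed
  show thesis
  proof (rule that[of "\<bar>sqrt (B / P_coercivity) * len\<bar> + 1"])
    show "0 < \<bar>sqrt (B / P_coercivity) * len\<bar> + 1" by simp
    show "real (Suc k) * move h x0 k \<le> \<bar>sqrt (B / P_coercivity) * len\<bar> + 1"
      if "0 < h" "real (Suc k) * h \<le> T" for h k using main[OF that] by linarith
  qed
qed

text \<open>The threshold involves \<open>Suc k\<close> because a time rounded down to the grid
  index \<open>k\<close> is only known to be below \<open>Suc k\<close> times the step size.\<close>

lemma euler_lipschitz:
  assumes x0: "x0 \<in> closure D" and T: "0 < T"
  obtains L where "0 < L" "\<And>h k l \<tau>. 0 < h \<Longrightarrow> k \<le> l \<Longrightarrow> 0 < \<tau> \<Longrightarrow> \<tau> \<le> real (Suc k) * h \<Longrightarrow> real l * h \<le> T \<Longrightarrow>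
     norm (euler h x0 l - euler h x0 k) \<le> L / \<tau> * (real (l - k) * h)"
proof -
  obtain L where L: "0 < L" "\<And>h k. 0 < h \<Longrightarrow> real (Suc k) * h \<le> T \<Longrightarrow> real (Suc k) * move h x0 k \<le> L"
    by (rule euler_speed_bound[OF assms], rule that) blast+
  show thesis
  proof (rule that[OF L(1)])
    fix h \<tau> :: real and k l :: nat
    assume A: "0 < h" "k \<le> l" "0 < \<tau>" "\<tau> \<le> real (Suc k) * h" "real l * h \<le> T"
    have each: "move h x0 i \<le> L / \<tau> * h" if "i \<in> {k..<l}" for i
    proof -
      have i: "real (Suc i) * h \<le> real l * h" "real (Suc k) * h \<le> real (Suc i) * h"
        using that A(1) by (auto intro!: mult_right_mono)
      then have "real (Suc i) * move h x0 i \<le> L" using A by (intro L(2)) linarith+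
      then have "h * (real (Suc i) * move h x0 i) \<le> h * L" using A(1) by (intro mult_left_mono) auto
      moreover have "\<tau> * move h x0 i \<le> (real (Suc i) * h) * move h x0 i"
        using A(4) i(2) by (intro mult_right_mono) auto
      moreover have "h * (real (Suc i) * move h x0 i) = (real (Suc i) * h) * move h x0 i"
        by (simp only: mult_ac)
      ultimately have "\<tau> * move h x0 i \<le> h * L" by linarith
      then show ?thesis using A(3) by (simp add: field_simps del: euler.simps)
    qed
    have "norm (euler h x0 l - euler h x0 k) \<le> (\<Sum>i=k..<l. move h x0 i)"
      by (rule euler_dist_le_length[OF A(2)])
    also have "\<dots> \<le> (\<Sum>i=k..<l. L / \<tau> * h)" by (rule sum_mono) (rule each)
    also have "\<dots> = L / \<tau> * (real (l - k) * h)" by simp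
    finally show "norm (euler h x0 l - euler h x0 k) \<le> L / \<tau> * (real (l - k) * h)" .
  qed
qed

text \<open>The one-step inequalities are summed. Energy decay lets \<open>\<phi>\<close> be
  evaluated at the last iterate, and the Lipschitz bound moves the quadratic terms there, at the
  price of the second-order remainder with \<open>C\<close>.\<close>

lemma euler_evi:
  assumes x0: "x0 \<in> closure D" and T: "0 < T" and \<tau>: "0 < \<tau>" and z: "z \<in> D"
  obtains C where "\<And>h k l. 0 < h \<Longrightarrow> k \<le> l \<Longrightarrow> 1 \<le> l \<Longrightarrow> \<tau> \<le> real (Suc k) * h \<Longrightarrow> real l * h \<le> T \<Longrightarrow>
    half_dist h x0 z l - half_dist h x0 z k \<le>
    real (l - k) * h * (\<phi> z - \<phi> (euler h x0 l) + qM (euler h x0 l - z) / 2 + C * (real (l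
        - k) * h))"
proof -
  obtain L where L: "0 < L" "\<And>h k l \<tau>. 0 < h \<Longrightarrow> k \<le> l \<Longrightarrow> 0 < \<tau> \<Longrightarrow> \<tau> \<le> real (Suc k) * h \<Longrightarrow> real l * h
      \<le> T \<Longrightarrow>
     norm (euler h x0 l - euler h x0 k) \<le> L / \<tau> * (real (l - k) * h)"
    by (rule euler_lipschitz[OF x0 T], rule that) blast+
  define B where "B = rad x0 + norm (minimiser - z)"
  define C where "C = M_norm * B * (L / \<tau>)"
  show thesis
  proof (rule that[of C])
    fix h :: real and k l :: nat
    assume A: "0 < h" "k \<le> l" "1 \<le> l" "\<tau> \<le> real (Suc k) * h" "real l * h \<le> T"
    let ?u = "\<lambda>i. euler h x0 i - z"
    let ?G = "\<phi> z - \<phi> (euler h x0 l) + (?u l \<bullet> M (?u l)) / 2 + C * (real (l - k) * h)"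
    have each: "Q (real (Suc i) * h) (?u (Suc i)) / 2 - Q (real i * h) (?u i) / 2 \<le> h * ?G"
        if i: "i \<in> {k..<l}" for i
    proof -
      have B: "norm (?u j) \<le> B" for j unfolding B_def by (rule euler_norm_bound'[OF A(1)])
      have "norm (euler h x0 l - euler h x0 (Suc i)) \<le> L / \<tau> * (real (l - Suc i) * h)"
      proof (rule L(2))
        have "real (Suc k) * h \<le> real (Suc (Suc i)) * h" using i A(1)
            by (intro mult_right_mono) auto
        then show "\<tau> \<le> real (Suc (Suc i)) * h" using A(4) by linarith
      qed (use A \<tau> i in auto)
      also have "\<dots> \<le> L / \<tau> * (real (l - k) * h)"
        using i A(1) L(1) \<tau> by (intro mult_left_mono mult_right_mono) auto
      finally have d: "norm (?u (Suc i) - ?u l) \<le> L / \<tau> * (real (l - k) * h)"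
          by (simp add: norm_minus_commute del: euler.simps)
      have "?u (Suc i) \<bullet> M (?u (Suc i)) - ?u l \<bullet> M (?u l) = (?u (Suc i) - ?u l) \<bullet> M (?u (Suc i)
          + ?u l)"
      proof -
        have e: "(p - q) \<bullet> M (p + q) = p \<bullet> M p - q \<bullet> M q" for p q
          using spd_map_sym[OF M, of q p]
          by (simp add: linear_add[OF spd_map_linear[OF M]] inner_diff_left inner_add_right
              inner_commute[of "M q" p])
        show ?thesis by (rule e[symmetric])
      qed
      also have "\<dots> \<le> M_norm * (norm (?u (Suc i) - ?u l) * norm (?u (Suc i) + ?u l))"
          by (rule M_norm_inner)
      also have "\<dots> \<le> M_norm * ((L / \<tau> * (real (l - k) * h)) * (B + B))"
        using d norm_triangle_mono[OF B[of "Suc i"] B[of l]] M_norm(1) L(1) \<tau> A(1)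
        by (intro mult_left_mono mult_mono) auto
      also have "\<dots> = 2 * (C * (real (l - k) * h))" by (simp add: C_def)
      finally have "\<phi> z - \<phi> (euler h x0 (Suc i)) + (?u (Suc i) \<bullet> M (?u (Suc i))) / 2 \<le> ?G"
        using euler_energy[OF A(1), of "Suc i" l x0] i by simp
      then have "h * (\<phi> z - \<phi> (euler h x0 (Suc i)) + (?u (Suc i) \<bullet> M (?u (Suc i))) / 2) \<le> h * ?G"
        using A(1) by (intro mult_left_mono) auto
      then show ?thesis using euler_evi_step[OF A(1) z, of i x0] by linarith
    qed
    have "Q (real l * h) (?u l) / 2 - Q (real k * h) (?u k) / 2
        = (\<Sum>i=k..<l. Q (real (Suc i) * h) (?u (Suc i)) / 2 - Q (real i * h) (?u i) / 2)"
      by (rule sum_Suc_diff'[OF A(2), symmetric])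
    also have "\<dots> \<le> (\<Sum>i=k..<l. h * ?G)" by (rule sum_mono) (rule each)
    also have "\<dots> = real (l - k) * h * ?G" by (simp only: sum_constant card_atLeastLessThan
        mult.assoc)
    finally show "Q (real l * h) (?u l) / 2 - Q (real k * h) (?u k) / 2 \<le> real (l - k) * h * ?G" .
  qed
qed

end

section \<open>The limit curve\<close>

text \<open>Convergence along one fixed filter, instead of a subsequence, gives the limit
  at every \<open>t\<close> at once by Tychonoff's theorem.\<close>

lemma pointwise_cluster_filter:
  fixes g :: "nat \<Rightarrow> 'b \<Rightarrow> 'a::topological_space"
  assumes K: "\<And>t. compact (K t)" and g: "\<And>n t. g n t \<in> K t"
  obtains m U where "U \<noteq> bot" "U \<le> sequentially" "\<And>t. ((\<lambda>n. g n t) \<longlongrightarrow> m t) U"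
proof -
  have "compactin (product_topology (\<lambda>_. euclidean) UNIV) (PiE UNIV K)"
    unfolding compactin_PiE using K by simp
  then have comp: "compact (PiE UNIV K)"
    unfolding euclidean_product_topology by simp
  define F where "F = filtermap g sequentially"
  have "F \<noteq> bot" by (simp add: F_def filtermap_bot_iff)
  moreover have "eventually (\<lambda>f. f \<in> PiE UNIV K) F"
    unfolding F_def eventually_filtermap using g by (auto simp: PiE_def)
  ultimately obtain m where m: "inf (nhds m) F \<noteq> bot"
    using comp[unfolded compact_filter] by blast
  \<comment> \<open>Generated by the sets of large indices \<open>n\<close> for which
    \<open>g n\<close> is close to the cluster point \<open>m\<close> in the product
    topology.\<close>
  define U where "U = inf (filtercomap g (nhds m)) sequentially"
  have "U \<noteq> bot"
  proof
    assume "U = bot"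
    then have "eventually (\<lambda>_. False) U" by simp
    then obtain A B where AB: "eventually A (filtercomap g (nhds m))" "eventually B sequentially"
        "\<And>n. A n \<Longrightarrow> B n \<Longrightarrow> False"
      unfolding U_def eventually_inf by blast
    obtain V where V: "eventually V (nhds m)" "\<And>n. V (g n) \<Longrightarrow> A n"
      using AB(1) unfolding eventually_filtercomap by blast
    have "eventually (\<lambda>f. \<exists>n. f = g n \<and> B n) F"
      unfolding F_def eventually_filtermap using AB(2) by (rule eventually_mono) blast
    then have "eventually (\<lambda>_. False) (inf (nhds m) F)"
      unfolding eventually_inf using V AB(3) by blast
    then show False using m by (simp add: trivial_limit_def)
  qed
  moreover have "U \<le> sequentially" by (simp add: U_def)
  moreover have "((\<lambda>n. g n t) \<longlongrightarrow> m t) U" for t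
  proof -
    have "filterlim g (nhds m) U"
      unfolding filterlim_iff_le_filtercomap by (simp add: U_def)
    then show ?thesis
      by (rule continuous_on_tendsto_compose[OF continuous_on_product_coordinates[of t]]) auto
  qed
  ultimately show thesis by (rule that)
qed

section \<open>Interpolation in time and passage to the limit\<close>

context moving_metric_flow
begin

lemma tendsto_linear: "linear N \<Longrightarrow> (g \<longlongrightarrow> l) F \<Longrightarrow> ((\<lambda>n. N (g n)) \<longlongrightarrow> N l) F" for N :: "'a \<Rightarrow> 'a"
  by (rule bounded_linear.tendsto[OF linear_conv_bounded_linear[THEN iffD1]])

lemma tendsto_Q:
  assumes "(s \<longlongrightarrow> t) F" "(g \<longlongrightarrow> l) F"
  shows "((\<lambda>n. Q (s n) (g n)) \<longlongrightarrow> Q t l) F"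
  unfolding Q_def S_def
  by (intro tendsto_intros tendsto_linear[OF spd_map_linear[OF P]] tendsto_linear[OF
      spd_map_linear[OF M]] assms)

definition mesh :: "nat \<Rightarrow> real" where "mesh n = 1 / real (Suc n)"
definition grid_index :: "nat \<Rightarrow> real \<Rightarrow> nat" where "grid_index n t = nat \<lfloor>t * real (Suc n)\<rfloor>"

lemma mesh_pos: "0 < mesh n" by (simp add: mesh_def)

lemma grid_index_le: "0 \<le> t \<Longrightarrow> real (grid_index n t) * mesh n \<le> t"
proof -
  assume "0 \<le> t"
  then have "real (grid_index n t) \<le> t * real (Suc n)" unfolding grid_index_def
      by (intro of_nat_floor) auto
  then show ?thesis by (simp add: mesh_def field_simps)
qed

lemma grid_index_gt: "t < real (Suc (grid_index n t)) * mesh n"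
proof -
  have "t * real (Suc n) < real (Suc (grid_index n t))" unfolding grid_index_def by linarith
  then show ?thesis by (simp add: mesh_def field_simps)
qed

lemma grid_index_mono: "s \<le> t \<Longrightarrow> grid_index n s \<le> grid_index n t"
  unfolding grid_index_def by (intro nat_mono floor_mono mult_right_mono) auto

lemma grid_index_tendsto:
  assumes "0 \<le> t"
  shows "(\<lambda>n. real (grid_index n t) * mesh n) \<longlonglongrightarrow> t"
proof (rule tendsto_sandwich)
  show "\<forall>\<^sub>F n in sequentially. t - mesh n \<le> real (grid_index n t) * mesh n"
    using grid_index_gt[of t] by (intro always_eventually allI) (simp add: algebra_simps
        less_imp_le)
  show "\<forall>\<^sub>F n in sequentially. real (grid_index n t) * mesh n \<le> t"
    using grid_index_le[OF assms] by (intro always_eventually allI)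
  have "mesh \<longlonglongrightarrow> 0" unfolding mesh_def using LIMSEQ_inverse_real_of_nat
      by (simp add: inverse_eq_divide)
  then have "(\<lambda>n. t - mesh n) \<longlonglongrightarrow> t - 0" by (intro tendsto_intros)
  then show "(\<lambda>n. t - mesh n) \<longlonglongrightarrow> t" by simp
qed simp

text \<open>Integrated form of the inclusion with a remainder of second order in
  \<open>t - s\<close>; dividing by \<open>t - s\<close> and letting \<open>s\<close> increase to
  \<open>t\<close> makes the remainder vanish.\<close>

abbreviation evi :: "(real \<Rightarrow> 'a) \<Rightarrow> 'a \<Rightarrow> real \<Rightarrow> real \<Rightarrow> real \<Rightarrow> bool" where
  "evi m z C s t \<equiv> m t \<in> D \<and> Q t (m t - z) / 2 - Q s (m s - z) / 2 \<le>
     (t - s) * (\<phi> z - \<phi> (m t) + qM (m t - z) / 2 + C * (t - s))"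

text \<open>Only closed inequalities are passed to the limit, one for each later use: continuity at
  \<open>0\<close>, absolute continuity at \<open>0\<close>, the Lipschitz bound away from
  \<open>0\<close>, and the inclusion.\<close>

lemma limit_curve:
  assumes x0: "x0 \<in> closure D"
  obtains m where "m 0 = x0"
    "\<And>z. z \<in> D \<Longrightarrow> \<exists>K. \<forall>t\<ge>0. Q t (m t - z) / 2 \<le> Q 0 (x0 - z) / 2 + t * K"
    "\<exists>c a K. 0 < c \<and> (\<forall>s t. 0 \<le> s \<longrightarrow> s \<le> t \<longrightarrow> c * norm (m t - m s) \<le> (t - s) * K + (Q s (m s - a) / 2
        - Q t (m t - a) / 2))"
    "\<And>T. 0 < T \<Longrightarrow> \<exists>L>0. \<forall>\<tau> s t. 0 < \<tau> \<longrightarrow> \<tau> \<le> s \<longrightarrow> s \<le> t \<longrightarrow> t \<le> T \<longrightarrow> norm (m t - m s) \<le> L / \<tau> * (t - s)"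
    "\<And>z \<tau> T. z \<in> D \<Longrightarrow> 0 < \<tau> \<Longrightarrow> 0 < T \<Longrightarrow> \<exists>C. \<forall>s t. \<tau> \<le> s \<longrightarrow> s < t \<longrightarrow> t \<le> T \<longrightarrow>
       evi m z C s t"
proof -
  let ?s = "\<lambda>n t. real (grid_index n t) * mesh n"
  let ?\<Delta> = "\<lambda>n s t. real (grid_index n t - grid_index n s) * mesh n"
  define g where "g n t = euler (mesh n) x0 (grid_index n t)" for n t
  have gb: "g n t \<in> cball minimiser (rad x0)" for n t
    using euler_norm_bound[OF mesh_pos] by (simp add: g_def dist_norm norm_minus_commute)
  obtain m U where U: "U \<noteq> bot" "U \<le> sequentially" and lim: "\<And>t. ((\<lambda>n. g n t) \<longlongrightarrow> m t) U"
    by (rule pointwise_cluster_filter[of "\<lambda>_. cball minimiser (rad x0)" g, OF compact_cball gb],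
        rule that) blast+
  have kU: "((\<lambda>n. ?s n t) \<longlongrightarrow> t) U" if "0 \<le> t" for t
    using grid_index_tendsto[OF that] U(2) by (rule tendsto_mono[rotated])
  have QU: "((\<lambda>n. Q (?s n t) (g n t - z)) \<longlongrightarrow> Q t (m t - z)) U" if "0 \<le> t" for t z
    by (intro tendsto_Q kU that tendsto_intros lim)
  have dk: "?\<Delta> n s t = ?s n t - ?s n s" if "s \<le> t" for n s t
    using grid_index_mono[OF that] by (simp add: of_nat_diff left_diff_distrib)
  have dkU: "((\<lambda>n. ?\<Delta> n s t) \<longlongrightarrow> t - s) U" if "0 \<le> s" "s \<le> t" for s t
    unfolding dk[OF that(2)] using that by (intro tendsto_intros kU) auto
  show thesis
  proof (rule that[of m])
    have "((\<lambda>n. g n 0) \<longlongrightarrow> x0) U" by (simp add: g_def grid_index_def)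
    then show "m 0 = x0" using lim[of 0] U(1) tendsto_unique by blast
  next
    fix z assume z: "z \<in> D"
    define K where "K = \<phi> z - \<phi> minimiser + M_norm * (rad x0 + norm (minimiser - z))\<^sup>2 / 2"
    have "Q t (m t - z) / 2 \<le> Q 0 (x0 - z) / 2 + t * K" if "0 \<le> t" for t
    proof (rule tendsto_le[OF U(1)])
      show "((\<lambda>n. Q (?s n t) (g n t - z) / 2) \<longlongrightarrow> Q t (m t - z) / 2) U"
        by (intro tendsto_intros QU that) auto
      show "((\<lambda>n. Q 0 (x0 - z) / 2 + ?s n t * K) \<longlongrightarrow> Q 0 (x0 - z) / 2 + t * K) U"
        by (intro tendsto_intros kU that)
      show "\<forall>\<^sub>F n in U. Q (?s n t) (g n t - z) / 2 \<le> Q 0 (x0 - z) / 2 + ?s n t * K"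
        unfolding g_def K_def by (intro always_eventually allI euler_evi_initial mesh_pos z)
    qed
    then show "\<exists>K. \<forall>t\<ge>0. Q t (m t - z) / 2 \<le> Q 0 (x0 - z) / 2 + t * K" by blast
  next
    obtain a r K where a: "0 < r" "a \<in> D" "\<And>z. z \<in> affine hull D \<Longrightarrow> dist a z \<le> r \<Longrightarrow> z \<in> D \<and> \<phi> z \<le> K"
      by (rule phi_relative_ball, rule that) blast+
    define K' where "K' = K - \<phi> minimiser + M_norm * (rad x0 + norm (minimiser - a))\<^sup>2"
    have "P_coercivity * r * norm (m t - m s) \<le> (t - s) * K' + (Q s (m s - a) / 2 - Q t (m t
        - a) / 2)" if st: "0 \<le> s" "s \<le> t" for s t
    proof (rule tendsto_le[OF U(1)])
      show "((\<lambda>n. ?\<Delta> n s t * K' + (Q (?s n s) (g n s - a) / 2 - Q (?s n t) (g n t - a) / 2))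
          \<longlongrightarrow> (t - s) * K' + (Q s (m s - a) / 2 - Q t (m t - a) / 2)) U"
        using st by (intro tendsto_intros QU dkU) auto
      show "((\<lambda>n. P_coercivity * r * norm (g n t - g n s)) \<longlongrightarrow> P_coercivity * r * norm (m t - m s)) U"
        by (intro tendsto_intros lim)
      show "\<forall>\<^sub>F n in U. P_coercivity * r * norm (g n t - g n s) \<le> ?\<Delta> n s t * K' + (Q (?s n s) (g n s
          - a) / 2 - Q (?s n t) (g n t - a) / 2)"
      proof (intro always_eventually allI)
        fix n
        have "P_coercivity * r * norm (g n t - g n s)
            \<le> P_coercivity * r * (\<Sum>i=grid_index n s..<grid_index n t. norm (euler (mesh n) x0 (Suc
            i) - euler (mesh n) x0 i))"
          unfolding g_def using P_coercivity_pos a(1)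
              by (intro mult_left_mono euler_dist_le_length grid_index_mono st) auto
        also have "\<dots> \<le> ?\<Delta> n s t * K' + (Q (?s n s) (g n s - a) / 2 - Q (?s n t) (g n t - a) / 2)"
          unfolding g_def K'_def by (rule euler_length[OF mesh_pos x0 a grid_index_mono[OF st(2)]])
        finally show "P_coercivity * r * norm (g n t - g n s) \<le> ?\<Delta> n s t * K' + (Q (?s n s) (g n s
            - a) / 2 - Q (?s n t) (g n t - a) / 2)" .
      qed
    qed
    moreover have "0 < P_coercivity * r" using P_coercivity_pos a(1) by simp
    ultimately show "\<exists>c a K. 0 < c \<and> (\<forall>s t. 0 \<le> s \<longrightarrow> s \<le> t \<longrightarrow> c * norm (m t - m s) \<le> (t - s) * K
        + (Q s (m s - a) / 2 - Q t (m t - a) / 2))"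
      by blast
  next
    fix T :: real assume T: "0 < T"
    obtain L where L: "0 < L" "\<And>h k l \<tau>. 0 < h \<Longrightarrow> k \<le> l \<Longrightarrow> 0 < \<tau> \<Longrightarrow> \<tau> \<le> real (Suc k) * h \<Longrightarrow> real l * h
        \<le> T \<Longrightarrow>
     norm (euler h x0 l - euler h x0 k) \<le> L / \<tau> * (real (l - k) * h)"
      by (rule euler_lipschitz[OF x0 T], rule that) blast+
    have "norm (m t - m s) \<le> L / \<tau> * (t - s)" if st: "0 < \<tau>" "\<tau> \<le> s" "s \<le> t" "t \<le> T" for \<tau> s t
    proof (rule tendsto_le[OF U(1)])
      show "((\<lambda>n. L / \<tau> * (?\<Delta> n s t)) \<longlongrightarrow> L / \<tau> * (t - s)) U"
        using st by (intro tendsto_intros dkU) auto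
      show "((\<lambda>n. norm (g n t - g n s)) \<longlongrightarrow> norm (m t - m s)) U" by (intro tendsto_intros lim)
      have "norm (g n t - g n s) \<le> L / \<tau> * (?\<Delta> n s t)" for n
        unfolding g_def
      proof (rule L(2)[OF mesh_pos grid_index_mono[OF st(3)] st(1)])
        show "\<tau> \<le> real (Suc (grid_index n s)) * mesh n" using grid_index_gt[of s n] st by linarith
        show "?s n t \<le> T" using grid_index_le[of t n] st by linarith
      qed
      then show "\<forall>\<^sub>F n in U. norm (g n t - g n s) \<le> L / \<tau> * (?\<Delta> n s t)" by simp
    qed
    with L(1) show "\<exists>L>0. \<forall>\<tau> s t. 0 < \<tau> \<longrightarrow> \<tau> \<le> s \<longrightarrow> s \<le> t \<longrightarrow> t \<le> T \<longrightarrow> norm (m t - m s) \<le> L / \<tau> * (t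
        - s)" by blast
  next
    fix z and \<tau> T :: real assume z: "z \<in> D" and \<tau>: "0 < \<tau>" and T: "0 < T"
    obtain C where C: "\<And>h k l. 0 < h \<Longrightarrow> k \<le> l \<Longrightarrow> 1 \<le> l \<Longrightarrow> \<tau> \<le> real (Suc k) * h \<Longrightarrow> real l * h \<le> T \<Longrightarrow>
    Q (real l * h) (euler h x0 l - z) / 2 - Q (real k * h) (euler h x0 k - z) / 2 \<le>
    real (l - k) * h * (\<phi> z - \<phi> (euler h x0 l) + qM (euler h x0 l - z) / 2 + C * (real (l
        - k) * h))"
      by (rule euler_evi[OF x0 T \<tau> z], rule that) blast+
    have "evi m z C s t"
      if st: "\<tau> \<le> s" "s < t" "t \<le> T" for s t
    proof -
      define q where "q x = (x \<bullet> M x) / 2 - b \<bullet> x" for x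
      \<comment> \<open>The discrete inequality solved for \<open>\<phi> (g n t)\<close>: its upper
        bound \<open>\<rho> n\<close> converges, while convergence of \<open>\<phi> (g n t)\<close>
        is not known. Points of the closed epigraph then converge to a point of the
        epigraph.\<close>
      define \<rho> where "\<rho> n = \<phi> z + qM (g n t - z) / 2 + C * ?\<Delta> n s t
        - (Q (?s n t) (g n t - z) / 2 - Q (?s n s) (g n s - z) / 2) / ?\<Delta> n s t" for n
      define \<rho>' where "\<rho>' = \<phi> z + qM (m t - z) / 2 + C * (t - s)
        - (Q t (m t - z) / 2 - Q s (m s - z) / 2) / (t - s)"
      have d: "((\<lambda>n. ?\<Delta> n s t) \<longlongrightarrow> t - s) U" using st \<tau> by (intro dkU) auto
      have \<rho>: "(\<rho> \<longlongrightarrow> \<rho>') U" unfolding \<rho>_def[abs_def] \<rho>'_def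
        using st \<tau> by (intro tendsto_intros d QU lim tendsto_linear[OF spd_map_linear[OF M]]) auto
      have q: "((\<lambda>n. q (g n t)) \<longlongrightarrow> q (m t)) U" unfolding q_def
        by (intro tendsto_intros lim tendsto_linear[OF spd_map_linear[OF M]]) auto
      have ev1: "\<forall>\<^sub>F n in U. 0 < ?\<Delta> n s t" using order_tendstoD(1)[OF d, of 0] st by simp
      \<comment> \<open>Makes the grid index positive: the iterates are known to lie in
        \<open>D\<close> only from the first step on.\<close>
      have ev2: "\<forall>\<^sub>F n in U. 0 < ?s n t" using order_tendstoD(1)[OF kU[of t], of 0] st \<tau> by simp
      have divide_le: "A / d \<le> B" if "A \<le> d * B" "0 < d" for A d B :: real
        using that by (simp add: pos_divide_le_eq mult.commute)
      from ev1 ev2 have "\<forall>\<^sub>F n in U. (g n t, \<rho> n - q (g n t)) \<in> {(x, a). x \<in> D \<and> f x \<le> a}"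
      proof eventually_elim
        case (elim n)
        then have l: "1 \<le> grid_index n t" by (cases "grid_index n t") auto
        then obtain j where j: "grid_index n t = Suc j" by (cases "grid_index n t") auto
        have "g n t \<in> D" unfolding g_def j by (rule euler_in_D[OF mesh_pos])
        have "Q (?s n t) (g n t - z) / 2 - Q (?s n s) (g n s - z) / 2 \<le>
          ?\<Delta> n s t * (\<phi> z - \<phi> (g n t) + qM (g n t - z) / 2 + C * ?\<Delta> n s t)"
          unfolding g_def
        proof (rule C[OF mesh_pos grid_index_mono l])
          show "\<tau> \<le> real (Suc (grid_index n s)) * mesh n" using grid_index_gt[of s n] st by linarith
          show "?s n t \<le> T" using grid_index_le[of t n] st \<tau> by linarith
        qed (use st in simp)
        then have "(Q (?s n t) (g n t - z) / 2 - Q (?s n s) (g n s - z) / 2) / ?\<Delta> n s t \<le>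
           \<phi> z - \<phi> (g n t) + qM (g n t - z) / 2 + C * ?\<Delta> n s t"
          by (rule divide_le[OF _ elim(1)])
        then have "\<phi> (g n t) \<le> \<rho> n" by (simp add: \<rho>_def)
        then show ?case using \<open>g n t \<in> D\<close> by (simp add: \<phi>_def q_def)
      qed
      then have "(m t, \<rho>' - q (m t)) \<in> {(x, a). x \<in> D \<and> f x \<le> a}"
        by (rule Lim_in_closed_set[OF epi_closed _ U(1)]) (intro tendsto_intros lim \<rho> q)
      then have mt: "m t \<in> D" "\<phi> (m t) \<le> \<rho>'" by (auto simp: \<phi>_def q_def)
      then have "(Q t (m t - z) / 2 - Q s (m s - z) / 2) / (t - s) \<le> \<phi> z - \<phi> (m t) + qM (m t
          - z) / 2 + C * (t - s)"
        by (simp add: \<rho>'_def)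
      then show ?thesis using mt(1) st(2) by (simp add: pos_divide_le_eq mult.commute)
    qed
    then show "\<exists>C. \<forall>s t. \<tau> \<le> s \<longrightarrow> s < t \<longrightarrow> t \<le> T \<longrightarrow>
       evi m z C s t"
      by blast
  qed
qed

end

section \<open>Existence and uniqueness of the flow\<close>

lemma abs_continuous_onI_Lipschitz:
  assumes f: "abs_continuous_on S f" and "0 \<le> K"
    and h: "\<And>a b. a \<in> S \<Longrightarrow> b \<in> S \<Longrightarrow> norm (h b - h a) \<le> K * (norm (f b - f a) + \<bar>b - a\<bar>)"
  shows "abs_continuous_on S h"
  by (rule abs_continuous_on_comb[OF f abs_continuous_on_ident \<open>0 \<le> K\<close>]) (use h in simp)

lemma abs_continuous_on_diff:
  assumes "abs_continuous_on S f" "abs_continuous_on S g"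
  shows "abs_continuous_on S (\<lambda>t. f t - g t)"
proof (rule abs_continuous_on_comb[OF assms, of 1])
  fix a b
  have "(f b - g b) - (f a - g a) = (f b - f a) - (g b - g a)" by simp
  then show "norm ((f b - g b) - (f a - g a)) \<le> 1 * (norm (f b - f a) + norm (g b - g a))"
    by (metis mult_1 norm_triangle_ineq4)
qed simp

lemma abs_continuous_on_add:
  assumes "abs_continuous_on S f" "abs_continuous_on S g"
  shows "abs_continuous_on S (\<lambda>t. f t + g t)"
proof (rule abs_continuous_on_comb[OF assms, of 1])
  fix a b
  have "(f b + g b) - (f a + g a) = (f b - f a) + (g b - g a)" by simp
  then show "norm ((f b + g b) - (f a + g a)) \<le> 1 * (norm (f b - f a) + norm (g b - g a))"
    by (metis mult_1 norm_triangle_ineq)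
qed simp

lemma abs_continuous_on_scaleR:
  assumes "abs_continuous_on S f"
  shows "abs_continuous_on S (\<lambda>t. c *\<^sub>R f t)"
  by (rule abs_continuous_on_comb[OF assms assms, of "\<bar>c\<bar>"]) (simp_all add:
      scaleR_diff_right[symmetric])

lemma abs_continuous_on_bounded:
  fixes f :: "real \<Rightarrow> 'a::real_normed_vector"
  assumes "abs_continuous_on {a..b} f"
  obtains B where "0 < B" "\<And>t. t \<in> {a..b} \<Longrightarrow> norm (f t) \<le> B"
proof -
  have "compact (f ` {a..b})"
    by (rule compact_continuous_image[OF abs_continuous_on_imp_continuous_on_Icc[OF assms]
        compact_Icc])
  then obtain B where "0 < B" "\<forall>x\<in>f ` {a..b}. norm x \<le> B" using compact_imp_bounded bounded_pos
      by blast
  then show thesis using that by blast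
qed

lemma exp_neg_Lipschitz:
  fixes x y :: real
  assumes "x \<le> 0" "y \<le> 0"
  shows "\<bar>exp x - exp y\<bar> \<le> \<bar>x - y\<bar>"
proof -
  have *: "exp v - exp u \<le> v - u" if "u \<le> v" "v \<le> 0" for u v :: real
  proof -
    have "exp v - exp u = exp v * (1 - exp (u - v))" by (simp add: algebra_simps exp_diff)
    also have "\<dots> \<le> 1 * (v - u)"
    proof (intro mult_mono)
      show "1 - exp (u - v) \<le> v - u" using exp_ge_add_one_self[of "u - v"] by linarith
    qed (use that in auto)
    finally show ?thesis by simp
  qed
  show ?thesis
    using *[of x y] *[of y x] assms by (cases "x \<le> y") (auto simp: abs_real_def)
qed

text \<open>Gronwall's argument for equations that hold almost everywhere:
  \<open>exp (- (2 * L) * s)\<close> times the squared distance does not increase. The Lipschitz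
  bound is asked only along the two curves, which suits a locally Lipschitz
  \<open>F\<close>.\<close>

lemma ode_unique:
  fixes u w :: "real \<Rightarrow> 'a::euclidean_space"
  assumes T: "0 < T" and u: "abs_continuous_on {0..T} u" and w: "abs_continuous_on {0..T} w"
    and init: "u 0 = w 0" and N: "negligible N"
    and du: "\<And>t. t \<in> {0..T} - N \<Longrightarrow> (u has_vector_derivative F (u t)) (at t within {0..T})"
    and dw: "\<And>t. t \<in> {0..T} - N \<Longrightarrow> (w has_vector_derivative F (w t)) (at t within {0..T})"
    and lip: "0 \<le> L" "\<And>t. t \<in> {0..T} \<Longrightarrow> norm (F (u t) - F (w t)) \<le> L * norm (u t - w t)"
    and t: "t \<in> {0..T}"
  shows "u t = w t"
proof -
  define d where "d s = u s - w s" for s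
  define g where "g s = exp (- (2 * L) * s) * (d s \<bullet> d s)" for s
  have acd: "abs_continuous_on {0..T} d" unfolding d_def[abs_def]
      by (rule abs_continuous_on_diff[OF u w])
  obtain B where B: "0 < B" "\<And>s. s \<in> {0..T} \<Longrightarrow> norm (d s) \<le> B"
    by (rule abs_continuous_on_bounded[OF acd], rule that) blast+
  have "abs_continuous_on {0..T} g"
  proof (rule abs_continuous_onI_Lipschitz[OF acd, of "2 * B + 2 * L * B\<^sup>2"])
    fix x y assume xy: "x \<in> {0..T}" "y \<in> {0..T}"
    have dd: "\<bar>d y \<bullet> d y - d x \<bullet> d x\<bar> \<le> 2 * B * norm (d y - d x)"
    proof -
      have "d y \<bullet> d y - d x \<bullet> d x = (d y - d x) \<bullet> (d y + d x)"
        by (simp add: inner_diff_left inner_add_right inner_commute[of "d y" "d x"])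
      then have "\<bar>d y \<bullet> d y - d x \<bullet> d x\<bar> \<le> norm (d y - d x) * norm (d y + d x)"
        by (simp only: Cauchy_Schwarz_ineq2)
      also have "\<dots> \<le> norm (d y - d x) * (B + B)"
        using norm_triangle_mono[OF B(2) B(2)] xy by (intro mult_left_mono) auto
      finally show ?thesis by (simp add: algebra_simps)
    qed
    have e1: "\<bar>exp (- (2 * L) * y) - exp (- (2 * L) * x)\<bar> \<le> 2 * L * \<bar>y - x\<bar>"
    proof -
      have "\<bar>exp (- (2 * L) * y) - exp (- (2 * L) * x)\<bar> \<le> \<bar>- (2 * L) * y - - (2 * L) * x\<bar>"
        using lip(1) xy by (intro exp_neg_Lipschitz) auto
      also have "- (2 * L) * y - - (2 * L) * x = - (2 * L) * (y - x)" by (simp add: algebra_simps)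
      finally show ?thesis using lip(1) by (simp add: abs_mult)
    qed
    have n: "d x \<bullet> d x \<le> B\<^sup>2"
      using power_mono[OF B(2)[OF xy(1)], of 2] by (simp add: power2_norm_eq_inner)
    have "g y - g x = exp (- (2 * L) * y) * (d y \<bullet> d y - d x \<bullet> d x) + (exp (- (2 * L) * y)
        - exp (- (2 * L) * x)) * (d x \<bullet> d x)"
      by (simp add: g_def algebra_simps)
    then have "norm (g y - g x) \<le> exp (- (2 * L) * y) * \<bar>d y \<bullet> d y - d x \<bullet> d x\<bar>
        + \<bar>exp (- (2 * L) * y) - exp (- (2 * L) * x)\<bar> * (d x \<bullet> d x)"
      using abs_triangle_ineq[of "exp (- (2 * L) * y) * (d y \<bullet> d y
          - d x \<bullet> d x)" "(exp (- (2 * L) * y) - exp (- (2 * L) * x)) * (d x \<bullet> d x)"]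
      by (simp only: abs_mult real_norm_def abs_exp_cancel abs_of_nonneg[OF inner_ge_zero])
    also have "\<dots> \<le> 1 * (2 * B * norm (d y - d x)) + (2 * L * \<bar>y - x\<bar>) * B\<^sup>2"
      using dd e1 n lip(1) xy by (intro add_mono mult_mono) auto
    also have "\<dots> \<le> (2 * B + 2 * L * B\<^sup>2) * (norm (d y - d x) + \<bar>y - x\<bar>)"
      using B(1) lip(1) by (simp add: algebra_simps)
    finally show "norm (g y - g x) \<le> (2 * B + 2 * L * B\<^sup>2) * (norm (d y - d x) + \<bar>y - x\<bar>)" .
  qed (use B lip(1) in auto)
  then have "abs_continuous_on {0..t} g" by (rule abs_continuous_on_subset) (use t in auto)
  then have "g t \<le> g 0"
  proof (rule abs_continuous_nonincreasing[OF _ _ N])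
    fix s assume s: "s \<in> {0..t} - N"
    then have s': "s \<in> {0..T} - N" using t by auto
    have dd: "(d has_vector_derivative F (u s) - F (w s)) (at s within {0..T})"
      unfolding d_def[abs_def] by (intro has_vector_derivative_diff du dw s')
    have "((\<lambda>s. d s \<bullet> d s) has_vector_derivative (d s \<bullet> (F (u s) - F (w s)) + (F (u s)
        - F (w s)) \<bullet> d s)) (at s within {0..T})"
      by (rule bounded_bilinear.has_vector_derivative[OF bounded_bilinear_inner dd dd])
    moreover have "((\<lambda>s. exp (- (2 * L) * s)) has_vector_derivative (- (2 * L) * exp (- (2 * L) *
        s))) (at s within {0..T})"
      unfolding has_real_derivative_iff_has_vector_derivative[symmetric]
      by (auto intro!: derivative_eq_intros)
    ultimately have g': "(g has_vector_derivative (exp (- (2 * L) * s) * (d s \<bullet> (F (u s) - F (w s))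
        + (F (u s) - F (w s)) \<bullet> d s) + (- (2 * L) * exp (- (2 * L) * s)) * (d s \<bullet> d s))) (at s
        within {0..T})"
      unfolding g_def[abs_def] by (intro has_vector_derivative_mult)
    have gen: "E * (a + a) + (- (2 * L) * E) * n = E * (2 * a - 2 * L * n)" for E a n :: real
      by (simp add: algebra_simps)
    have "d s \<bullet> (F (u s) - F (w s)) \<le> norm (d s) * norm (F (u s) - F (w s))"
        by (rule norm_cauchy_schwarz)
    also have "\<dots> \<le> norm (d s) * (L * norm (d s))" using lip(2)[of s] s' unfolding d_def
        by (intro mult_left_mono) auto
    also have "\<dots> = L * (d s \<bullet> d s)" by (simp add: dot_square_norm power2_eq_square)
    finally have "exp (- (2 * L) * s) * (2 * (d s \<bullet> (F (u s) - F (w s))) - 2 * L * (d s \<bullet> d s)) \<le> 0"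
      by (intro mult_nonneg_nonpos) auto
    then have "exp (- (2 * L) * s) * (d s \<bullet> (F (u s) - F (w s)) + (F (u s) - F (w s)) \<bullet> d s)
        + (- (2 * L) * exp (- (2 * L) * s)) * (d s \<bullet> d s) \<le> 0"
      unfolding inner_commute[of "F (u s) - F (w s)" "d s"] by (simp only: gen)
    moreover have "{0..t} \<subseteq> {0..T}" using t by auto
    note has_vector_derivative_within_subset[OF g' this]
    ultimately show "\<exists>D\<le>0. (g has_vector_derivative D) (at s within {0..t})" by blast
  qed (use t in simp)
  then have "exp (- (2 * L) * t) * (d t \<bullet> d t) \<le> 0" using init by (simp add: g_def d_def)
  then have "d t \<bullet> d t \<le> 0" by (simp add: mult_le_0_iff)
  then have "d t = 0" using inner_ge_zero[of "d t"] by (metis antisym inner_eq_zero_iff)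
  then show ?thesis by (simp add: d_def)
qed

section \<open>Monotonicity and uniqueness of the gradient flow\<close>

context closed_convex_function
begin

lemma subgrad_monotone:
  assumes "subgrad x \<xi>" "subgrad y \<eta>"
  shows "0 \<le> (\<xi> - \<eta>) \<bullet> (x - y)"
proof -
  have "f x + \<xi> \<bullet> (y - x) \<le> f y" "f y + \<eta> \<bullet> (x - y) \<le> f x" using assms by (auto simp: subgrad_def)
  moreover have "\<xi> \<bullet> (y - x) = - (\<xi> \<bullet> (x - y))" by (simp add: inner_diff_right)
  ultimately show ?thesis by (simp only: inner_diff_left)
qed

end

context moving_metric_flow
begin

text \<open>The condition \<open>S t v \<in> - \<partial>\<phi> (m t)\<close> written in terms of
  \<open>f\<close>. The velocity is an argument, so that both two-sided derivatives and derivatives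
  within an interval can be inserted.\<close>

definition flows :: "(real \<Rightarrow> 'a) \<Rightarrow> real \<Rightarrow> 'a \<Rightarrow> bool" where
  "flows m t v \<longleftrightarrow> subgrad (m t) (- S t v - M (m t) + b)"

text \<open>Product rule with \<open>S' = 2 M\<close>; symmetry merges the two terms containing
  \<open>v\<close>.\<close>

lemma Q_has_vector_derivative:
  assumes u: "(u has_vector_derivative v) (at t within A)" and t: "0 \<le> t"
  shows "((\<lambda>s. Q s (u s)) has_vector_derivative 2 * (S t v \<bullet> u t + u t \<bullet> M (u t))) (at t within A)"
proof -
  have Pu: "((\<lambda>s. P (u s)) has_vector_derivative P v) (at t within A)"
    by (rule bounded_linear.has_vector_derivative[OF linear_conv_bounded_linear[THEN iffD1, OF
        spd_map_linear[OF P]] u])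
  have Mu: "((\<lambda>s. M (u s)) has_vector_derivative M v) (at t within A)"
    by (rule bounded_linear.has_vector_derivative[OF linear_conv_bounded_linear[THEN iffD1, OF
        spd_map_linear[OF M]] u])
  have 1: "((\<lambda>s. u s \<bullet> P (u s)) has_vector_derivative (u t \<bullet> P v + v \<bullet> P (u t))) (at t within A)"
    by (rule bounded_bilinear.has_vector_derivative[OF bounded_bilinear_inner u Pu])
  have 2: "((\<lambda>s. u s \<bullet> M (u s)) has_vector_derivative (u t \<bullet> M v + v \<bullet> M (u t))) (at t within A)"
    by (rule bounded_bilinear.has_vector_derivative[OF bounded_bilinear_inner u Mu])
  have 3: "((\<lambda>s::real. 2 * s) has_vector_derivative 2) (at t within A)"
    unfolding has_real_derivative_iff_has_vector_derivative[symmetric]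
        by (auto intro!: derivative_eq_intros)
  have eq: "(u t \<bullet> P v + v \<bullet> P (u t)) + (2 * t * (u t \<bullet> M v + v \<bullet> M (u t)) + 2 * (u t \<bullet> M (u t)))
     = 2 * (S t v \<bullet> u t + u t \<bullet> M (u t))"
    using spd_map_sym[OF P, of v "u t"] spd_map_sym[OF M, of v "u t"]
    by (simp add: S_def inner_add_left inner_commute algebra_simps)
  have "((\<lambda>s. u s \<bullet> P (u s) + 2 * s * (u s \<bullet> M (u s))) has_vector_derivative
     (u t \<bullet> P v + v \<bullet> P (u t)) + (2 * t * (u t \<bullet> M v + v \<bullet> M (u t))
         + 2 * (u t \<bullet> M (u t)))) (at t within A)"
    by (intro has_vector_derivative_add 1 has_vector_derivative_mult 2 3)
  then show ?thesis unfolding eq by (simp add: Q_def S_def inner_add_right)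
qed

lemma Q_abs_continuous:
  assumes d: "abs_continuous_on {0..T} d" and T: "0 < T"
  shows "abs_continuous_on {0..T} (\<lambda>t. Q t (d t))"
proof -
  obtain B where B: "0 < B" "\<And>s. s \<in> {0..T} \<Longrightarrow> norm (d s) \<le> B"
    by (rule abs_continuous_on_bounded[OF d], rule that) blast+
  obtain BP where BP: "0 < BP" "\<And>x. norm (P x) \<le> BP * norm x"
    using linear_bounded_pos[OF spd_map_linear[OF P]] by blast
  \<comment> \<open>The first summand accounts for a change of the argument at a fixed time, the
    second for a change of the metric at a fixed argument.\<close>
  define K where "K = (BP + 2 * T * M_norm) * (2 * B) + 2 * (M_norm * (B * B))"
  have K1: "0 \<le> (BP + 2 * T * M_norm) * (2 * B)" using BP(1) M_norm(1) B(1) T by simp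
  have K2: "0 \<le> 2 * (M_norm * (B * B))" using M_norm(1) B(1) by simp
  show ?thesis
  proof (rule abs_continuous_onI_Lipschitz[OF d, of K])
    fix s t assume st: "s \<in> {0..T}" "t \<in> {0..T}"
    have S: "norm (S t x) \<le> (BP + 2 * T * M_norm) * norm x" for x
    proof -
      have "norm (S t x) \<le> norm (P x) + (2 * t) * norm (M x)"
        unfolding S_def using norm_triangle_ineq[of "P x" "(2 * t) *\<^sub>R M x"] st by simp
      also have "\<dots> \<le> BP * norm x + (2 * T) * (M_norm * norm x)"
        using BP(2) M_norm st by (intro add_mono mult_mono) auto
      finally show ?thesis by (simp add: algebra_simps)
    qed
    have "Q t (d t) - Q t (d s) = (d t - d s) \<bullet> S t (d t + d s)"
      using spd_map_sym[OF S_spd_map, of t "d s" "d t"] st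
      by (simp add: Q_def linear_add[OF spd_map_linear[OF S_spd_map]] inner_diff_left
          inner_add_right inner_commute)
    then have "\<bar>Q t (d t) - Q t (d s)\<bar> \<le> norm (d t - d s) * norm (S t (d t + d s))"
      by (simp only: Cauchy_Schwarz_ineq2)
    also have "\<dots> \<le> norm (d t - d s) * ((BP + 2 * T * M_norm) * (B + B))"
      using S[of "d t + d s"] norm_triangle_mono[OF B(2) B(2), of t s] st BP(1) M_norm(1) T
      by (intro mult_left_mono order_trans[OF S] mult_left_mono) auto
    finally have 1: "\<bar>Q t (d t) - Q t (d s)\<bar> \<le> (BP + 2 * T * M_norm) * (2 * B) * norm (d t - d s)"
        by (simp add: mult_ac)
    have "Q t (d s) - Q s (d s) = 2 * (t - s) * (d s \<bullet> M (d s))" using Q_add[of s "t - s" "d s"]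
        by simp
    moreover have "\<bar>d s \<bullet> M (d s)\<bar> \<le> M_norm * (B * B)"
    proof -
      have "\<bar>d s \<bullet> M (d s)\<bar> \<le> M_norm * (norm (d s) * norm (d s))"
        using M_norm_inner[of "d s" "d s"] spd_map_nonneg[OF M, of "d s"] by simp
      also have "\<dots> \<le> M_norm * (B * B)" using B(2)[OF st(1)] B(1) M_norm(1)
          by (intro mult_left_mono mult_mono) auto
      finally show ?thesis .
    qed
    then have "2 * \<bar>t - s\<bar> * \<bar>d s \<bullet> M (d s)\<bar> \<le> 2 * \<bar>t - s\<bar> * (M_norm * (B * B))"
      by (intro mult_left_mono) auto
    ultimately have 2: "\<bar>Q t (d s) - Q s (d s)\<bar> \<le> 2 * (M_norm * (B * B)) * \<bar>t - s\<bar>"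
      by (simp only: abs_mult abs_numeral mult_ac)
    have "norm (Q t (d t) - Q s (d s)) \<le> (BP + 2 * T * M_norm) * (2 * B) * norm (d t - d s)
        + 2 * (M_norm * (B * B)) * \<bar>t - s\<bar>"
      using 1 2 by simp
    also have "\<dots> \<le> K * norm (d t - d s) + K * \<bar>t - s\<bar>"
      using K1 K2 unfolding K_def by (intro add_mono mult_right_mono) auto
    finally show "norm (Q t (d t) - Q s (d s)) \<le> K * (norm (d t - d s) + \<bar>t - s\<bar>)"
        by (simp add: algebra_simps)
  qed (use K1 K2 in \<open>simp add: K_def\<close>)
qed

lemma flow_unique:
  assumes T: "0 < T" and m1: "abs_continuous_on {0..T} m1" and m2: "abs_continuous_on {0..T} m2"
    and init: "m1 0 = m2 0" and N: "negligible N"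
    and d1: "\<And>t. t \<in> {0..T} - N \<Longrightarrow> \<exists>v. (m1 has_vector_derivative v) (at t within {0..T})
        \<and> flows m1 t v"
    and d2: "\<And>t. t \<in> {0..T} - N \<Longrightarrow> \<exists>v. (m2 has_vector_derivative v) (at t within {0..T})
        \<and> flows m2 t v"
    and t: "t \<in> {0..T}"
  shows "m1 t = m2 t"
proof -
  define d where "d s = m1 s - m2 s" for s
  have acd: "abs_continuous_on {0..T} d" unfolding d_def[abs_def]
      by (rule abs_continuous_on_diff[OF m1 m2])
  have "abs_continuous_on {0..t} (\<lambda>s. Q s (d s))"
    using Q_abs_continuous[OF acd T] by (rule abs_continuous_on_subset) (use t in auto)
  then have "Q t (d t) \<le> Q 0 (d 0)"
  proof (rule abs_continuous_nonincreasing[OF _ _ N])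
    fix s assume s: "s \<in> {0..t} - N"
    then have s': "s \<in> {0..T} - N" "0 \<le> s" using t by auto
    obtain v1 where v1: "(m1 has_vector_derivative v1) (at s within {0..T})" "flows m1 s v1"
        using d1[OF s'(1)] by blast
    obtain v2 where v2: "(m2 has_vector_derivative v2) (at s within {0..T})" "flows m2 s v2"
        using d2[OF s'(1)] by blast
    have lin: "linear (S s)" using s'(2) by (intro spd_map_linear S_spd_map)
    have "(d has_vector_derivative v1 - v2) (at s within {0..T})"
      unfolding d_def[abs_def] by (intro has_vector_derivative_diff v1 v2)
    from Q_has_vector_derivative[OF this s'(2)]
    have "((\<lambda>s. Q s (d s)) has_vector_derivative 2 * (S s (v1 - v2) \<bullet> d s
        + d s \<bullet> M (d s))) (at s within {0..T})" .
    then have der: "((\<lambda>s. Q s (d s)) has_vector_derivative 2 * (S s (v1 - v2) \<bullet> d s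
        + d s \<bullet> M (d s))) (at s within {0..t})"
      by (rule has_vector_derivative_within_subset) (use t in auto)
    \<comment> \<open>The two subgradients differ by minus \<open>S s (v1 - v2) + M (d s)\<close>,
      exactly the combination in the derivative of the distance; there \<open>M\<close> stems from
      the growth of the metric, here from the quadratic part of \<open>\<phi>\<close>.\<close>
    have "0 \<le> ((- S s v1 - M (m1 s) + b) - (- S s v2 - M (m2 s) + b)) \<bullet> (m1 s - m2 s)"
      using v1(2) v2(2) unfolding flows_def by (rule subgrad_monotone)
    also have "(- S s v1 - M (m1 s) + b) - (- S s v2 - M (m2 s) + b) = - (S s (v1 - v2) + M (d s))"
      by (simp add: d_def linear_diff[OF lin] linear_diff[OF spd_map_linear[OF M]])
    finally have "2 * (S s (v1 - v2) \<bullet> d s + d s \<bullet> M (d s)) \<le> 0"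
      by (simp add: d_def[symmetric] inner_diff_left inner_commute[of "d s"])
    with der show "\<exists>D\<le>0. ((\<lambda>s. Q s (d s)) has_vector_derivative D) (at s within {0..t})" by blast
  qed (use t in simp)
  moreover have "Q 0 (d 0) = 0" using init by (simp add: d_def Q_def)
  moreover have "P_coercivity * (norm (d t))\<^sup>2 \<le> Q t (d t)" using t by (intro P_coercivity_Q) auto
  ultimately have "P_coercivity * (norm (d t))\<^sup>2 \<le> 0" by simp
  then have "d t = 0" using P_coercivity_pos by (simp add: mult_le_0_iff)
  then show ?thesis by (simp add: d_def)
qed

lemma flow_exists:
  assumes x0: "x0 \<in> closure D"
  obtains m where "m 0 = x0" "continuous_on {0..} m" "\<And>T. 0 < T \<Longrightarrow> abs_continuous_on {0..T} m"
    "negligible {t. 0 < t \<and> \<not> (\<exists>v. (m has_vector_derivative v) (at t) \<and> flows m t v)}"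
proof -
  show thesis
  proof (rule limit_curve[OF x0])
    fix m
    assume m0: "m 0 = x0"
      and m_init: "\<And>z. z \<in> D \<Longrightarrow> \<exists>K. \<forall>t\<ge>0. Q t (m t - z) / 2 \<le> Q 0 (x0 - z) / 2 + t * K"
      and m_len: "\<exists>c a K. 0 < c \<and> (\<forall>s t. 0 \<le> s \<longrightarrow> s \<le> t \<longrightarrow> c * norm (m t - m s) \<le> (t - s) * K
          + (Q s (m s - a) / 2 - Q t (m t - a) / 2))"
      and m_lip: "\<And>T. 0 < T \<Longrightarrow> \<exists>L>0. \<forall>\<tau> s t. 0 < \<tau> \<longrightarrow> \<tau> \<le> s \<longrightarrow> s \<le> t \<longrightarrow> t \<le> T \<longrightarrow> norm (m t - m s)
          \<le> L / \<tau> * (t - s)"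
      and m_evi: "\<And>z \<tau> T. z \<in> D \<Longrightarrow> 0 < \<tau> \<Longrightarrow> 0 < T \<Longrightarrow> \<exists>C. \<forall>s t. \<tau> \<le> s \<longrightarrow> s < t \<longrightarrow> t \<le> T \<longrightarrow>
         evi m z C s t"
    have lip: "\<exists>L. L-lipschitz_on {\<tau>..T} m" if \<tau>: "0 < \<tau>" "\<tau> \<le> T" for \<tau> T
    proof -
      obtain L where L: "L > 0" "\<And>s t. \<tau> \<le> s \<Longrightarrow> s \<le> t \<Longrightarrow> t \<le> T \<Longrightarrow> norm (m t - m s) \<le> L / \<tau> * (t - s)"
        using m_lip[of T] \<tau> by auto
      have "(L / \<tau>)-lipschitz_on {\<tau>..T} m"
      proof (rule lipschitz_onI)
        fix s t assume "s \<in> {\<tau>..T}" "t \<in> {\<tau>..T}"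
        then show "dist (m s) (m t) \<le> L / \<tau> * dist s t"
          using L(2)[of s t] L(2)[of t s] by (cases "s
              \<le> t") (auto simp: dist_norm norm_minus_commute)
      qed (use L(1) \<tau> in simp)
      then show ?thesis by blast
    qed
    have cont: "continuous_on {0..} m"
      unfolding continuous_on_iff
    proof (intro ballI allI impI)
      fix t \<epsilon> :: real assume t: "t \<in> {0..}" and \<epsilon>: "0 < \<epsilon>"
      show "\<exists>\<delta>>0. \<forall>s\<in>{0..}. dist s t < \<delta> \<longrightarrow> dist (m s) (m t) < \<epsilon>"
      proof (cases "t = 0")
        case False
        then have t0: "0 < t" using t by simp
        obtain L where L: "L-lipschitz_on {t/2..t+1} m" using lip[of "t/2" "t+1"] t0 by auto
        have "t \<in> {t/2..t+1}" using t0 by auto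
        then obtain \<delta> where \<delta>: "\<delta> > 0" "\<And>s. s \<in> {t/2..t+1} \<Longrightarrow> dist s t < \<delta> \<Longrightarrow> dist (m s) (m t) < \<epsilon>"
          using lipschitz_on_continuous_on[OF L] \<epsilon> unfolding continuous_on_iff by blast
        show ?thesis
        proof (intro exI[of _ "min \<delta> (min 1 (t/2))"] conjI ballI impI)
          fix s assume "dist s t < min \<delta> (min 1 (t/2))"
          then have "\<bar>s - t\<bar> < \<delta>" "\<bar>s - t\<bar> < 1" "\<bar>s - t\<bar> < t / 2" by (auto simp: dist_real_def)
          moreover from this have "t / 2 \<le> s" "s \<le> t + 1" by linarith+
          ultimately show "dist (m s) (m t) < \<epsilon>" by (intro \<delta>(2)) (auto simp: dist_real_def)
        qed (use \<delta>(1) t0 in simp)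
      next
        case True
        obtain BP where BP: "0 < BP" "\<And>x. x \<bullet> P x \<le> BP * (norm x)\<^sup>2"
          by (rule spd_map_bound[OF P], rule that) blast+
        \<comment> \<open>At \<open>t = 0\<close> the initial value is replaced by a nearby
          \<open>z\<close> in \<open>D\<close>, for which the initial estimate has a finite
          constant. The error of the replacement and the growth up to time \<open>\<delta>\<close>
          each contribute at most \<open>P_coercivity * \<epsilon>\<^sup>2 / 16\<close>.\<close>
        define \<eta> where "\<eta> = min (\<epsilon> / 2) (sqrt (P_coercivity * \<epsilon>\<^sup>2 / (8 * BP)))"
        have "\<eta> > 0" using \<epsilon> P_coercivity_pos BP(1) by (simp add: \<eta>_def)
        then obtain z where z: "z \<in> D" "dist z x0 < \<eta>" using x0 unfolding closure_approachable
            by blast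
        have "(norm (x0 - z))\<^sup>2 \<le> (sqrt (P_coercivity * \<epsilon>\<^sup>2 / (8 * BP)))\<^sup>2"
          using z(2) by (intro power_mono) (auto simp: \<eta>_def dist_norm norm_minus_commute)
        also have "\<dots> = P_coercivity * \<epsilon>\<^sup>2 / (8 * BP)" using P_coercivity_pos BP(1) by simp
        finally have "BP * (norm (x0 - z))\<^sup>2 \<le> P_coercivity * \<epsilon>\<^sup>2 / 8" using BP(1)
            by (simp add: field_simps)
        then have Q0: "Q 0 (x0 - z) \<le> P_coercivity * \<epsilon>\<^sup>2 / 8" using BP(2)[of "x0 - z"]
            by (simp add: Q_def S_def)
        obtain K where K: "\<And>t. t \<ge> 0 \<Longrightarrow> Q t (m t - z) / 2 \<le> Q 0 (x0 - z) / 2 + t * K"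
          using m_init[OF z(1)] by blast
        define k where "k = \<bar>K\<bar> + 1"
        have k: "0 < k" "K \<le> k" by (auto simp: k_def)
        define \<delta> where "\<delta> = P_coercivity * \<epsilon>\<^sup>2 / (16 * k)"
        have pos: "0 < P_coercivity * \<epsilon>\<^sup>2" using P_coercivity_pos \<epsilon> by simp
        then have "\<delta> > 0" using k(1) by (simp add: \<delta>_def)
        have "dist (m s) x0 < \<epsilon>" if s: "0 \<le> s" "s < \<delta>" for s
        proof -
          have "s * K \<le> s * k" using s k by (intro mult_left_mono) auto
          also have "\<dots> \<le> \<delta> * k" using s k by (intro mult_right_mono) auto
          also have "\<dots> = P_coercivity * \<epsilon>\<^sup>2 / 16" using k(1) by (simp add: \<delta>_def)
          finally have "Q s (m s - z) \<le> P_coercivity * \<epsilon>\<^sup>2 / 4" using K[OF s(1)] Q0 by linarith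
          then have "P_coercivity * (norm (m s - z))\<^sup>2 \<le> P_coercivity * (\<epsilon> / 2)\<^sup>2"
              using P_coercivity_Q[OF s(1), of "m s - z"] by (simp add: power_divide)
          then have "norm (m s - z) \<le> \<epsilon> / 2" using P_coercivity_pos \<epsilon>
              by (auto intro: power2_le_imp_le)
          moreover have "dist z x0 < \<epsilon> / 2" using z(2) by (simp add: \<eta>_def)
          ultimately show ?thesis using dist_triangle[of "m s" x0 z] by (simp add: dist_norm)
        qed
        then show ?thesis using \<open>\<delta> > 0\<close> True m0 by (intro exI[of _ \<delta>]) (auto simp: dist_real_def)
      qed
    qed
    have ac: "abs_continuous_on {0..T} m" if T: "0 < T" for T
    proof -
      obtain c a K where c: "0 < c" "\<And>s t. 0 \<le> s \<Longrightarrow> s \<le> t \<Longrightarrow> c * norm (m t - m s) \<le> (t - s) * K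
          + (Q s (m s - a) / 2 - Q t (m t - a) / 2)"
        using m_len by blast
      \<comment> \<open>The right-hand side of the length bound is an increment of
        \<open>c * G\<close>; \<open>G\<close> is nondecreasing because norms are
        nonnegative.\<close>
      define G where "G t = (t * K - Q t (m t - a) / 2) / c" for t
      have inc: "norm (m t - m s) \<le> G t - G s" if "0 \<le> s" "s \<le> t" for s t
      proof -
        have "G t - G s = ((t - s) * K + (Q s (m s - a) / 2 - Q t (m t - a) / 2)) / c"
          unfolding G_def diff_divide_distrib[symmetric]
          by (rule arg_cong[where f = "\<lambda>x. x / c"]) (simp add: left_diff_distrib)
        then show ?thesis using c(2)[OF that] c(1) by (simp add: pos_le_divide_eq mult.commute)
      qed
      have contQ: "continuous_on {0..T} (\<lambda>t. Q t (m t - a))"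
      proof -
        have cm: "continuous_on {0..T} m" by (rule continuous_on_subset[OF cont]) auto
        show ?thesis unfolding continuous_on_def
          by (intro ballI tendsto_Q tendsto_intros cm[unfolded continuous_on_def, rule_format])
      qed
      show ?thesis
      proof (rule abs_continuous_on_mono_Lipschitz_tail[of T G])
        show "mono_on {0..T} G"
        proof (rule mono_onI)
          fix s t assume "s \<in> {0..T}" "t \<in> {0..T}" "s \<le> t"
          then show "G s \<le> G t" using inc[of s t] norm_ge_zero[of "m t - m s"]
              by (auto simp del: norm_ge_zero)
        qed
        show "continuous_on {0..T} G" unfolding G_def using c(1)
            by (intro continuous_intros contQ) auto
        show "\<exists>L. \<forall>a b. \<tau> \<le> a \<longrightarrow> a \<le> b \<longrightarrow> b \<le> T \<longrightarrow> norm (m b - m a) \<le> L * (b - a)" if "0 < \<tau>" for \<tau>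
          using m_lip[OF T] that by blast
      qed (use T inc in auto)
    qed
    have "negligible {t. 0 < t \<and> \<not> m differentiable (at t)}"
    proof -
      \<comment> \<open>With its time argument clamped to \<open>{1 / Suc n..Suc n}\<close> the
        curve is Lipschitz on the whole line; these intervals exhaust the positive times.\<close>
      define mn where "mn n t = m (max (1 / real (Suc n)) (min t (real (Suc n))))" for n :: nat
          and t
      have "negligible {t. \<not> mn n differentiable (at t)}" for n
      proof -
        have le: "1 / real (Suc n) \<le> real (Suc n)" by (simp add: field_simps)
        obtain L where L: "L-lipschitz_on {1 / real (Suc n)..real (Suc n)} m"
          using lip[of "1 / real (Suc n)" "real (Suc n)"] le by auto
        have "L-lipschitz_on UNIV (mn n)"
        proof (rule lipschitz_onI)
          fix s t :: real
          let ?c = "\<lambda>t. max (1 / real (Suc n)) (min t (real (Suc n)))"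
          have "dist (mn n s) (mn n t) \<le> L * dist (?c s) (?c t)"
            unfolding mn_def using le by (intro lipschitz_onD[OF L]) auto
          also have "\<dots> \<le> L * dist s t"
            using lipschitz_on_nonneg[OF L] by (intro mult_left_mono) (auto simp: dist_real_def)
          finally show "dist (mn n s) (mn n t) \<le> L * dist s t" .
        qed (rule lipschitz_on_nonneg[OF L])
        then show ?thesis by (rule lipschitz_differentiable_ae)
      qed
      then have neg: "negligible (\<Union>n. {t. \<not> mn n differentiable (at t)})"
          by (intro negligible_countable_Union) auto
      have "m differentiable (at t)" if t: "0 < t" "\<And>n. mn n differentiable (at t)" for t
      proof -
        obtain n1 n2 where n: "1 / real (Suc n1) < t" "t < real n2"
          using reals_Archimedean[OF t(1)] reals_Archimedean2[of t]
              by (auto simp: inverse_eq_divide)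
        define n where "n = max n1 n2"
        have n': "1 / real (Suc n) < t" "t < real (Suc n)"
        proof -
          have "1 / real (Suc n) \<le> 1 / real (Suc n1)" unfolding n_def
              by (intro divide_left_mono) auto
          then show "1 / real (Suc n) < t" using n(1) by linarith
          show "t < real (Suc n)" using n(2) unfolding n_def by linarith
        qed
        obtain D where D: "(mn n has_derivative D) (at t)" using t(2)[of n]
            unfolding differentiable_def by blast
        have "(m has_derivative D) (at t)"
        proof (rule has_derivative_transform_within_open[OF D])
          show "open {1 / real (Suc n)<..<real (Suc n)}" by simp
          show "t \<in> {1 / real (Suc n)<..<real (Suc n)}" using n' by simp
          show "mn n s = m s" if "s \<in> {1 / real (Suc n)<..<real (Suc n)}" for s
            using that by (simp add: mn_def)
        qed
        then show ?thesis unfolding differentiable_def by blast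
      qed
      then have "{t. 0 < t \<and> \<not> m differentiable (at t)} \<subseteq> (\<Union>n. {t. \<not> mn n differentiable (at t)})"
          by blast
      with neg show ?thesis by (rule negligible_subset)
    qed
    moreover have "\<exists>v. (m has_vector_derivative v) (at t) \<and> flows m t v" if t: "0 < t"
        and diff: "m differentiable (at t)" for t
    proof -
      obtain v where v: "(m has_vector_derivative v) (at t)"
        using diff vector_derivative_works by blast
      have mt: "m t \<in> D"
      proof -
        obtain z where "z \<in> D" using D_ne by blast
        then obtain C where "\<forall>s t'. t/2 \<le> s \<longrightarrow> s < t' \<longrightarrow> t' \<le> t \<longrightarrow> evi m z C s t'"
          using m_evi[of z "t/2" t] t by auto
        then have "t/2 \<le> t/2 \<longrightarrow> t/2 < t \<longrightarrow> t \<le> t \<longrightarrow> m t \<in> D" by blast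
        then show ?thesis using t by simp
      qed
      \<comment> \<open>The variational inequality is divided by \<open>t - s\<close>, and
        \<open>s\<close> increases to \<open>t\<close>. The derivative of half the squared distance
        contributes \<open>qM (m t - z)\<close>, twice the term on the right; the surplus is the
        strong convexity term.\<close>
      have "\<phi> (m t) + (- S t v) \<bullet> (z - m t) + qM (z - m t) / 2 \<le> \<phi> z" if z: "z \<in> D" for z
      proof -
        define A where "A = \<phi> z - \<phi> (m t) + qM (m t - z) / 2"
        define r where "r s = Q s (m s - z) / 2" for s
        obtain C where C: "\<forall>s t'. t/2 \<le> s \<longrightarrow> s < t' \<longrightarrow> t' \<le> t \<longrightarrow> evi m z C s t'"
          using m_evi[of z "t/2" t] t z by auto
        have ineq: "r t - r s \<le> (t - s) * (A + C * (t - s))" if "t/2 \<le> s" "s < t" for s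
          using C[rule_format, OF that order_refl] unfolding r_def A_def by blast
        define r' where "r' = S t v \<bullet> (m t - z) + qM (m t - z)"
        have "((\<lambda>s. m s - z) has_vector_derivative v) (at t)"
          using has_vector_derivative_diff[OF v has_vector_derivative_const[of z]] by simp
        from Q_has_vector_derivative[OF this] t
        have "((\<lambda>s. Q s (m s - z)) has_vector_derivative 2 * r') (at t)" by (simp add: r'_def)
        then have "((\<lambda>s. Q s (m s - z)) has_real_derivative 2 * r') (at t)"
          by (simp add: has_real_derivative_iff_has_vector_derivative)
        then have "(r has_real_derivative (2 * r') / 2) (at t)" unfolding r_def
            by (rule DERIV_cdivide)
        then have "((\<lambda>s. (r s - r t) / (s - t)) \<longlongrightarrow> r') (at t)"
            by (simp add: has_field_derivative_iff)
        then have lim1: "((\<lambda>s. (r s - r t) / (s - t)) \<longlongrightarrow> r') (at_left t)"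
            by (rule filterlim_mono) (auto simp: at_le)
        have lim2: "((\<lambda>s. A + C * (t - s)) \<longlongrightarrow> A + C * (t - t)) (at_left t)" by (intro tendsto_intros)
        have "r' \<le> A + C * (t - t)"
        proof (rule tendsto_le[OF _ lim2 lim1])
          have "\<forall>\<^sub>F s in at_left t. s \<in> {t/2<..<t}" using t
              by (intro eventually_at_leftI[of "t/2"]) auto
          then show "\<forall>\<^sub>F s in at_left t. (r s - r t) / (s - t) \<le> A + C * (t - s)"
          proof eventually_elim
            case (elim s)
            then have "r t - r s \<le> (t - s) * (A + C * (t - s))" by (intro ineq) auto
            then have "(r t - r s) / (t - s) \<le> A + C * (t - s)" using elim
                by (simp add: pos_divide_le_eq mult.commute)
            moreover have "(r s - r t) / (s - t) = (r t - r s) / (t - s)"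
                by (metis minus_diff_eq minus_divide_divide)
            ultimately show ?case by simp
          qed
        qed simp
        then have "S t v \<bullet> (m t - z) + qM (m t - z) \<le> \<phi> z - \<phi> (m t) + qM (m t - z) / 2"
          by (simp add: A_def r'_def)
        moreover have "qM (z - m t) = qM (m t - z)"
          using linear_diff[OF spd_map_linear[OF M]] by (simp add: inner_diff_left inner_diff_right)
        moreover have "(- S t v) \<bullet> (z - m t) = S t v \<bullet> (m t - z)" by (simp add: inner_diff_right)
        ultimately show ?thesis by linarith
      qed
      from phi_strong_conv[OF mt this] show ?thesis using v unfolding flows_def by auto
    qed
    ultimately have "negligible {t. 0 < t \<and> \<not> (\<exists>v. (m has_vector_derivative v) (at t)
        \<and> flows m t v)}"
      by (elim negligible_subset) blast
    then show thesis using that[of m] m0 cont ac by blast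
  qed
qed

end

text \<open>Uniqueness makes the solution map \<open>G t\<close> linear in the initial value;
  conservation of the quadratic form along solutions, polarised, is the last property. Linearity
  lets one map transport the sum and the covariance of all deviations at once.\<close>

lemma linear_flow:
  fixes P M :: "'a::euclidean_space \<Rightarrow> 'a"
  assumes P: "spd_map P" and M: "spd_map M"
  obtains G where "\<And>x. G 0 x = x" "\<And>x. continuous_on {0..} (\<lambda>t. G t x)"
    "\<And>x T. 0 < T \<Longrightarrow> abs_continuous_on {0..T} (\<lambda>t. G t x)"
    "\<And>x. negligible {t. 0 < t \<and> \<not> (\<exists>v. ((\<lambda>s. G s x) has_vector_derivative v) (at t) \<and> P v
        + (2 * t) *\<^sub>R M v = - M (G t x))}"
    "\<And>t. 0 \<le> t \<Longrightarrow> linear (G t)"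
    "\<And>t x y. 0 \<le> t \<Longrightarrow> (P (G t x) + (2 * t) *\<^sub>R M (G t x)) \<bullet> G t y = P x \<bullet> y"
proof -
  have "{(x, a). x \<in> UNIV \<and> (0::real) \<le> a} = (UNIV :: 'a set) \<times> {0..}" by auto
  then have cl: "closed {(x::'a, a). x \<in> UNIV \<and> (0::real) \<le> a}"
      by (metis closed_Times closed_UNIV closed_atLeast)
  interpret L: moving_metric_flow UNIV "\<lambda>_. 0" 0 P M 0
    by unfold_locales (use cl P M in \<open>auto simp: convex_on_def\<close>)
  have flows: "L.flows m t v \<longleftrightarrow> L.S t v = - M (m t)" for m t v
  proof -
    \<comment> \<open>A subgradient of the zero function on the whole space is tested in its own
      direction, and so must vanish.\<close>
    have "L.subgrad x \<xi> \<longleftrightarrow> \<xi> = 0" for x \<xi>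
    proof
      assume "L.subgrad x \<xi>"
      then have "\<forall>z. \<xi> \<bullet> (z - x) \<le> 0" unfolding L.subgrad_def by simp
      from spec[OF this, of "x + \<xi>"] have "\<xi> \<bullet> \<xi> \<le> 0" by simp
      then show "\<xi> = 0" using inner_ge_zero[of \<xi>] by (metis antisym inner_eq_zero_iff)
    qed (simp add: L.subgrad_def)
    then show ?thesis unfolding L.flows_def by (auto simp: algebra_simps eq_neg_iff_add_eq_0
        neg_eq_iff_add_eq_0)
  qed
  define sol where "sol x u \<longleftrightarrow> u 0 = x \<and> continuous_on {0..} u \<and> (\<forall>T>0. abs_continuous_on {0..T} u) \<and>
    negligible {t. 0 < t \<and> \<not> (\<exists>v. (u has_vector_derivative v) (at t) \<and> L.S t v = - M (u t))}"
        for x u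
  have "\<exists>u. sol x u" for x
  proof -
    have x: "x \<in> closure UNIV" by simp
    show ?thesis
    proof (rule L.flow_exists[OF x])
      fix m assume "m 0 = x" "continuous_on {0..} m" "\<And>T. 0 < T \<Longrightarrow> abs_continuous_on {0..T} m"
        "negligible {t. 0 < t \<and> \<not> (\<exists>v. (m has_vector_derivative v) (at t) \<and> L.flows m t v)}"
      then have "sol x m" unfolding sol_def flows by blast
      then show ?thesis by blast
    qed
  qed
  then obtain H where H: "\<And>x. sol x (H x)" by metis
  have unique: "u t = w t" if u: "sol x u" and w: "sol x w" and t: "0 \<le> t" for x u w t
  proof -
    define N1 where "N1 u = {t. 0 < t \<and> \<not> (\<exists>v. (u has_vector_derivative v) (at t) \<and> L.S t v =
        - M (u t))}" for u
    have neg: "negligible ({0} \<union> N1 u \<union> N1 w)"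
      using u w unfolding sol_def N1_def by (intro negligible_Un negligible_sing) auto
    have der: "\<exists>v. (u has_vector_derivative v) (at s within {0..t + 1}) \<and> L.flows u s v"
      if s: "s \<in> {0..t + 1}" "s \<noteq> 0" "s \<notin> N1 u" for s u
    proof -
      obtain v where "(u has_vector_derivative v) (at s)" "L.S s v = - M (u s)" using s
          unfolding N1_def by auto
      then show ?thesis unfolding flows using has_vector_derivative_at_within by blast
    qed
    show ?thesis
    proof (rule L.flow_unique[OF _ _ _ _ neg])
      show "0 < t + 1" "t \<in> {0..t + 1}" using t by auto
      show "abs_continuous_on {0..t + 1} u" "abs_continuous_on {0..t + 1} w" "u 0 = w 0"
        using u w t unfolding sol_def by auto
    qed (use der in auto)
  qed
  have comb: "sol (c *\<^sub>R x + y) (\<lambda>t. c *\<^sub>R H x t + H y t)" for c x y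
    unfolding sol_def
  proof (intro conjI allI impI)
    let ?N = "\<lambda>u. {t. 0 < t \<and> \<not> (\<exists>v. (u has_vector_derivative v) (at t) \<and> L.S t v = - M (u t))}"
    note hx = H[of x, unfolded sol_def] and hy = H[of y, unfolded sol_def]
    show "c *\<^sub>R H x 0 + H y 0 = c *\<^sub>R x + y" using hx hy by simp
    show "continuous_on {0..} (\<lambda>t. c *\<^sub>R H x t + H y t)" using hx hy
        by (intro continuous_intros) auto
    show "abs_continuous_on {0..T} (\<lambda>t. c *\<^sub>R H x t + H y t)" if "0 < T" for T
      using hx hy that by (intro abs_continuous_on_add abs_continuous_on_scaleR) auto
    have "negligible (?N (H x) \<union> ?N (H y))" using hx hy by (intro negligible_Un) auto
    moreover have "?N (\<lambda>t. c *\<^sub>R H x t + H y t) \<subseteq> ?N (H x) \<union> ?N (H y)"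
    proof (rule subsetI, rule ccontr)
      fix t assume t: "t \<in> ?N (\<lambda>t. c *\<^sub>R H x t + H y t)" "t \<notin> ?N (H x) \<union> ?N (H y)"
      then have "0 < t" by simp
      obtain v where v: "(H x has_vector_derivative v) (at t)" "L.S t v = - M (H x t)" using t
          by blast
      obtain w where w: "(H y has_vector_derivative w) (at t)" "L.S t w = - M (H y t)" using t
          by blast
      have lS: "linear (L.S t)" using \<open>0 < t\<close> by (intro spd_map_linear L.S_spd_map) auto
      have lM: "linear M" by (rule spd_map_linear[OF M])
      have "((\<lambda>t. c *\<^sub>R H x t + H y t) has_vector_derivative c *\<^sub>R v + w) (at t)"
        by (intro has_vector_derivative_add v(1) w(1) bounded_linear.has_vector_derivative[OF
            bounded_linear_scaleR_right])
      moreover have "L.S t (c *\<^sub>R v + w) = - M (c *\<^sub>R H x t + H y t)"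
        by (simp add: linear_add[OF lS] linear_add[OF lM] linear_scale[OF lS] linear_scale[OF lM]
            v(2) w(2))
      ultimately show False using t(1) by blast
    qed
    ultimately show "negligible (?N (\<lambda>t. c *\<^sub>R H x t + H y t))" by (rule negligible_subset)
  qed
  define G where "G t x = H x t" for t x
  have lin: "linear (G t)" if t: "0 \<le> t" for t
  proof (rule linearI)
    show "G t (x + y) = G t x + G t y" for x y
      using unique[OF H comb[of 1 x y, unfolded scaleR_one] t] by (simp add: G_def)
    have z: "sol 0 (\<lambda>_. 0)"
      unfolding sol_def
    proof (intro conjI allI impI)
      show "abs_continuous_on {0..T} (\<lambda>_. 0::'a)" for T
        by (rule abs_continuous_onI_Lipschitz[OF abs_continuous_on_ident, of 0]) auto
      have "\<exists>v. ((\<lambda>_. 0::'a) has_vector_derivative v) (at t) \<and> L.S t v = - M 0" for t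
        by (intro exI[of _ 0]) (simp add: L.S_def linear_0[OF spd_map_linear[OF P]] linear_0[OF
            spd_map_linear[OF M]])
      then show "negligible {t. 0 < t \<and> \<not> (\<exists>v. ((\<lambda>_. 0::'a) has_vector_derivative v) (at t)
          \<and> L.S t v = - M 0)}" by simp
    qed auto
    then have "G t 0 = 0" using unique[OF H z t] by (simp add: G_def)
    then show "G t (c *\<^sub>R x) = c *\<^sub>R G t x" for c x
      using unique[OF H comb[of c x 0, unfolded add_0_right] t] by (simp add: G_def)
  qed
  have cons: "L.Q t (G t x) = x \<bullet> P x" if t: "0 \<le> t" for t x
  proof -
    let ?N = "{t. 0 < t \<and> \<not> (\<exists>v. (H x has_vector_derivative v) (at t) \<and> L.S t v = - M (H x t))}"
    have neg: "negligible ({0} \<union> ?N)" using H[of x] unfolding sol_def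
        by (intro negligible_Un negligible_sing) auto
    have "abs_continuous_on {0..t + 1} (\<lambda>s. L.Q s (H x s))"
      using H[of x] t unfolding sol_def by (intro L.Q_abs_continuous) auto
    then have ac: "abs_continuous_on {0..t} (\<lambda>s. L.Q s (H x s))"
        by (rule abs_continuous_on_subset) auto
    have der: "((\<lambda>s. L.Q s (H x s)) has_vector_derivative 0) (at s within {0..t})" if s: "s \<in> {0..t}
        - ({0} \<union> ?N)" for s
    proof -
      have "0 < s" using s by auto
      obtain v where v: "(H x has_vector_derivative v) (at s)" "L.S s v = - M (H x s)" using s
          by auto
      have "((\<lambda>s. L.Q s (H x s)) has_vector_derivative 2 * (L.S s v \<bullet> H x s
          + H x s \<bullet> M (H x s))) (at s)"
        using v(1) \<open>0 < s\<close> by (intro L.Q_has_vector_derivative) auto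
      moreover have "2 * (L.S s v \<bullet> H x s + H x s \<bullet> M (H x s)) = 0" using v(2)
          by (simp add: inner_commute)
      ultimately show ?thesis using has_vector_derivative_at_within by metis
    qed
    \<comment> \<open>The derivative is zero almost everywhere, so the monotonicity criterion
      applies to the form and to its negative.\<close>
    have "L.Q t (H x t) \<le> L.Q 0 (H x 0)"
      using ac t neg by (rule abs_continuous_nonincreasing) (use der in blast)
    moreover have "- L.Q t (H x t) \<le> - L.Q 0 (H x 0)"
    proof (rule abs_continuous_nonincreasing[OF _ t neg])
      show "abs_continuous_on {0..t} (\<lambda>s. - L.Q s (H x s))"
        using abs_continuous_on_scaleR[OF ac, of "-1"] by simp
      show "\<exists>D\<le>0. ((\<lambda>s. - L.Q s (H x s)) has_vector_derivative D) (at s within {0..t})"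
          if "s \<in> {0..t} - ({0} \<union> ?N)" for s
        using has_vector_derivative_minus[OF der[OF that]] by force
    qed
    moreover have "L.Q 0 (H x 0) = x \<bullet> P x" using H[of x] unfolding sol_def
        by (simp add: L.Q_def L.S_def)
    ultimately show ?thesis by (simp add: G_def)
  qed
  \<comment> \<open>Polarisation with \<open>x - y\<close>, by linearity of
    \<open>G t\<close>.\<close>
  have cons2: "L.S t (G t x) \<bullet> G t y = P x \<bullet> y" if t: "0 \<le> t" for t x y
  proof -
    have "L.Q t (G t x - G t y) = (x - y) \<bullet> P (x - y)"
      using cons[OF t, of "x - y"] by (simp add: linear_diff[OF lin[OF t]])
    then show ?thesis unfolding L.Q_diff[OF t] spd_map_quad_diff[OF P] cons[OF t] by simp
  qed
  show thesis
  proof (rule that[of G])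
    show "negligible {t. 0 < t \<and> \<not> (\<exists>v. ((\<lambda>s. G s x) has_vector_derivative v) (at t) \<and> P v
        + (2 * t) *\<^sub>R M v = - M (G t x))}" for x
      using H[of x] unfolding sol_def G_def L.S_def by (simp add: eta_contract_eq)
    show "(P (G t x) + (2 * t) *\<^sub>R M (G t x)) \<bullet> G t y = P x \<bullet> y" if "0 \<le> t" for t x y
      using cons2[OF that] unfolding L.S_def by blast
  qed (use H lin in \<open>auto simp: G_def sol_def\<close>)
qed

text \<open>On \<open>eff_dom R\<close> the values are finite and the epigraphs agree; outside it
  \<open>R\<close> is infinite, so testing a subgradient there is trivial. This is the bridge from
  extended-real functions to the locale.\<close>

lemma closed_convex_function_of_ereal:
  fixes R :: "'a::euclidean_space \<Rightarrow> ereal"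
  assumes "proper_fun R" "closed_fun R" "convex_fun R" "(INF x. R x) > -\<infinity>"
  obtains \<beta> where "closed_convex_function (eff_dom R) (\<lambda>x. real_of_ereal (R x)) \<beta>"
    "\<And>x \<xi>. closed_convex_function.subgrad (eff_dom R) (\<lambda>x. real_of_ereal (R x)) x \<xi>
        \<longleftrightarrow> \<xi> \<in> subdiff R x"
proof -
  let ?f = "\<lambda>x. real_of_ereal (R x)"
  have fin: "R x = ereal (?f x)" if "x \<in> eff_dom R" for x
    using that assms(1) unfolding eff_dom_def proper_fun_def by (cases "R x") auto
  have outside: "R x = \<infinity>" if "x \<notin> eff_dom R" for x using that by (simp add: eff_dom_def)
  obtain x1 where x1: "x1 \<in> eff_dom R" using assms(1) unfolding proper_fun_def eff_dom_def
      by (auto simp: less_top[symmetric] top_ereal_def)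
  have "(INF x. R x) \<le> R x1" by (rule INF_lower) simp
  then obtain \<beta> where \<beta>: "(INF x. R x) = ereal \<beta>"
    using assms(4) fin[OF x1] by (cases "INF x. R x") auto
  have ccf: "closed_convex_function (eff_dom R) ?f \<beta>"
  proof
    show "eff_dom R \<noteq> {}" using x1 by blast
    have ineq: "R (u *\<^sub>R x + v *\<^sub>R y) \<le> ereal (u * ?f x + v * ?f y)"
      if "x \<in> eff_dom R" "y \<in> eff_dom R" "0 \<le> u" "0 \<le> v" "u + v = 1" for x y u v
    proof -
      have v: "v = 1 - u" using that by simp
      have "R (u *\<^sub>R x + (1 - u) *\<^sub>R y) \<le> ereal u * R x + ereal (1 - u) * R y"
        using assms(3) that unfolding convex_fun_def by auto
      then show ?thesis using fin[OF that(1)] fin[OF that(2)] unfolding v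
          by (metis plus_ereal.simps(1) times_ereal.simps(1))
    qed
    show "convex_on (eff_dom R) ?f" unfolding convex_on_def
    proof (intro conjI ballI allI impI)
      show "convex (eff_dom R)" unfolding convex_def
      proof (intro ballI allI impI)
        fix x y u v assume *: "x \<in> eff_dom R" "y \<in> eff_dom R" "0 \<le> (u::real)" "0 \<le> v" "u + v = 1"
        show "u *\<^sub>R x + v *\<^sub>R y \<in> eff_dom R"
          using ineq[OF *] unfolding eff_dom_def by (auto simp: le_less_trans)
      qed
      fix x y and u v :: real assume *: "x \<in> eff_dom R" "y \<in> eff_dom R" "0 \<le> u" "0 \<le> v" "u + v = 1"
      have "u *\<^sub>R x + v *\<^sub>R y \<in> eff_dom R"
        using ineq[OF *] unfolding eff_dom_def by (auto simp: le_less_trans)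
      from fin[OF this] ineq[OF *] show "?f (u *\<^sub>R x + v *\<^sub>R y) \<le> u * ?f x + v * ?f y"
          by (metis ereal_less_eq(3))
    qed
    have "{(x, a). x \<in> eff_dom R \<and> ?f x \<le> a} = {(x, a). R x \<le> ereal a}"
    proof -
      have "x \<in> eff_dom R \<and> ?f x \<le> a \<longleftrightarrow> R x \<le> ereal a" for x a
        by (cases "x \<in> eff_dom R") (metis ereal_less_eq(3) fin, simp add: outside)
      then show ?thesis by simp
    qed
    then show "closed {(x, a). x \<in> eff_dom R \<and> ?f x \<le> a}" using assms(2)
        by (simp add: closed_fun_def)
    fix x assume x: "x \<in> eff_dom R"
    have "ereal \<beta> \<le> R x" unfolding \<beta>[symmetric] by (rule INF_lower) simp
    then show "\<beta> \<le> ?f x" by (metis ereal_less_eq(3) fin[OF x])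
  qed
  moreover have "closed_convex_function.subgrad (eff_dom R) ?f x \<xi> \<longleftrightarrow> \<xi> \<in> subdiff R x" for x \<xi>
    unfolding closed_convex_function.subgrad_def[OF ccf]
  proof
    assume A: "x \<in> eff_dom R \<and> (\<forall>z\<in>eff_dom R. ?f x + \<xi> \<bullet> (z - x) \<le> ?f z)"
    have "R x + ereal (\<xi> \<bullet> (z - x)) \<le> R z" for z
    proof (cases "z \<in> eff_dom R")
      case True
      then show ?thesis using A fin[OF True] fin[of x]
          by (metis ereal_less_eq(3) plus_ereal.simps(1))
    qed (simp add: outside)
    then show "\<xi> \<in> subdiff R x" unfolding subdiff_def by simp
  next
    assume A: "\<xi> \<in> subdiff R x"
    then have x: "x \<in> eff_dom R" using subdiff_imp_eff_dom[OF assms(1)] by blast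
    moreover have "?f x + \<xi> \<bullet> (z - x) \<le> ?f z" if z: "z \<in> eff_dom R" for z
    proof -
      have "R x + ereal (\<xi> \<bullet> (z - x)) \<le> R z" using A unfolding subdiff_def by simp
      then show ?thesis using fin[OF x] fin[OF z] by (metis ereal_less_eq(3) plus_ereal.simps(1))
    qed
    ultimately show "x \<in> eff_dom R \<and> (\<forall>z\<in>eff_dom R. ?f x + \<xi> \<bullet> (z - x) \<le> ?f z)" by blast
  qed
  ultimately show thesis by (rule that)
qed

section \<open>The ensemble system\<close>

lemma sym_pos_def_invertible:
  fixes N :: "real^'n^'n"
  assumes "sym_pos_def N"
  shows "invertible N"
proof -
  have "x = 0" if "N *v x = 0" for x
  proof (rule ccontr)
    assume "x \<noteq> 0"
    then have "0 < x \<bullet> (N *v x)" using assms by (simp add: sym_pos_def_def)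
    then show False using that by simp
  qed
  then have "\<exists>B. B ** N = mat 1" by (simp add: matrix_left_invertible_ker)
  then show ?thesis by (simp add: invertible_left_inverse)
qed

lemma matrix_inv_inverse:
  fixes N :: "real^'n^'n"
  assumes "sym_pos_def N"
  shows "N *v (matrix_inv N *v x) = x" "matrix_inv N *v (N *v x) = x"
proof -
  have "\<exists>B. N ** B = mat 1 \<and> B ** N = mat 1"
    using sym_pos_def_invertible[OF assms] by (simp add: invertible_def)
  from someI_ex[OF this] have "N ** matrix_inv N = mat 1" "matrix_inv N ** N = mat 1"
    unfolding matrix_inv_def by auto
  then show "N *v (matrix_inv N *v x) = x" "matrix_inv N *v (N *v x) = x"
    by (simp_all add: matrix_vector_mul_assoc)
qed

lemma sym_pos_def_spd_map:
  fixes N :: "real^'n^'n"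
  assumes "sym_pos_def N"
  shows "spd_map (\<lambda>v. N *v v)"
  unfolding spd_map_def
proof (intro conjI allI impI)
  show "linear (\<lambda>v. N *v v)" by simp
  show "(N *v x) \<bullet> y = x \<bullet> (N *v y)" for x y
    using assms dot_lmul_matrix[of x N y] by (simp add: sym_pos_def_def
        transpose_matrix_vector[symmetric])
  show "0 < x \<bullet> (N *v x)" if "x \<noteq> 0" for x using assms that by (simp add: sym_pos_def_def)
qed

lemma sym_pos_def_inverse_spd_map:
  fixes N :: "real^'n^'n"
  assumes N: "sym_pos_def N"
  shows "spd_map (\<lambda>v. matrix_inv N *v v)"
  unfolding spd_map_def
proof (intro conjI allI impI)
  let ?I = "\<lambda>v. matrix_inv N *v v"
  note sa = sym_pos_def_spd_map[OF N]
  show "linear ?I" by simp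
  show "?I x \<bullet> y = x \<bullet> ?I y" for x y
    using spd_map_sym[OF sa, of "?I x" "?I y"] by (simp add: matrix_inv_inverse[OF N])
  show "0 < x \<bullet> ?I x" if "x \<noteq> 0" for x
  proof -
    have "?I x \<noteq> 0" using that matrix_inv_inverse(1)[OF N, of x] by auto
    then have "0 < ?I x \<bullet> (N *v ?I x)" using N by (simp add: sym_pos_def_def)
    then show ?thesis by (simp add: matrix_inv_inverse[OF N] inner_commute)
  qed
qed

text \<open>The data term is in general only semidefinite, as \<open>A\<close> may have a kernel;
  definiteness comes from the Tikhonov term.\<close>

lemma precision_spd_map:
  fixes A :: "real^'d^'k" and \<Gamma> :: "real^'k^'k" and C\<^sub>0 :: "real^'d^'d"
  assumes \<Gamma>: "sym_pos_def \<Gamma>" and C\<^sub>0: "sym_pos_def C\<^sub>0"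
  shows "spd_map (\<lambda>v. (transpose A ** matrix_inv \<Gamma> ** A + matrix_inv C\<^sub>0) *v v)"
proof -
  define g where "g u = transpose A *v u" for u
  have eq: "(transpose A ** matrix_inv \<Gamma> ** A + matrix_inv C\<^sub>0) *v v = g (matrix_inv \<Gamma> *v (A *v v))
      + matrix_inv C\<^sub>0 *v v" for v
    by (simp add: g_def matrix_vector_mult_add_rdistrib matrix_vector_mul_assoc matrix_mul_assoc)
  have tr: "g u \<bullet> x = u \<bullet> (A *v x)" for u x
    using dot_lmul_matrix[of u A x] by (simp add: g_def transpose_matrix_vector)
  have tr': "x \<bullet> g u = (A *v x) \<bullet> u" for u x
    using tr by (simp add: inner_commute)
  note G = sym_pos_def_inverse_spd_map[OF \<Gamma>] and C = sym_pos_def_inverse_spd_map[OF C\<^sub>0]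
  show ?thesis unfolding spd_map_def
  proof (intro conjI allI impI)
    show "linear (\<lambda>v. (transpose A ** matrix_inv \<Gamma> ** A + matrix_inv C\<^sub>0) *v v)" by simp
    show "((transpose A ** matrix_inv \<Gamma> ** A + matrix_inv C\<^sub>0) *v x) \<bullet> y
        = x \<bullet> ((transpose A ** matrix_inv \<Gamma> ** A + matrix_inv C\<^sub>0) *v y)" for x y
      unfolding eq inner_add_left inner_add_right tr tr' spd_map_sym[OF G] spd_map_sym[OF C] ..
    show "0 < x \<bullet> ((transpose A ** matrix_inv \<Gamma> ** A + matrix_inv C\<^sub>0) *v x)" if "x \<noteq> 0" for x
    proof -
      have "0 < x \<bullet> (matrix_inv C\<^sub>0 *v x)" using C that by (simp add: spd_map_def)
      moreover have "0 \<le> (A *v x) \<bullet> (matrix_inv \<Gamma> *v (A *v x))" using spd_map_nonneg[OF G] by simp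
      ultimately show ?thesis unfolding eq inner_add_right tr' by simp
    qed
  qed
qed

section \<open>The covariance and the deviation equation\<close>

lemma outer_product_mult:
  fixes a v :: "real^'d"
  shows "((columnvector a :: real^1^'d) ** transpose (columnvector a)) *v v = (a \<bullet> v) *\<^sub>R a"
  by (simp add: vec_eq_iff matrix_vector_mult_def matrix_matrix_mult_def columnvector_def
      transpose_def
      inner_vec_def sum_distrib_left mult_ac)

lemma matrix_vector_mult_sum_left: "(\<Sum>i\<in>I. F i) *v v = (\<Sum>i\<in>I. F i *v v)" for F :: "'i \<Rightarrow> real^'n^'m"
  by (induction I rule: infinite_finite_induct) (simp_all add: matrix_vector_mult_add_rdistrib)

text \<open>As a sum of rank-one maps, the covariance sees a vector only through its pairings with
  the deviations; this is where the conserved pairings enter.\<close>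

lemma dev_cov_mult:
  fixes e :: "real^'d^'j"
  shows "dev_cov e *v v = (1 / real CARD('j)) *\<^sub>R (\<Sum>j\<in>UNIV. (e $ j \<bullet> v) *\<^sub>R (e $ j))"
  by (simp add: dev_cov_def scaleR_matrix_vector_assoc[symmetric] matrix_vector_mult_sum_left
      outer_product_mult)

text \<open>The right-hand side of the deviation equation is the diagonal of a bounded trilinear map,
  hence locally Lipschitz.\<close>

definition dev_rhs :: "real^'d^'d \<Rightarrow> real^'d^'j \<Rightarrow> real^'d^'j" where
  "dev_rhs N e = (\<chi> j. - (dev_cov e *v (N *v (e $ j))))"

lemma dev_rhs_Lipschitz:
  fixes N :: "real^'d^'d"
  assumes "0 \<le> B"
  obtains L where "0 \<le> L"
    "\<And>e e' :: real^'d^'j. norm e \<le> B \<Longrightarrow> norm e' \<le> B \<Longrightarrow> norm (dev_rhs N e - dev_rhs N e') \<le> L * norm (e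
        - e')"
proof -
  obtain BN where BN: "0 < BN" "\<And>x. norm (N *v x) \<le> BN * norm x"
    using linear_bounded_pos[OF matrix_vector_mul_linear[of N]] by blast
  \<comment> \<open>The slot \<open>a\<close> carries the output vectors, \<open>b\<close> and
    \<open>c\<close> the pairing; the diagonal is \<open>dev_rhs N\<close>.\<close>
  define T :: "real^'d^'j \<Rightarrow> real^'d^'j \<Rightarrow> real^'d^'j \<Rightarrow> real^'d^'j" where
    "T a b c = (\<chi> j. - ((1 / real CARD('j)) *\<^sub>R (\<Sum>i\<in>UNIV. (b $ i \<bullet> (N *v (c $ j))) *\<^sub>R (a $ i))))"
        for a b c
  have vn: "norm (x $ i) \<le> norm x" for x :: "real^'d^'j" and i
    by (rule Finite_Cartesian_Product.norm_nth_le)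
  have T_bound: "norm (T a b c) \<le> real CARD('j) * BN * (norm a * norm b * norm c)" for a b c
  proof -
    have 1: "norm (T a b c $ j) \<le> BN * (norm a * norm b * norm c)" for j
    proof -
      have "norm (\<Sum>i\<in>UNIV. (b $ i \<bullet> (N *v (c $ j))) *\<^sub>R (a $ i))
          \<le> (\<Sum>i\<in>(UNIV::'j set). BN * (norm a * norm b * norm c))"
      proof (rule sum_norm_le)
        fix i :: 'j
        have "\<bar>b $ i \<bullet> (N *v (c $ j))\<bar> \<le> norm (b $ i) * norm (N *v (c $ j))"
            by (rule Cauchy_Schwarz_ineq2)
        also have "\<dots> \<le> norm b * (BN * norm c)"
        proof (intro mult_mono)
          have "norm (N *v (c $ j)) \<le> BN * norm (c $ j)" by (rule BN(2))
          also have "\<dots> \<le> BN * norm c" using BN(1) vn by (intro mult_left_mono) auto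
          finally show "norm (N *v (c $ j)) \<le> BN * norm c" .
        qed (use vn in auto)
        finally have "\<bar>b $ i \<bullet> (N *v (c $ j))\<bar> * norm (a $ i) \<le> norm b * (BN * norm c) * norm a"
          using vn[of a i] BN(1) by (intro mult_mono) auto
        then show "norm ((b $ i \<bullet> (N *v (c $ j))) *\<^sub>R (a $ i)) \<le> BN * (norm a * norm b * norm c)"
          by (simp add: mult_ac)
      qed
      also have "\<dots> = real CARD('j) * (BN * (norm a * norm b * norm c))" by simp
      finally show ?thesis by (simp add: T_def field_simps)
    qed
    have "norm (T a b c) \<le> (\<Sum>j\<in>UNIV. norm (T a b c $ j))"
      unfolding norm_vec_def by (rule L2_set_le_sum) simp
    also have "\<dots> \<le> (\<Sum>j\<in>(UNIV::'j set). BN * (norm a * norm b * norm c))" by (rule sum_mono) (rule 1)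
    finally show ?thesis by (simp add: mult_ac)
  qed
  have T_diag: "dev_rhs N e = T e e e" for e :: "real^'d^'j"
    by (simp add: dev_rhs_def T_def dev_cov_mult)
  \<comment> \<open>Telescoping through the three slots, one difference at a time; this is the
    origin of the factor 3 in the constant.\<close>
  have decomp: "T e e e - T e' e' e' = T (e - e') e e + T e' (e - e') e + T e' e' (e - e')" for e e'
    by (simp add: T_def vec_eq_iff matrix_vector_mult_diff_distrib inner_diff_left inner_diff_right
        scaleR_diff_left
        scaleR_diff_right sum_subtractf algebra_simps)
  show thesis
  proof (rule that[of "real CARD('j) * BN * (3 * B * B)"])
    show "0 \<le> real CARD('j) * BN * (3 * B * B)" using BN(1) assms by simp
    fix e e' :: "real^'d^'j"
    assume e: "norm e \<le> B" "norm e' \<le> B"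
    have "norm (dev_rhs N e - dev_rhs N e') \<le> norm (T (e - e') e e) + norm (T e' (e - e') e)
        + norm (T e' e' (e - e'))"
      unfolding T_diag decomp by (intro norm_triangle_le add_mono order_refl norm_triangle_ineq)
    also have "\<dots> \<le> real CARD('j) * BN * (norm (e - e') * B * B) + real CARD('j) * BN * (B * norm (e
        - e') * B)
        + real CARD('j) * BN * (B * B * norm (e - e'))"
      using e BN(1) assms by (intro add_mono order_trans[OF T_bound] mult_left_mono mult_mono) auto
    also have "\<dots> = real CARD('j) * BN * (3 * B * B) * norm (e - e')" by (simp add: algebra_simps)
    finally show "norm (dev_rhs N e - dev_rhs N e') \<le> real CARD('j) * BN * (3 * B * B) * norm (e
        - e')" .
  qed
qed

section \<open>Exceptional sets, components and measurable derivatives\<close>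

lemma AE_lebesgue_on_obtain_negligible:
  assumes "AE t in lebesgue_on S. Pr t" "S \<in> sets lebesgue"
  obtains N where "negligible N" "\<And>t. t \<in> S - N \<Longrightarrow> Pr t"
proof -
  have "AE t in lebesgue. t \<in> S \<longrightarrow> Pr t" using assms by (simp add: AE_restrict_space_iff)
  then obtain N where "N \<in> null_sets lebesgue" "{t. \<not> (t \<in> S \<longrightarrow> Pr t)} \<subseteq> N"
    unfolding eventually_ae_filter by auto
  then show thesis using that[of N] by (auto simp: negligible_iff_null_sets)
qed

lemma AE_lebesgue_onI:
  assumes "negligible N" "S \<in> sets lebesgue" "\<And>t. t \<in> S - N \<Longrightarrow> Pr t"
  shows "AE t in lebesgue_on S. Pr t"
proof -
  have "AE t in lebesgue. t \<notin> N" using assms(1) by (simp add: negligible_iff_null_sets AE_not_in)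
  then have "AE t in lebesgue. t \<in> S \<longrightarrow> Pr t" by (rule eventually_mono) (use assms(3) in auto)
  then show ?thesis using assms(2) by (simp add: AE_restrict_space_iff)
qed

lemma abs_continuous_on_bounded_linear:
  assumes "bounded_linear h" "abs_continuous_on S f"
  shows "abs_continuous_on S (\<lambda>t. h (f t))"
proof -
  obtain K where K: "0 < K" "\<And>x. norm (h x) \<le> norm x * K"
      using bounded_linear.pos_bounded[OF assms(1)] by blast
  show ?thesis
  proof (rule abs_continuous_on_comb[OF assms(2) assms(2), of K])
    fix a b
    have "norm (h (f b) - h (f a)) = norm (h (f b - f a))"
        by (simp add: linear_diff[OF bounded_linear.linear[OF assms(1)]])
    also have "\<dots> \<le> K * norm (f b - f a)" using K(2) by (simp add: mult.commute)
    also have "\<dots> \<le> K * (norm (f b - f a) + norm (f b - f a))" using K(1)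
        by (intro mult_left_mono) auto
    finally show "norm (h (f b) - h (f a)) \<le> K * (norm (f b - f a) + norm (f b - f a))" .
  qed (use K in simp)
qed

lemma abs_continuous_on_cong:
  assumes "abs_continuous_on S f" "\<And>t. t \<in> S \<Longrightarrow> f t = g t"
  shows "abs_continuous_on S g"
  by (rule abs_continuous_on_comb[OF assms(1) assms(1), of 1]) (simp_all flip: assms(2))

lemma abs_continuous_on_Pair:
  assumes "abs_continuous_on S f" "abs_continuous_on S g"
  shows "abs_continuous_on S (\<lambda>t. (f t, g t))"
proof (rule abs_continuous_on_comb[OF assms, of 1])
  fix a b show "norm ((f b, g b) - (f a, g a)) \<le> 1 * (norm (f b - f a) + norm (g b - g a))"
    using norm_Pair_le[of "f b - f a" "g b - g a"] by simp
qed simp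

lemma bounded_linear_axis: "bounded_linear (axis j :: real^'d \<Rightarrow> real^'d^'j)"
  unfolding linear_conv_bounded_linear[symmetric]
  by (rule linearI) (auto simp: axis_def vec_eq_iff)

lemma abs_continuous_on_vec_lambda:
  fixes f :: "'j::finite \<Rightarrow> real \<Rightarrow> real^'d"
  assumes "\<And>j. abs_continuous_on S (f j)"
  shows "abs_continuous_on S (\<lambda>t. \<chi> j. f j t)"
proof -
  have "abs_continuous_on S (\<lambda>t. \<Sum>j\<in>I. axis j (f j t) :: real^'d^'j)" if "finite I"
      for I :: "'j set"
    using that
  proof induction
    case empty
    show ?case by (rule abs_continuous_onI_Lipschitz[OF abs_continuous_on_ident, of 0]) auto
  next
    case (insert j I)
    then show ?case using assms
      by (simp add: abs_continuous_on_add abs_continuous_on_bounded_linear[OF bounded_linear_axis])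
  qed
  from this[of UNIV] have "abs_continuous_on S (\<lambda>t. \<Sum>j\<in>UNIV. axis j (f j t) :: real^'d^'j)" by simp
  then show ?thesis by (rule abs_continuous_on_cong) (simp add: vec_eq_iff axis_def if_distrib
      sum.delta cong: if_cong)
qed

lemma has_vector_derivative_vec_lambda:
  fixes f :: "'j::finite \<Rightarrow> real \<Rightarrow> real^'d"
  assumes "\<And>j. (f j has_vector_derivative f' j) F"
  shows "((\<lambda>t. \<chi> j. f j t) has_vector_derivative (\<chi> j. f' j)) F"
proof -
  have eq: "(\<Sum>j\<in>UNIV. axis j (g j)) = (\<chi> j. g j)" for g :: "'j \<Rightarrow> real^'d"
    by (simp add: vec_eq_iff axis_def if_distrib sum.delta cong: if_cong)
  have "((\<lambda>t. \<Sum>j\<in>UNIV. axis j (f j t) :: real^'d^'j) has_vector_derivative (\<Sum>j\<in>UNIV. axis j (f' j)))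
      F"
    unfolding has_vector_derivative_def scaleR_sum_right
    by (intro has_derivative_sum) (use bounded_linear.has_derivative[OF bounded_linear_axis
        assms[unfolded has_vector_derivative_def]]
      in \<open>simp add: linear_scale[OF bounded_linear.linear[OF bounded_linear_axis]]\<close>)
  then show ?thesis unfolding eq .
qed

lemma has_vector_derivative_Pair:
  assumes "(f has_vector_derivative f') (at t within A)" "(g has_vector_derivative g') (at t within
      A)"
  shows "((\<lambda>s. (f s, g s)) has_vector_derivative (f', g')) (at t within A)"
  using has_derivative_Pair[OF assms[unfolded has_vector_derivative_def]]
  by (simp add: has_vector_derivative_def)

text \<open>The limit of forward difference quotients is measurable and agrees with the derivative
  wherever the latter exists; it serves as the measurable selection in the notion of solution.
  Continuity is asked on all of \<open>{0..}\<close> because the quotient at \<open>T\<close>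
  reaches beyond \<open>T\<close>.\<close>

lemma measurable_derivative:
  fixes u :: "real \<Rightarrow> 'a::euclidean_space"
  assumes cont: "continuous_on {0..} u"
  obtains w where "w \<in> borel_measurable (lebesgue_on {0..T})"
    "\<And>t v. 0 < t \<Longrightarrow> (u has_vector_derivative v) (at t) \<Longrightarrow> w t = v"
proof -
  define q where "q n t = real (Suc n) *\<^sub>R (u (t + 1 / real (Suc n)) - u t)" for n t
  have meas: "q n \<in> borel_measurable (lebesgue_on {0..T})" for n
  proof (rule continuous_imp_measurable_on_sets_lebesgue)
    show "continuous_on {0..T} (q n)" unfolding q_def
      by (intro continuous_intros continuous_on_compose2[OF cont]) auto
  qed simp
  show thesis
  proof (rule that[of "\<lambda>t. lim (\<lambda>n. q n t)"])
    show "(\<lambda>t. lim (\<lambda>n. q n t)) \<in> borel_measurable (lebesgue_on {0..T})"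
      by (rule borel_measurable_lim_metric[OF meas])
    fix t v assume t: "0 < t" and v: "(u has_vector_derivative v) (at t)"
    have "(\<lambda>n. q n t) \<longlonglongrightarrow> v"
    proof (rule LIMSEQ_I)
      fix e :: real assume "0 < e"
      then have e2: "0 < e / 2" by simp
      obtain d where d: "d > 0" "\<And>y. norm (y - t) < d \<Longrightarrow> norm (u y - u t - (y - t) *\<^sub>R v)
          \<le> e / 2 * norm (y - t)"
        using v e2 unfolding has_vector_derivative_def has_derivative_within_alt by blast
      obtain n0 where n0: "1 / real (Suc n0) < d" using reals_Archimedean[OF d(1)]
          by (auto simp: inverse_eq_divide)
      have "norm (q n t - v) < e" if "n0 \<le> n" for n
      proof -
        define k where "k = real (Suc n)"
        have k: "0 < k" by (simp add: k_def)
        have "1 / k \<le> 1 / real (Suc n0)" using that unfolding k_def by (intro divide_left_mono) auto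
        then have "norm (u (t + 1 / k) - u t - (1 / k) *\<^sub>R v) \<le> e / 2 * (1 / k)"
          using d(2)[of "t + 1 / k"] n0 k by simp
        then have "k * norm (u (t + 1 / k) - u t - (1 / k) *\<^sub>R v) \<le> k * (e / 2 * (1 / k))"
          using k by (intro mult_left_mono) auto
        also have "\<dots> = e / 2" using k by simp
        also have "k * norm (u (t + 1 / k) - u t - (1 / k) *\<^sub>R v) = norm (k *\<^sub>R (u (t + 1 / k) - u t
            - (1 / k) *\<^sub>R v))"
          using k by simp
        also have "k *\<^sub>R (u (t + 1 / k) - u t - (1 / k) *\<^sub>R v) = q n t - v"
          unfolding q_def k_def[symmetric] using k by (simp add: scaleR_diff_right)
        finally show ?thesis using \<open>0 < e\<close> by simp
      qed
      then show "\<exists>n0. \<forall>n\<ge>n0. norm (q n t - v) < e" by blast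
    qed
    then show "lim (\<lambda>n. q n t) = v" by (rule limI)
  qed
qed

text \<open>A zero sum of the deviations makes the splitting into mean and deviations unique, so the
  two can be constructed separately and then assembled.\<close>

lemma ens_mean_dev:
  fixes m :: "real^'d" and e :: "real^'d^'j"
  assumes "(\<Sum>j\<in>UNIV. e $ j) = 0"
  shows "ens_mean (\<chi> j. m + e $ j) = m" "ens_dev (\<chi> j. m + e $ j) = e"
proof -
  have "(\<Sum>j\<in>(UNIV::'j set). m + e $ j) = real CARD('j) *\<^sub>R m"
    by (simp add: sum.distrib assms scaleR_conv_of_real sum_constant_scaleR)
  then show 1: "ens_mean (\<chi> j. m + e $ j) = m" by (simp add: ens_mean_def)
  show "ens_dev (\<chi> j. m + e $ j) = e" by (simp add: ens_dev_def 1 vec_eq_iff)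
qed

lemma ens_dev_sum: "(\<Sum>j\<in>UNIV. ens_dev x $ j) = 0" for x :: "real^'d^'j"
  by (simp only: ens_dev_def vec_lambda_beta sum_subtractf sum_constant_scaleR ens_mean_def
      scaleR_scaleR) simp

lemma ens_reconstruct: "x $ j = ens_mean x + ens_dev x $ j"
  by (simp add: ens_dev_def)

theorem theorem3p1:
  fixes A :: "real^'d^'k" and y :: "real^'k"
    and \<Gamma> :: "real^'k^'k" and C\<^sub>0 :: "real^'d^'d"
    and R :: "real^'d \<Rightarrow> ereal" and x\<^sub>0 :: "real^'d^'j"
  assumes "sym_pos_def \<Gamma>" and "sym_pos_def C\<^sub>0" and "CARD('j) \<ge> 2"
    and "proper_fun R" and "closed_fun R" and "convex_fun R" and "lsc_fun R"
    and "(INF x. R x) > -\<infinity>"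
    and "sym_pos_def (dev_cov (ens_dev x\<^sub>0))"
    and "ens_mean x\<^sub>0 \<in> closure (eff_dom R)"
  shows "\<forall>T>0. \<exists>x :: real \<Rightarrow> real^'d^'j.
           continuous_on {0..T} x \<and> eki_solution A y \<Gamma> C\<^sub>0 R T x \<and> x 0 = x\<^sub>0 \<and>
           (\<forall>x'. eki_solution A y \<Gamma> C\<^sub>0 R T x' \<and> x' 0 = x\<^sub>0 \<longrightarrow> (\<forall>t\<in>{0..T}. x' t = x t))"
proof (intro allI impI)
  fix T :: real assume T: "0 < T"
  define C where "C = dev_cov (ens_dev x\<^sub>0)"
  define H where "H = transpose A ** matrix_inv \<Gamma> ** A + matrix_inv C\<^sub>0"
  define P where "P v = matrix_inv C *v v" for v
  define M where "M v = H *v v" for v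
  define b where "b = transpose A *v (matrix_inv \<Gamma> *v y)"
  have C: "sym_pos_def C" using assms(9) by (simp add: C_def)
  have P: "spd_map P" unfolding P_def[abs_def] by (rule sym_pos_def_inverse_spd_map[OF C])
  have M: "spd_map M" unfolding M_def[abs_def] H_def by (rule precision_spd_map[OF assms(1,2)])
  define D where "D = eff_dom R"
  define f where "f = (\<lambda>x. real_of_ereal (R x))"
  obtain \<beta> where raw: "closed_convex_function (eff_dom R) (\<lambda>x. real_of_ereal (R x)) \<beta>"
    "\<And>x \<xi>. closed_convex_function.subgrad (eff_dom R) (\<lambda>x. real_of_ereal (R x)) x \<xi>
        \<longleftrightarrow> \<xi> \<in> subdiff R x"
    by (rule closed_convex_function_of_ereal[OF assms(4,5,6,8)], rule that) blast+
  note ccf = raw(1)[folded D_def f_def] and subgrad = raw(2)[folded D_def f_def]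
  interpret F: moving_metric_flow D f \<beta> P M b
    by (intro moving_metric_flow.intro ccf moving_metric_flow_axioms.intro P M)
  have S_lin: "linear (F.S t)" if "0 \<le> t" for t using that by (intro spd_map_linear F.S_spd_map)

  have x0D: "ens_mean x\<^sub>0 \<in> closure D" using assms(10) by (simp add: D_def)
  obtain m where m: "m 0 = ens_mean x\<^sub>0" "continuous_on {0..} m" "\<And>T. 0 < T
      \<Longrightarrow> abs_continuous_on {0..T} m"
    and m_der: "negligible {t. 0 < t \<and> \<not> (\<exists>v. (m has_vector_derivative v) (at t) \<and> F.flows m t v)}"
    by (rule F.flow_exists[OF x0D], rule that) (assumption | blast)+
  obtain G where G: "\<And>x. G 0 x = x" "\<And>x. continuous_on {0..} (\<lambda>t. G t x)"
    "\<And>x T. 0 < T \<Longrightarrow> abs_continuous_on {0..T} (\<lambda>t. G t x)"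
    and G_der: "\<And>x. negligible {t. 0 < t \<and> \<not> (\<exists>v. ((\<lambda>s. G s x) has_vector_derivative v) (at t) \<and> P v
        + (2 * t) *\<^sub>R M v = - M (G t x))}"
    and G_lin: "\<And>t. 0 \<le> t \<Longrightarrow> linear (G t)"
    and G_cons: "\<And>t x y. 0 \<le> t \<Longrightarrow> (P (G t x) + (2 * t) *\<^sub>R M (G t x)) \<bullet> G t y = P x \<bullet> y"
    by (rule linear_flow[OF P M], rule that) (assumption | blast)+

  \<comment> \<open>All deviations are transported by the same linear map, so their zero sum
    persists.\<close>
  define e :: "real \<Rightarrow> real^'d^'j" where "e t = (\<chi> j. G t (ens_dev x\<^sub>0 $ j))" for t
  have e_sum: "(\<Sum>j\<in>UNIV. e t $ j) = 0" if "0 \<le> t" for t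
  proof -
    have "(\<Sum>j\<in>UNIV. e t $ j) = G t (\<Sum>j\<in>UNIV. ens_dev x\<^sub>0 $ j)"
      by (simp add: e_def linear_sum[OF G_lin[OF that]])
    then show ?thesis by (simp add: ens_dev_sum linear_0[OF G_lin[OF that]])
  qed

  text \<open>The covariance of the deviations is the inverse of the moving metric: \<open>G t\<close> is an isometry
    from the metric at time \<open>0\<close> to the one at time \<open>t\<close>.\<close>

  have cov: "dev_cov (e t) *v (F.S t v) = v" "F.S t (dev_cov (e t) *v v) = v" if t: "0 \<le> t" for t v
  proof -
    have "inj (G t)"
    proof (rule linear_injective_0[OF G_lin[OF t], THEN iffD2], intro allI impI)
      fix x assume "G t x = 0"
      then have "P x \<bullet> x = 0" using G_cons[OF t, of x x] by simp
      then show "x = 0" using P by (metis inner_commute less_irrefl spd_map_def)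
    qed
    then have G_surj: "surj (G t)" using linear_injective_imp_surjective[OF G_lin[OF t]] by blast
    have left: "dev_cov (e t) *v (F.S t v) = v" for v
    proof -
      obtain x where x: "v = G t x" using G_surj by (metis surjD)
      have i: "e t $ j \<bullet> F.S t v = ens_dev x\<^sub>0 $ j \<bullet> P x" for j
        using G_cons[OF t, of x "ens_dev x\<^sub>0 $ j"] by (simp add: e_def F.S_def x inner_commute)
      have "dev_cov (e t) *v (F.S t v) = (1 / real CARD('j)) *\<^sub>R (\<Sum>j\<in>UNIV. (ens_dev x\<^sub>0 $ j \<bullet> P x)
          *\<^sub>R G t (ens_dev x\<^sub>0 $ j))"
        unfolding dev_cov_mult i by (simp add: e_def)
      also have "\<dots> = G t (dev_cov (ens_dev x\<^sub>0) *v P x)"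
        unfolding dev_cov_mult by (simp add: linear_scale[OF G_lin[OF t]] linear_sum[OF G_lin[OF
            t]])
      also have "dev_cov (ens_dev x\<^sub>0) *v P x = x"
        unfolding P_def C_def[symmetric] by (rule matrix_inv_inverse(1)[OF C])
      finally show ?thesis by (simp add: x)
    qed
    then show "dev_cov (e t) *v (F.S t v) = v" .
    \<comment> \<open>In finite dimension the one-sided inverse is two-sided.\<close>
    have "inj (F.S t)" by (rule inj_on_inverseI[where g = "\<lambda>v. dev_cov (e t) *v v"]) (rule left)
    then have "surj (F.S t)" using linear_injective_imp_surjective[OF S_lin[OF t]] by blast
    then obtain w where "v = F.S t w" by (metis surjD)
    then show "F.S t (dev_cov (e t) *v v) = v" by (simp add: left)
  qed

  \<comment> \<open>Writing \<open>p\<close> as the covariance applied to \<open>F.S t p\<close>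
    lets the covariance be factored out of the whole mean equation.\<close>
  have mean_eq: "p + dev_cov (e t) *v (transpose A *v (matrix_inv \<Gamma> *v (A *v n - y)))
      + dev_cov (e t) *v (matrix_inv C\<^sub>0 *v n)
      = dev_cov (e t) *v (F.S t p + M n - b)" if "0 \<le> t" for t p n
  proof -
    let ?K = "dev_cov (e t)"
    have "M n = transpose A *v (matrix_inv \<Gamma> *v (A *v n)) + matrix_inv C\<^sub>0 *v n"
      by (simp add: M_def H_def matrix_vector_mult_add_rdistrib matrix_vector_mul_assoc
          matrix_mul_assoc)
    moreover have "transpose A *v (matrix_inv \<Gamma> *v (A *v n - y))
        = transpose A *v (matrix_inv \<Gamma> *v (A *v n)) - b"
      by (simp only: b_def matrix_vector_mult_diff_distrib)
    ultimately have "M n - b = transpose A *v (matrix_inv \<Gamma> *v (A *v n - y)) + matrix_inv C\<^sub>0 *v n"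
      by (simp only:) simp
    then have "?K *v (F.S t p + M n - b) = ?K *v (F.S t p + (transpose A *v (matrix_inv \<Gamma> *v (A *v n
        - y)) + matrix_inv C\<^sub>0 *v n))"
      by (simp only: add_diff_eq[symmetric])
    then show ?thesis by (simp only: matrix_vector_right_distrib cov(1)[OF that] add.assoc)
  qed

  \<comment> \<open>The factored covariance is cancelled by applying its inverse
    \<open>F.S t\<close>; what remains for the mean is the gradient flow condition.\<close>
  have rhs: "(p, q) \<in> eki_rhs A y \<Gamma> C\<^sub>0 R t (n, e t) \<longleftrightarrow>
      closed_convex_function.subgrad D f n (- F.S t p - M n + b) \<and> q = dev_rhs H (e t)" if t: "0
          \<le> t" for t p q n
  proof -
    have "p + dev_cov (e t) *v (transpose A *v (matrix_inv \<Gamma> *v (A *v n - y)))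
        + dev_cov (e t) *v (matrix_inv C\<^sub>0 *v n)
        \<in> (\<lambda>\<xi>. - (dev_cov (e t) *v \<xi>)) ` subdiff R n \<longleftrightarrow> - F.S t p - M n + b \<in> subdiff R n"
      unfolding mean_eq[OF t]
    proof
      assume "dev_cov (e t) *v (F.S t p + M n - b) \<in> (\<lambda>\<xi>. - (dev_cov (e t) *v \<xi>)) ` subdiff R n"
      then obtain \<xi> where \<xi>: "\<xi> \<in> subdiff R n" "dev_cov (e t) *v (F.S t p + M n - b) =
          - (dev_cov (e t) *v \<xi>)" by blast
      then have "F.S t (dev_cov (e t) *v (F.S t p + M n - b)) = - F.S t (dev_cov (e t) *v \<xi>)"
        by (simp add: linear_neg[OF S_lin[OF t]])
      then have "F.S t p + M n - b = - \<xi>" by (simp only: cov(2)[OF t])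
      then have "- F.S t p - M n + b = \<xi>" by (simp add: algebra_simps eq_neg_iff_add_eq_0)
      with \<xi>(1) show "- F.S t p - M n + b \<in> subdiff R n" by simp
    next
      assume "- F.S t p - M n + b \<in> subdiff R n"
      moreover have "dev_cov (e t) *v (F.S t p + M n - b) = - (dev_cov (e t) *v (- F.S t p - M n
          + b))"
      proof -
        have "- F.S t p - M n + b = - (F.S t p + M n - b)" by simp
        then show ?thesis by (metis linear_neg matrix_vector_mul_linear minus_minus)
      qed
      ultimately show "dev_cov (e t) *v (F.S t p + M n - b) \<in> (\<lambda>\<xi>.
          - (dev_cov (e t) *v \<xi>)) ` subdiff R n"
        by blast
    qed
    moreover have "(\<forall>j. q $ j = - (dev_cov (e t) *v (H *v e t $ j))) \<longleftrightarrow> q = dev_rhs H (e t)"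
      by (simp add: dev_rhs_def vec_eq_iff)
    ultimately show ?thesis unfolding eki_rhs_def Let_def subgrad H_def[symmetric] by simp
  qed

  define x :: "real \<Rightarrow> real^'d^'j" where "x t = (\<chi> j. m t + e t $ j)" for t
  have x_parts: "ens_mean (x t) = m t" "ens_dev (x t) = e t" if "0 \<le> t" for t
    using ens_mean_dev[OF e_sum[OF that]] by (simp_all add: x_def)
  have x_init: "x 0 = x\<^sub>0"
    by (simp add: x_def e_def m(1) G(1) vec_eq_iff ens_reconstruct[symmetric, of x\<^sub>0])
  have e_cont: "continuous_on {0..} e" unfolding e_def[abs_def] using G(2)
      by (intro continuous_on_vec_lambda) auto
  have x_cont: "continuous_on {0..T} x"
  proof -
    have "continuous_on {0..} x" unfolding x_def[abs_def] by (intro continuous_intros m(2) e_cont)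
    then show ?thesis by (rule continuous_on_subset) auto
  qed
  have e_ac: "abs_continuous_on {0..T} e" unfolding e_def[abs_def]
      by (rule abs_continuous_on_vec_lambda) (rule G(3)[OF T])

  \<comment> \<open>Time \<open>0\<close> joins the exceptional set, since two-sided derivatives are
    available only at positive times.\<close>
  define N where "N = {0} \<union> {t. 0 < t \<and> \<not> (\<exists>v. (m has_vector_derivative v) (at t)
      \<and> F.flows m t v)} \<union>
    (\<Union>j. {t. 0 < t \<and> \<not> (\<exists>v. ((\<lambda>s. G s (ens_dev x\<^sub>0 $ j)) has_vector_derivative v) (at t) \<and> P v
        + (2 * t) *\<^sub>R M v = - M (G t (ens_dev x\<^sub>0 $ j)))})"
  have N: "negligible N" unfolding N_def
    by (intro negligible_Un negligible_sing m_der negligible_Union) (use G_der in auto)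
  have m_der': "\<exists>v. (m has_vector_derivative v) (at t) \<and> F.flows m t v" if "t \<in> {0..T} - N" for t
    using that unfolding N_def by auto
  have e_der: "(e has_vector_derivative dev_rhs H (e t)) (at t)" if t: "t \<in> {0..T} - N" for t
  proof -
    have t0: "0 < t" using t unfolding N_def by auto
    have "((\<lambda>s. G s (ens_dev x\<^sub>0 $ j)) has_vector_derivative
        - (dev_cov (e t) *v (H *v (e t $ j)))) (at t)" for j
    proof -
      obtain v where v: "((\<lambda>s. G s (ens_dev x\<^sub>0 $ j)) has_vector_derivative v) (at t)"
        "P v + (2 * t) *\<^sub>R M v = - M (G t (ens_dev x\<^sub>0 $ j))"
        using t t0 unfolding N_def by blast
      have "v = dev_cov (e t) *v (F.S t v)" using cov(1) t0 by simp
      also have "F.S t v = - (H *v (e t $ j))" using v(2) by (simp add: F.S_def M_def e_def)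
      also have "dev_cov (e t) *v (- (H *v (e t $ j))) = - (dev_cov (e t) *v (H *v (e t $ j)))"
        by (rule linear_neg[OF matrix_vector_mul_linear])
      finally show ?thesis using v(1) by simp
    qed
    then show ?thesis unfolding e_def[abs_def] dev_rhs_def
      by (intro has_vector_derivative_vec_lambda) (simp add: e_def)
  qed

  have sol: "eki_solution A y \<Gamma> C\<^sub>0 R T x"
    unfolding eki_solution_def inclusion_solution_def
  proof (intro conjI)
    have eq: "(m t, e t) = (ens_mean (x t), ens_dev (x t))" if "t \<in> {0..T}" for t using x_parts that
        by simp
    show "abs_continuous_on {0..T} (\<lambda>t. (ens_mean (x t), ens_dev (x t)))"
      by (rule abs_continuous_on_cong[OF abs_continuous_on_Pair[OF m(3)[OF T] e_ac] eq])
    have me: "continuous_on {0..} (\<lambda>t. (m t, e t))" by (intro continuous_intros m(2) e_cont)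
    obtain w where w: "w \<in> borel_measurable (lebesgue_on {0..T})"
      "\<And>t v. 0 < t \<Longrightarrow> ((\<lambda>t. (m t, e t)) has_vector_derivative v) (at t) \<Longrightarrow> w t = v"
      by (rule measurable_derivative[OF me], rule that) (assumption | blast)+
    have "AE t in lebesgue_on {0..T}. w t \<in> eki_rhs A y \<Gamma> C\<^sub>0 R t (ens_mean (x t), ens_dev (x t)) \<and>
        ((\<lambda>t. (ens_mean (x t), ens_dev (x t))) has_vector_derivative w t) (at t within {0..T})"
    proof (rule AE_lebesgue_onI[OF N])
      fix t assume t: "t \<in> {0..T} - N"
      then have t0: "0 < t" unfolding N_def by auto
      obtain v where v: "(m has_vector_derivative v) (at t)" "F.flows m t v" using m_der'[OF t]
          by blast
      have der: "((\<lambda>t. (m t, e t)) has_vector_derivative (v, dev_rhs H (e t))) (at t)"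
        by (rule has_vector_derivative_Pair[OF v(1) e_der[OF t]])
      have wt: "w t = (v, dev_rhs H (e t))" by (rule w(2)[OF t0 der])
      have "w t \<in> eki_rhs A y \<Gamma> C\<^sub>0 R t (m t, e t)" unfolding wt using rhs t0 v(2)
          by (simp add: F.flows_def)
      moreover have "((\<lambda>t. (ens_mean (x t), ens_dev (x t))) has_vector_derivative w t) (at t within
          {0..T})"
        by (rule has_vector_derivative_transform[OF _ _ has_vector_derivative_at_within[OF
            der[folded wt]]])
          (use t x_parts in auto)
      ultimately show "w t \<in> eki_rhs A y \<Gamma> C\<^sub>0 R t (ens_mean (x t), ens_dev (x t)) \<and>
        ((\<lambda>t. (ens_mean (x t), ens_dev (x t))) has_vector_derivative w t) (at t within {0..T})"
        using t0 x_parts by simp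
    qed simp
    with w(1) show "\<exists>w\<in>borel_measurable (lebesgue_on {0..T}). AE t in lebesgue_on {0..T}.
        w t \<in> eki_rhs A y \<Gamma> C\<^sub>0 R t (ens_mean (x t), ens_dev (x t)) \<and>
        ((\<lambda>t. (ens_mean (x t), ens_dev (x t))) has_vector_derivative w t) (at t within {0..T})"
            by blast
  qed

  have unique: "x' t = x t" if sol': "eki_solution A y \<Gamma> C\<^sub>0 R T x'" and init: "x' 0 = x\<^sub>0"
      and t: "t \<in> {0..T}" for x' t
  proof -
    let ?u = "\<lambda>t. (ens_mean (x' t), ens_dev (x' t))"
    obtain w where acu: "abs_continuous_on {0..T} ?u"
      and "AE t in lebesgue_on {0..T}. w t \<in> eki_rhs A y \<Gamma> C\<^sub>0 R t (?u t)
          \<and> (?u has_vector_derivative w t) (at t within {0..T})"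
      using sol' unfolding eki_solution_def inclusion_solution_def by blast
    then obtain N' where N': "negligible N'"
      and w: "\<And>t. t \<in> {0..T} - N' \<Longrightarrow> w t \<in> eki_rhs A y \<Gamma> C\<^sub>0 R t (?u t)
          \<and> (?u has_vector_derivative w t) (at t within {0..T})"
      by (elim AE_lebesgue_on_obtain_negligible) auto
    define m' where "m' t = ens_mean (x' t)" for t
    define e' where "e' t = ens_dev (x' t)" for t
    have ac: "abs_continuous_on {0..T} m'" "abs_continuous_on {0..T} e'"
      using abs_continuous_on_bounded_linear[OF bounded_linear_fst acu]
        abs_continuous_on_bounded_linear[OF bounded_linear_snd acu]
            by (simp_all add: m'_def[abs_def] e'_def[abs_def])
    have der': "(m' has_vector_derivative fst (w t)) (at t within {0..T})" "(e'
        has_vector_derivative snd (w t)) (at t within {0..T})"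
      if "t \<in> {0..T} - N'" for t
      using bounded_linear.has_vector_derivative[OF bounded_linear_fst w[OF that, THEN conjunct2]]
        bounded_linear.has_vector_derivative[OF bounded_linear_snd w[OF that, THEN conjunct2]]
      by (simp_all add: m'_def[abs_def] e'_def[abs_def])
    have e'_rhs: "snd (w t) = dev_rhs H (e' t)" if "t \<in> {0..T} - N'" for t
      using w[OF that, THEN conjunct1]
      by (auto simp: eki_rhs_def Let_def dev_rhs_def vec_eq_iff H_def e'_def)
    have init_e: "e' 0 = e 0" "m' 0 = m 0" using x_parts[of 0] x_init init
        by (simp_all add: e'_def m'_def)
    \<comment> \<open>The deviation equation does not contain the mean, so it is settled first. Then
      the covariance of the second solution is also the inverse of \<open>F.S\<close>, and its mean
      satisfies the flow condition.\<close>
    have ee: "e' s = e s" if s: "s \<in> {0..T}" for s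
    proof -
      obtain B1 where B1: "0 < B1" "\<And>t. t \<in> {0..T} \<Longrightarrow> norm (e' t) \<le> B1"
        by (rule abs_continuous_on_bounded[OF ac(2)], rule that) blast+
      obtain B2 where B2: "0 < B2" "\<And>t. t \<in> {0..T} \<Longrightarrow> norm (e t) \<le> B2"
        by (rule abs_continuous_on_bounded[OF e_ac], rule that) blast+
      \<comment> \<open>Both curves stay in one ball, on which the cubic right-hand side has a
        single Lipschitz constant.\<close>
      have B: "0 \<le> max B1 B2" using B1(1) by simp
      obtain L where L: "0 \<le> L"
        "\<And>a b :: real^'d^'j. norm a \<le> max B1 B2 \<Longrightarrow> norm b \<le> max B1 B2 \<Longrightarrow> norm (dev_rhs H a
            - dev_rhs H b) \<le> L * norm (a - b)"
        by (rule dev_rhs_Lipschitz[OF B, of H], rule that) (assumption | blast)+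
      show ?thesis
      proof (rule ode_unique[OF T ac(2) e_ac init_e(1) negligible_Un[OF N N'] _ _ L(1) _ s])
        fix t assume t: "t \<in> {0..T} - (N \<union> N')"
        show "(e' has_vector_derivative dev_rhs H (e' t)) (at t within {0..T})"
            using der'(2) e'_rhs t by auto
        show "(e has_vector_derivative dev_rhs H (e t)) (at t within {0..T})"
          using e_der t by (auto intro: has_vector_derivative_at_within)
      next
        fix t assume "t \<in> {0..T}"
        then show "norm (dev_rhs H (e' t) - dev_rhs H (e t)) \<le> L * norm (e' t - e t)"
          using B1(2)[of t] B2(2)[of t] by (intro L(2)) auto
      qed
    qed
    have mm: "m' t = m t"
    proof (rule F.flow_unique[OF T ac(1) m(3)[OF T] init_e(2) negligible_Un[OF N N'] _ _ t])
      fix s assume s: "s \<in> {0..T} - (N \<union> N')"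
      then have s': "s \<in> {0..T} - N'" "s \<in> {0..T} - N" "0 \<le> s" by auto
      have "(fst (w s), snd (w s)) \<in> eki_rhs A y \<Gamma> C\<^sub>0 R s (m' s, e s)"
        using w[OF s'(1), THEN conjunct1] ee[of s] s by (simp add: m'_def e'_def)
      then have "F.flows m' s (fst (w s))" unfolding rhs[OF s'(3)] F.flows_def by blast
      then show "\<exists>v. (m' has_vector_derivative v) (at s within {0..T}) \<and> F.flows m' s v"
        using der'(1)[OF s'(1)] by blast
      show "\<exists>v. (m has_vector_derivative v) (at s within {0..T}) \<and> F.flows m s v"
        using m_der'[OF s'(2)] has_vector_derivative_at_within by blast
    qed
    show ?thesis
      using mm ee[OF t] ens_reconstruct[of "x' t"] by (simp add: x_def vec_eq_iff m'_def e'_def)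
  qed
  show "\<exists>x :: real \<Rightarrow> real^'d^'j.
           continuous_on {0..T} x \<and> eki_solution A y \<Gamma> C\<^sub>0 R T x \<and> x 0 = x\<^sub>0 \<and>
           (\<forall>x'. eki_solution A y \<Gamma> C\<^sub>0 R T x' \<and> x' 0 = x\<^sub>0 \<longrightarrow> (\<forall>t\<in>{0..T}. x' t = x t))"
    using x_cont sol x_init unique by blast
qed

end
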